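(* Restricted to dynamic network games $(G,R)$ in which $R$ contains no weak creation rule, the dynamic safety problem is in PSPACE (input size: size of the initial network plus size of $R$).
   Context: A network is $G=(V,E,A,S,(P_a)_{a\in\Sigma})$: finite node set $V$, undirected edges $E$, active nodes $A\subseteq V$, strong nodes $S\subseteq A$, and a partition $(P_a)_{a\in\Sigma}$ of $V$ into label classes; weak nodes are those in $A\setminus S$; the network is connected if the subgraph induced by $A$ is connected. In a dynamic network game $(G,R)$ ($G$ initial network, $R$ finite rule set), Destructor and Constructor alternate, Destructor first, both may skip. Destructor deletes one weak node. Constructor applies one rule of $R$: relabeling rules $\langle a,b\to c,d\rangle$ (relabel adjacent active nodes labeled $a,b$ to $c,d$; possibly several relabelings per turn), movement rules $\langle a\xrightarrow{\text{move}}b\rangle$ (for adjacent $u\in S\cap P_a$, $v\in P_b\setminus S$: $S:=(S\setminus\{u\})\cup\{v\}$, $A:=A\cup\{v\}$), and creation rules $\langle a_1,\dots,a_n\xrightarrow{\text{create}(c)}a'_1,\dots,a'_n\rangle$ (choose distinct strong $u_i$ labeled $a_i$, add a new active node labeled $c$ adjacent to all $u_i$, relabel $u_i$ to $a'_i$); a creation rule is weak if the new node is not strong and strong if it is added to $S$. The dynamic safety problem: given $(G,R)$ with $G$ connected, does Constructor have a strategy guaranteeing that every network in the play is connected? *)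

theory Defs
  imports Main
begin

section \<open>A Turing machine model and (promise) PSPACE\<close>

text \<open>Deterministic single-tape Turing machines. States and tape symbols are natural
  numbers below nstates / nsyms; symbol 0 is the blank. State 0 is the start state,
  state 1 accepts, state 2 rejects. Head moves are -1, 0, 1.\<close>

record tm =
  nstates :: nat
  nsyms :: nat
  delta :: "nat \<Rightarrow> nat \<Rightarrow> nat \<times> nat \<times> int"

definition valid_tm :: "tm \<Rightarrow> bool" where
  "valid_tm M \<longleftrightarrow> nstates M \<ge> 3 \<and> nsyms M \<ge> 1 \<and>
     (\<forall>q < nstates M. \<forall>s < nsyms M.
        (case delta M q s of (q', s', d) \<Rightarrow>
           q' < nstates M \<and> s' < nsyms M \<and> d \<in> {-1, 0, 1}))"

type_synonym config = "nat \<times> (int \<Rightarrow> nat) \<times> int"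

definition cstate :: "config \<Rightarrow> nat" where "cstate c = fst c"
definition chead :: "config \<Rightarrow> int" where "chead c = snd (snd c)"

definition halted_state :: "nat \<Rightarrow> bool" where
  "halted_state q \<longleftrightarrow> q = 1 \<or> q = 2"

definition tm_step :: "tm \<Rightarrow> config \<Rightarrow> config" where
  "tm_step M c = (case c of (q, t, h) \<Rightarrow>
     if halted_state q then (q, t, h)
     else (case delta M q (t h) of (q', s', d) \<Rightarrow> (q', t(h := s'), h + d)))"

definition tm_init :: "nat list \<Rightarrow> config" where
  "tm_init w = (0, (\<lambda>i. if 0 \<le> i \<and> i < int (length w) then w ! nat i else 0), 0)"

definition tm_run :: "tm \<Rightarrow> nat list \<Rightarrow> nat \<Rightarrow> config" where
  "tm_run M w n = (tm_step M ^^ n) (tm_init w)"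

text \<open>The promise problem ``given x with P x, decide whether Q x'', with instances
  encoded as strings by enc, is in PSPACE: a valid TM halts on every promise input,
  answers correctly, and its head never leaves the cells [-p(n), p(n)] for a
  polynomial bound p(n) = c * (n + 1)^k of the input length n.\<close>

definition in_PSPACE_promise ::
  "('x \<Rightarrow> nat list) \<Rightarrow> ('x \<Rightarrow> bool) \<Rightarrow> ('x \<Rightarrow> bool) \<Rightarrow> bool" where
  "in_PSPACE_promise enc P Q \<longleftrightarrow>
     (\<exists>M c k. valid_tm M \<and>
        (\<forall>x. P x \<longrightarrow>
           set (enc x) \<subseteq> {1..<nsyms M} \<and>
           (\<exists>n. halted_state (cstate (tm_run M (enc x) n))) \<and>
           (\<forall>n. halted_state (cstate (tm_run M (enc x) n)) \<longrightarrow>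
                  (cstate (tm_run M (enc x) n) = 1 \<longleftrightarrow> Q x)) \<and>
           (\<forall>n. \<bar>chead (tm_run M (enc x) n)\<bar> \<le> int (c * (length (enc x) + 1) ^ k))))"

section \<open>Networks\<close>

text \<open>Nodes are natural numbers; the partition into label classes is given by a
  labelling function lab (P_a = {v \<in> V. lab v = a}); labels are natural numbers.\<close>

record net =
  V :: "nat set"
  E :: "nat set set"
  Act :: "nat set"
  Str :: "nat set"
  lab :: "nat \<Rightarrow> nat"

definition wf_net :: "net \<Rightarrow> bool" where
  "wf_net G \<longleftrightarrow> finite (V G) \<and> (\<forall>e \<in> E G. card e = 2 \<and> e \<subseteq> V G) \<and>
     Act G \<subseteq> V G \<and> Str G \<subseteq> Act G"

definition adjA :: "net \<Rightarrow> (nat \<times> nat) set" where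
  "adjA G = {(x, y). x \<in> Act G \<and> y \<in> Act G \<and> {x, y} \<in> E G}"

text \<open>Connected: the subgraph induced by the active nodes is connected.\<close>
definition connected_net :: "net \<Rightarrow> bool" where
  "connected_net G \<longleftrightarrow> (\<forall>u \<in> Act G. \<forall>v \<in> Act G. (u, v) \<in> (adjA G)\<^sup>*)"

section \<open>Moves\<close>

definition del_node :: "nat \<Rightarrow> net \<Rightarrow> net" where
  "del_node v G = G\<lparr>V := V G - {v}, E := {e \<in> E G. v \<notin> e},
                    Act := Act G - {v}, Str := Str G - {v}\<rparr>"

text \<open>Destructor: skip, or delete one weak node.\<close>
definition dmove :: "net \<Rightarrow> net \<Rightarrow> bool" where
  "dmove G G' \<longleftrightarrow> G' = G \<or> (\<exists>v \<in> Act G - Str G. G' = del_node v G)"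

text \<open>Rules: Relab a b c d is the relabeling rule a,b -> c,d; Move a b is the movement
  rule a -move-> b; Create as c as' s is the creation rule a_1..a_n -create(c)-> a'_1..a'_n,
  strong iff s = True.\<close>
datatype rule =
    Relab nat nat nat nat
  | Move nat nat
  | Create "nat list" nat "nat list" bool

fun wf_rule :: "rule \<Rightarrow> bool" where
  "wf_rule (Create as c as' s) \<longleftrightarrow> as \<noteq> [] \<and> length as = length as'"
| "wf_rule _ \<longleftrightarrow> True"

fun apply_rule :: "rule \<Rightarrow> net \<Rightarrow> net \<Rightarrow> bool" where
  "apply_rule (Relab a b c d) G G' \<longleftrightarrow>
     (\<exists>M :: (nat \<times> nat) set.
        (\<forall>(u, v) \<in> M. u \<in> Act G \<and> v \<in> Act G \<and> {u, v} \<in> E G \<and> lab G u = a \<and> lab G v = b) \<and>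
        (\<forall>(u, v) \<in> M. \<forall>(u', v') \<in> M. (u, v) \<noteq> (u', v') \<longrightarrow> {u, v} \<inter> {u', v'} = {}) \<and>
        G' = G\<lparr>lab := (\<lambda>x. if x \<in> fst ` M then c else if x \<in> snd ` M then d else lab G x)\<rparr>)"
| "apply_rule (Move a b) G G' \<longleftrightarrow>
     (\<exists>u v. u \<in> Str G \<and> lab G u = a \<and> v \<in> V G - Str G \<and> lab G v = b \<and> {u, v} \<in> E G \<and>
        G' = G\<lparr>Str := (Str G - {u}) \<union> {v}, Act := Act G \<union> {v}\<rparr>)"
| "apply_rule (Create as c as' s) G G' \<longleftrightarrow>
     (\<exists>us w. length us = length as \<and> distinct us \<and> set us \<subseteq> Str G \<and>
        (\<forall>i < length us. lab G (us ! i) = as ! i) \<and> w \<notin> V G \<and>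
        G' = G\<lparr>V := insert w (V G),
               E := E G \<union> {{w, u} | u. u \<in> set us},
               Act := insert w (Act G),
               Str := (if s then insert w (Str G) else Str G),
               lab := (\<lambda>x. if x = w then c
                           else (case map_of (zip us as') x of Some a' \<Rightarrow> a' | None \<Rightarrow> lab G x))\<rparr>)"

text \<open>Constructor: skip, or apply one rule of R.\<close>
definition cmove :: "rule list \<Rightarrow> net \<Rightarrow> net \<Rightarrow> bool" where
  "cmove R G G' \<longleftrightarrow> G' = G \<or> (\<exists>r \<in> set R. apply_rule r G G')"

section \<open>The game\<close>

text \<open>A Constructor strategy maps the history of the play (ending with the network
  produced by Destructor's last move) to the next network.\<close>
definition legal_strategy :: "rule list \<Rightarrow> (net list \<Rightarrow> net) \<Rightarrow> bool" where
  "legal_strategy R \<sigma> \<longleftrightarrow> (\<forall>h. h \<noteq> [] \<longrightarrow> cmove R (last h) (\<sigma> h))"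

text \<open>Plays consistent with \<sigma>: Destructor moves from even positions, Constructor
  answers according to \<sigma>.\<close>
definition play_of :: "(net list \<Rightarrow> net) \<Rightarrow> net \<Rightarrow> (nat \<Rightarrow> net) \<Rightarrow> bool" where
  "play_of \<sigma> G p \<longleftrightarrow> p 0 = G \<and>
     (\<forall>k. dmove (p (2 * k)) (p (2 * k + 1)) \<and>
          p (2 * k + 2) = \<sigma> (map p [0..<2 * k + 2]))"

definition constructor_safe :: "rule list \<Rightarrow> net \<Rightarrow> bool" where
  "constructor_safe R G \<longleftrightarrow>
     (\<exists>\<sigma>. legal_strategy R \<sigma> \<and> (\<forall>p. play_of \<sigma> G p \<longrightarrow> (\<forall>i. connected_net (p i))))"

definition no_weak_creation :: "rule list \<Rightarrow> bool" where
  "no_weak_creation R \<longleftrightarrow> (\<forall>r \<in> set R. \<forall>as c as'. r \<noteq> Create as c as' False)"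

section \<open>Encoding of instances as strings over the alphabet {1,...,8}\<close>

fun bits :: "nat \<Rightarrow> nat list" where
  "bits n = (if n = 0 then [] else bits (n div 2) @ [n mod 2 + 1])"

definition enc_nat :: "nat \<Rightarrow> nat list" where
  "enc_nat n = bits n @ [3]"

definition enc_list :: "('a \<Rightarrow> nat list) \<Rightarrow> 'a list \<Rightarrow> nat list" where
  "enc_list f xs = concat (map f xs) @ [4]"

definition enc_net :: "net \<Rightarrow> nat list" where
  "enc_net G =
     enc_list (\<lambda>v. enc_nat v @ enc_nat (lab G v) @
                    [if v \<in> Act G then 1 else 2, if v \<in> Str G then 1 else 2])
              (sorted_list_of_set (V G)) @
     enc_list (\<lambda>(u, v). enc_nat u @ enc_nat v)
              (concat (map (\<lambda>u. map (\<lambda>v. (u, v))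
                                  (sorted_list_of_set {v. {u, v} \<in> E G \<and> u < v}))
                           (sorted_list_of_set (V G))))"

fun enc_rule :: "rule \<Rightarrow> nat list" where
  "enc_rule (Relab a b c d) = [5] @ enc_nat a @ enc_nat b @ enc_nat c @ enc_nat d"
| "enc_rule (Move a b) = [6] @ enc_nat a @ enc_nat b"
| "enc_rule (Create as c as' s) =
     [if s then 7 else 8] @ enc_list enc_nat as @ enc_nat c @ enc_list enc_nat as'"

definition enc_instance :: "net \<times> rule list \<Rightarrow> nat list" where
  "enc_instance x = (case x of (G, R) \<Rightarrow> enc_net G @ enc_list enc_rule R)"

definition safety_instance :: "net \<times> rule list \<Rightarrow> bool" where
  "safety_instance x = (case x of (G, R) \<Rightarrow>
     wf_net G \<and> (\<forall>r \<in> set R. wf_rule r) \<and> connected_net G)"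

end

theory Submission
  imports Defs
begin

text \<open>Skipping never helps Destructor: Constructor can skip as well and the position repeats. So
  Destructor may be assumed to delete a weak node in every round. No move of Constructor increases
  the number of nodes that are not strong (a movement trades one such node for another, a strong
  creation adds none), and every deletion decreases it. Hence the game is decided within \<open>|V|\<close>
  rounds, during which the network never has more than \<open>|V|\<close> nodes on Destructor's turns, and its
  value is that of an alternating tree of polynomial depth over network descriptions of polynomial
  length; Constructor's moves never disconnect the network.

  On the machine side, programs over finitely many natural number registers with increment,
  decrement and while loops are run by Turing machines with one tape track per register. If all
  registers stay below \<open>2 ^ p(n)\<close>, the head stays within \<open>p(n)\<close> cells; running time is irrelevant.
  Such programs are closed under primitive recursion with polynomially many bits in all
  intermediate values, hence under arithmetic, under quantifiers over numbers of
  polynomial length and under the evaluation of alternating trees. The machine finds a numeric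
  description of the instance by exhaustive search, comparing its encoding with the input, and then
  evaluates the game tree on it.\<close>

section \<open>Register programs on Turing machines\<close>

text \<open>The obstacle is the space accounting rather than the game. Created nodes may receive
  arbitrary numbers as names, so positions are kept up to renaming: a node is a slot among
  \<open>N\<close>, and because Constructor moves right after a deletion, a slot is free whenever a
  node is created. All labels that can occur stem from the input, so each fits in \<open>N\<close>
  bits. A recursive evaluation of the tree would need a stack, which recursion on numbers does not
  offer. Instead the exponentially many leaves are visited from left to right, and the values of
  completed subtrees are merged along the carries of the binary leaf counter; one bit per height
  suffices as memory. The search for a description takes the place of a parser. It is harmless
  because the encoding determines its lists of nodes, edges and rules, so any two descriptions that
  match the input lead to the same answer, and the string to be compared is generated symbol by
  symbol with a single input position as memory.\<close>

datatype instr = Inc nat | Dec nat | While nat "instr list"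

text \<open>No execution decrements a zero register.\<close>

inductive exec :: "nat \<Rightarrow> instr list \<Rightarrow> (nat \<Rightarrow> nat) \<Rightarrow> (nat \<Rightarrow> nat) \<Rightarrow> bool" for X where
  exec_Nil: "exec X [] s s"
| exec_Inc: "s r + 1 < X \<Longrightarrow> exec X k (s(r := s r + 1)) t \<Longrightarrow> exec X (Inc r # k) s t"
| exec_Dec: "s r > 0 \<Longrightarrow> exec X k (s(r := s r - 1)) t \<Longrightarrow> exec X (Dec r # k) s t"
| exec_While0: "s r = 0 \<Longrightarrow> exec X k s t \<Longrightarrow> exec X (While r b # k) s t"
| exec_WhileS: "s r > 0 \<Longrightarrow> exec X b s s' \<Longrightarrow> exec X (While r b # k) s' t \<Longrightarrow> exec X (While r b # k) s t"

fun regs_below :: "nat \<Rightarrow> instr list \<Rightarrow> bool" where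
  "regs_below K [] \<longleftrightarrow> True"
| "regs_below K (Inc r # k) \<longleftrightarrow> r < K \<and> regs_below K k"
| "regs_below K (Dec r # k) \<longleftrightarrow> r < K \<and> regs_below K k"
| "regs_below K (While r b # k) \<longleftrightarrow> r < K \<and> regs_below K b \<and> regs_below K k"

lemma regs_below_append [simp]: "regs_below K (c @ d) \<longleftrightarrow> regs_below K c \<and> regs_below K d"
  by (induction K c rule: regs_below.induct) auto

lemma regs_below_mono: "regs_below K c \<Longrightarrow> K \<le> K' \<Longrightarrow> regs_below K' c"
  by (induction K c rule: regs_below.induct) auto

lemma ex_regs_below: "\<exists>K. regs_below K c"
proof (induction c rule: regs_below.induct[of "\<lambda>_ c. \<exists>K. regs_below K c" 0])
  case (2 _ r k)
  then obtain K where "regs_below K k" by auto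
  then have "regs_below (K + r + 1) (Inc r # k)" by (auto intro: regs_below_mono)
  then show ?case by blast
next
  case (3 _ r k)
  then obtain K where "regs_below K k" by auto
  then have "regs_below (K + r + 1) (Dec r # k)" by (auto intro: regs_below_mono)
  then show ?case by blast
next
  case (4 _ r b k)
  then obtain K K' where "regs_below K k" "regs_below K' b" by auto
  then have "regs_below (K + K' + r + 1) (While r b # k)" by (auto intro: regs_below_mono)
  then show ?case by blast
qed auto

text \<open>The rest of the program lives in the finite control. Entering a loop replaces
  \<open>While r b # k\<close> by \<open>b @ While r b # k\<close>, which is not a suffix of the
  program. This set contains such unfoldings and is still finite, since every remainder of a body is
  followed by the unchanged loop.\<close>

fun conts :: "instr list \<Rightarrow> instr list set" where
  "conts [] = {[]}"
| "conts (Inc r # k) = insert (Inc r # k) (conts k)"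
| "conts (Dec r # k) = insert (Dec r # k) (conts k)"
| "conts (While r b # k) = insert (While r b # k) (conts k \<union> (\<lambda>x. x @ While r b # k) ` conts b)"

lemma finite_conts: "finite (conts c)"
  by (induction c rule: conts.induct) auto

lemma conts_refl [simp]: "c \<in> conts c"
  by (cases c rule: conts.cases) auto

lemma conts_Inc: "Inc r # k \<in> conts c \<Longrightarrow> k \<in> conts c"
proof (induction c arbitrary: k rule: conts.induct)
  case (4 r' b k')
  from "4.prems" consider "Inc r # k \<in> conts k'"
    | x where "Inc r # k = x @ While r' b # k'" "x \<in> conts b" by auto
  then show ?case
  proof cases
    case 2
    then obtain x' where "x = Inc r # x'" "k = x' @ While r' b # k'" by (cases x) auto
    with 2 "4.IH" show ?thesis by auto
  qed (use "4.IH" in auto)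
qed auto

lemma conts_Dec: "Dec r # k \<in> conts c \<Longrightarrow> k \<in> conts c"
proof (induction c arbitrary: k rule: conts.induct)
  case (4 r' b k')
  from "4.prems" consider "Dec r # k \<in> conts k'"
    | x where "Dec r # k = x @ While r' b # k'" "x \<in> conts b" by auto
  then show ?case
  proof cases
    case 2
    then obtain x' where "x = Dec r # x'" "k = x' @ While r' b # k'" by (cases x) auto
    with 2 "4.IH" show ?thesis by auto
  qed (use "4.IH" in auto)
qed auto

lemma conts_While:
  "While r b # k \<in> conts c \<Longrightarrow> k \<in> conts c \<and> b @ While r b # k \<in> conts c"
proof (induction c arbitrary: k rule: conts.induct)
  case (4 r' b' k')
  from "4.prems" consider "While r b # k \<in> conts k'" | "While r b # k = While r' b' # k'"
    | x where "While r b # k = x @ While r' b' # k'" "x \<in> conts b'" by auto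
  then show ?case
  proof cases
    case 3
    show ?thesis
    proof (cases x)
      case Nil
      with 3 show ?thesis by auto
    next
      case (Cons a x')
      with 3 have x: "x = While r b # x'" "k = x' @ While r' b' # k'" by auto
      with 3 "4.IH"(2)[of x'] have "x' \<in> conts b'" "b @ While r b # x' \<in> conts b'" by auto
      then have "x' @ While r' b' # k' \<in> conts (While r' b' # k')"
        "(b @ While r b # x') @ While r' b' # k' \<in> conts (While r' b' # k')" by auto
      with x show ?thesis by simp
    qed
  qed (use "4.IH" in auto)
qed auto

lemma regs_below_conts: "x \<in> conts c \<Longrightarrow> regs_below K c \<Longrightarrow> regs_below K x"
  by (induction c arbitrary: x rule: conts.induct) auto

section \<open>Control states, head movements and tape contents\<close>

datatype ctrl = Run "instr list" | Ret "instr list" | Acc | Rej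

text \<open>Bit \<open>r\<close> of cell \<open>i\<close> is bit \<open>i\<close> of register \<open>r\<close>, and bit \<open>K\<close> marks the cells written so far.
  The nonzero cells then form an interval starting at cell 0, so that both of its ends are
  recognised by the blank, and the input symbols 1 to 8 are the initial contents of registers 0 to 3.
  An arithmetic instruction scans right from cell 0, then Ret goes back to cell 0.\<close>

fun ctrl_step :: "nat \<Rightarrow> nat \<Rightarrow> ctrl \<Rightarrow> nat \<Rightarrow> ctrl \<times> nat \<times> int" where
  "ctrl_step K out (Run []) a = (if bit a out then Acc else Rej, a, 0)"
| "ctrl_step K out (Run (Inc r # k)) a =
     (if bit a r then (Run (Inc r # k), set_bit K (flip_bit r a), 1)
      else (Ret k, set_bit K (flip_bit r a), -1))"
| "ctrl_step K out (Run (Dec r # k)) a =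
     (if bit a r then (Ret k, set_bit K (flip_bit r a), -1)
      else (Run (Dec r # k), set_bit K (flip_bit r a), 1))"
| "ctrl_step K out (Run (While r b # k)) a =
     (if a = 0 then (Ret k, a, -1)
      else if bit a r then (Ret (b @ While r b # k), a, -1)
      else (Run (While r b # k), a, 1))"
| "ctrl_step K out (Ret k) a = (if a = 0 then (Run k, a, 1) else (Ret k, a, -1))"
| "ctrl_step K out Acc a = (Acc, a, 0)"
| "ctrl_step K out Rej a = (Rej, a, 0)"

type_synonym aconf = "ctrl \<times> (int \<Rightarrow> nat) \<times> int"

definition astep :: "nat \<Rightarrow> nat \<Rightarrow> aconf \<Rightarrow> aconf" where
  "astep K out c = (case c of (q, t, h) \<Rightarrow>
     case ctrl_step K out q (t h) of (q', a, d) \<Rightarrow> (q', t(h := a), h + d))"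

definition reach :: "nat \<Rightarrow> nat \<Rightarrow> nat \<Rightarrow> aconf \<Rightarrow> aconf \<Rightarrow> bool" where
  "reach K out B c c' \<longleftrightarrow>
     (\<exists>n. (astep K out ^^ n) c = c' \<and>
          (\<forall>m\<le>n. \<bar>snd (snd ((astep K out ^^ m) c))\<bar> \<le> int B))"

lemma reach_refl: "\<bar>snd (snd c)\<bar> \<le> int B \<Longrightarrow> reach K out B c c"
  unfolding reach_def by (rule exI[of _ 0]) simp

lemma reach_step:
  assumes "\<bar>snd (snd c)\<bar> \<le> int B" "reach K out B (astep K out c) c'"
  shows "reach K out B c c'"
proof -
  from assms(2) obtain n where n: "(astep K out ^^ n) (astep K out c) = c'"
    "\<forall>m\<le>n. \<bar>snd (snd ((astep K out ^^ m) (astep K out c)))\<bar> \<le> int B"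
    by (auto simp: reach_def)
  have "(astep K out ^^ Suc n) c = c'" using n(1) by (simp add: funpow_swap1)
  moreover have "\<bar>snd (snd ((astep K out ^^ m) c))\<bar> \<le> int B" if "m \<le> Suc n" for m
    using that n(2) assms(1) by (cases m) (auto simp: funpow_swap1)
  ultimately show ?thesis unfolding reach_def by blast
qed

lemma reach_trans:
  assumes "reach K out B c c'" "reach K out B c' c''"
  shows "reach K out B c c''"
proof -
  have "(astep K out ^^ n) c = c' \<Longrightarrow> (\<forall>m\<le>n. \<bar>snd (snd ((astep K out ^^ m) c))\<bar> \<le> int B)
    \<Longrightarrow> reach K out B c c''" for n
  proof (induction n arbitrary: c)
    case 0
    then show ?case using assms(2) by simp
  next
    case (Suc n)
    have "reach K out B (astep K out c) c''"
    proof (rule Suc.IH)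
      show "(astep K out ^^ n) (astep K out c) = c'" using Suc.prems(1) by (simp add: funpow_swap1)
      show "\<forall>m\<le>n. \<bar>snd (snd ((astep K out ^^ m) (astep K out c)))\<bar> \<le> int B"
      proof (intro allI impI)
        fix m assume "m \<le> n"
        then have "\<bar>snd (snd ((astep K out ^^ Suc m) c))\<bar> \<le> int B" using Suc.prems(2) by blast
        then show "\<bar>snd (snd ((astep K out ^^ m) (astep K out c)))\<bar> \<le> int B"
          by (simp add: funpow_swap1)
      qed
    qed
    moreover have "\<bar>snd (snd c)\<bar> \<le> int B" using Suc.prems(2)[rule_format, of 0] by simp
    ultimately show ?case by (rule reach_step[rotated])
  qed
  with assms(1) show ?thesis unfolding reach_def by blast
qed

text \<open>The rewriting \<open>g\<close> is a parameter because a carry or borrow flips one digit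
  in every cell it passes, while a loop test leaves the cells alone.\<close>

lemma reach_scan_right:
  assumes "\<And>i. h \<le> i \<Longrightarrow> i < h + int p \<Longrightarrow> ctrl_step K out q (t i) = (q, g (t i), 1)"
    and "\<bar>h\<bar> \<le> int B" "\<bar>h + int p\<bar> \<le> int B"
  shows "reach K out B (q, t, h) (q, (\<lambda>i. if h \<le> i \<and> i < h + int p then g (t i) else t i), h + int p)"
  using assms
proof (induction p arbitrary: t h)
  case 0
  have "(\<lambda>i. if h \<le> i \<and> i < h + int 0 then g (t i) else t i) = t" by auto
  then show ?case using 0 by (simp add: reach_refl)
next
  case (Suc p)
  define t' where "t' = t(h := g (t h))"
  have "astep K out (q, t, h) = (q, t', h + 1)"
    using Suc.prems(1)[of h] by (simp add: astep_def t'_def)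
  moreover have "reach K out B (q, t', h + 1)
    (q, (\<lambda>i. if h + 1 \<le> i \<and> i < h + 1 + int p then g (t' i) else t' i), h + 1 + int p)"
  proof (rule Suc.IH)
    show "ctrl_step K out q (t' i) = (q, g (t' i), 1)" if "h + 1 \<le> i" "i < h + 1 + int p" for i
      using Suc.prems(1)[of i] that by (simp add: t'_def)
  qed (use Suc.prems in auto)
  moreover have "(\<lambda>i. if h + 1 \<le> i \<and> i < h + 1 + int p then g (t' i) else t' i) =
      (\<lambda>i. if h \<le> i \<and> i < h + int (Suc p) then g (t i) else t i)"
    by (auto simp: t'_def fun_eq_iff)
  moreover have "h + 1 + int p = h + int (Suc p)" by simp
  ultimately show ?case using Suc.prems(2) reach_step[of "(q,t,h)"] by auto
qed

text \<open>The case \<open>p = 0\<close> occurs when a scan stops in cell 0: the head then already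
  stands on the blank cell -1, which is why \<open>B\<close> must be at least 1.\<close>

lemma reach_Ret:
  assumes "\<And>i. 0 \<le> i \<Longrightarrow> i < int p \<Longrightarrow> t i \<noteq> 0" "t (-1) = 0" "p \<le> B" "B \<ge> 1"
  shows "reach K out B (Ret k, t, int p - 1) (Run k, t, 0)"
  using assms
proof (induction p)
  case 0
  have "astep K out (Ret k, t, - 1) = (Run k, t, 0)"
    using 0 by (auto simp: astep_def fun_eq_iff)
  then show ?case using 0 by (auto intro!: reach_step[of "(Ret k, t, - 1)"] reach_refl)
next
  case (Suc p)
  have "astep K out (Ret k, t, int p) = (Ret k, t, int p - 1)"
    using Suc.prems(1)[of "int p"] by (auto simp: astep_def)
  moreover have "reach K out B (Ret k, t, int p - 1) (Run k, t, 0)"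
    using Suc by auto
  ultimately show ?case using Suc.prems by (auto intro!: reach_step[of "(Ret k, t, int p)"])
qed

text \<open>The extent \<open>e\<close> may exceed the length of every register, as cells stay
  nonblank when their digits become zero. Conversely, blank cells force all digits from position
  \<open>e\<close> on to be zero.\<close>

definition tape_rep :: "nat \<Rightarrow> (nat \<Rightarrow> nat) \<Rightarrow> nat \<Rightarrow> (int \<Rightarrow> nat) \<Rightarrow> bool" where
  "tape_rep K s e t \<longleftrightarrow> (\<forall>i. 0 \<le> i \<and> i < int e \<longleftrightarrow> t i \<noteq> 0) \<and>
     (\<forall>r<K. \<forall>i. bit (t (int i)) r = bit (s r) i)"

text \<open>Carry propagation: \<open>p\<close> is the position of the lowest zero, where the carry
  stops.\<close>

lemma bit_Suc_number:
  fixes x :: nat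
  assumes "\<And>i. i < p \<Longrightarrow> bit x i" "\<not> bit x p"
  shows "bit (Suc x) i \<longleftrightarrow> (if i < p then False else if i = p then True else bit x i)"
  using assms
proof (induction p arbitrary: x i)
  case 0
  then have "even x" by (simp add: bit_0)
  then show ?case by (cases i) (auto simp: bit_0 bit_Suc)
next
  case (Suc p)
  have o: "odd x" using Suc.prems(1)[of 0] by (simp add: bit_0)
  have d: "Suc x div 2 = Suc (x div 2)" using o by presburger
  have "bit (Suc (x div 2)) j \<longleftrightarrow> (if j < p then False else if j = p then True else bit (x div 2) j)" for j
    using Suc.prems(1)[of "Suc _"] Suc.prems(2) by (intro Suc.IH) (auto simp: bit_Suc)
  then show ?case using o d by (cases i) (auto simp: bit_0 bit_Suc)
qed

lemma bit_nat_imp_le: "bit (x::nat) p \<Longrightarrow> 2 ^ p \<le> x"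
  by (metis bit_iff_odd div_less dvd_0_right not_le)

lemma bits_all_zero: "(\<And>i. \<not> bit (x::nat) i) \<Longrightarrow> x = 0"
  by (simp add: bit_eq_iff)

lemma set_bit_nonzero [simp]: "set_bit K (a::nat) \<noteq> 0"
proof -
  have "bit (set_bit K a) K" by (simp add: bit_set_bit_iff)
  then show ?thesis by (metis bit_0_eq bot_apply bot_bool_def)
qed

lemma set_bit_pos [simp]: "0 < set_bit K (a::nat)"
  using set_bit_nonzero by (simp only: neq0_conv)

text \<open>Increment and decrement are one operation on digits: flip everything up to the first
  digit that differs from \<open>b\<close>. A carry passes through ones (\<open>b = True\<close>), a
  borrow through zeros (\<open>b = False\<close>).\<close>

lemma reach_flip:
  assumes tape_rep: "tape_rep K s e t" and r: "r < K" and e: "e \<le> B" and p: "p \<le> e" "p < B"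
    and b: "\<And>i. i < p \<Longrightarrow> bit (s r) i = b" "bit (s r) p = (\<not> b)"
    and step: "\<And>a. ctrl_step K out q a =
      (if bit a r = b then (q, set_bit K (flip_bit r a), 1) else (Ret k, set_bit K (flip_bit r a), -1))"
    and x: "\<And>i. bit x i \<longleftrightarrow> (if i \<le> p then \<not> bit (s r) i else bit (s r) i)"
  shows "\<exists>e' t'. reach K out B (q, t, 0) (Run k, t', 0) \<and> tape_rep K (s(r := x)) e' t' \<and> e' \<le> B"
proof -
  have nz: "0 \<le> i \<and> i < int e \<longleftrightarrow> t i \<noteq> 0" for i using tape_rep by (simp add: tape_rep_def)
  have bt: "bit (t (int i)) r' = bit (s r') i" if "r' < K" for i r'
    using tape_rep that by (simp add: tape_rep_def)
  let ?g = "\<lambda>a. set_bit K (flip_bit r a)"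
  define t1 where "t1 = (\<lambda>i. if 0 \<le> i \<and> i < 0 + int p then ?g (t i) else t i)"
  define t2 where "t2 = t1(int p := ?g (t (int p)))"
  have 1: "reach K out B (q, t, 0) (q, t1, 0 + int p)"
    unfolding t1_def
  proof (rule reach_scan_right)
    fix i :: int assume "0 \<le> i" "i < 0 + int p"
    then show "ctrl_step K out q (t i) = (q, ?g (t i), 1)"
      using b(1)[of "nat i"] bt[OF r, of "nat i"] by (simp add: step)
  qed (use p in auto)
  have "astep K out (q, t1, int p) = (Ret k, t2, int p - 1)"
    using b(2) bt[OF r, of p] by (simp add: astep_def t2_def t1_def step)
  moreover have "reach K out B (Ret k, t2, int p - 1) (Run k, t2, 0)"
    by (rule reach_Ret) (use p nz[of "-1"] in \<open>auto simp: t2_def t1_def\<close>)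
  ultimately have 2: "reach K out B (q, t1, int p) (Run k, t2, 0)"
    using p by (intro reach_step[of "(q, t1, int p)"]) auto
  \<comment> \<open>Since \<open>p \<le> e\<close>, the flip reaches at most the first blank cell,
    so the nonblank cells remain an interval.\<close>
  have "tape_rep K (s(r := x)) (max e (p + 1)) t2"
    unfolding tape_rep_def
  proof (intro conjI allI impI)
    fix i show "0 \<le> i \<and> i < int (max e (p + 1)) \<longleftrightarrow> t2 i \<noteq> 0"
      using nz[of i] p by (auto simp: t2_def t1_def)
  next
    fix r' i assume r': "r' < K"
    have t2: "t2 (int i) = (if i \<le> p then ?g (t (int i)) else t (int i))" by (auto simp: t2_def t1_def)
    show "bit (t2 (int i)) r' = bit ((s(r := x)) r') i"
      using r' r x[of i] bt[OF r', of i] by (auto simp: t2 bit_set_bit_iff bit_flip_bit_iff)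
  qed
  with reach_trans[OF 1] 2 p e show ?thesis by (intro exI[of _ "max e (p+1)"] exI[of _ t2]) auto
qed

lemma reach_Inc:
  assumes tape_rep: "tape_rep K s e t" and r: "r < K" and e: "e \<le> B" and lt: "s r + 1 < 2 ^ B"
  shows "\<exists>e' t'. reach K out B (Run (Inc r # k), t, 0) (Run k, t', 0) \<and>
    tape_rep K (s(r := s r + 1)) e' t' \<and> e' \<le> B"
proof -
  define p where "p = (LEAST p. \<not> bit (s r) p)"
  have ex: "\<not> bit (s r) e" using tape_rep r unfolding tape_rep_def by (metis bit_0_eq bot_apply
      bot_bool_def less_irrefl)
  have p0: "\<not> bit (s r) p" unfolding p_def using ex by (rule LeastI)
  have p1: "bit (s r) i" if "i < p" for i using that not_less_Least unfolding p_def by blast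
  have pe: "p \<le> e" unfolding p_def using ex by (rule Least_le)
  have bS: "bit (Suc (s r)) i \<longleftrightarrow> (if i < p then False else if i = p then True else bit (s r) i)" for i
    by (rule bit_Suc_number) (use p0 p1 in auto)
  \<comment> \<open>Digit \<open>p\<close> of the result is one, so the bound on the register value
    becomes a bound on the head position.\<close>
  have "2 ^ p \<le> Suc (s r)" using bS[of p] bit_nat_imp_le by simp
  then have "(2::nat) ^ p < 2 ^ B" using lt by linarith
  then have pB: "p < B" by simp
  show ?thesis
    by (rule reach_flip[OF tape_rep r e pe pB, where b = True]) (use p0 p1 bS in \<open>auto simp: le_less\<close>)
qed

lemma reach_Dec:
  assumes tape_rep: "tape_rep K s e t" and r: "r < K" and e: "e \<le> B" and lt: "s r > 0"
  shows "\<exists>e' t'. reach K out B (Run (Dec r # k), t, 0) (Run k, t', 0) \<and>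
    tape_rep K (s(r := s r - 1)) e' t' \<and> e' \<le> B"
proof -
  \<comment> \<open>Decrement is increment read backwards: the borrow stops at the lowest one of
    \<open>s r\<close>, which is the lowest zero of \<open>x\<close>.\<close>
  define x where "x = s r - 1"
  have sx: "s r = Suc x" using lt by (simp add: x_def)
  define p where "p = (LEAST p. \<not> bit x p)"
  have "\<not> bit x x" using bit_nat_imp_le[of x x] less_exp[of x] by linarith
  then have p0: "\<not> bit x p" unfolding p_def by (rule LeastI)
  have p1: "bit x i" if "i < p" for i using that not_less_Least unfolding p_def by blast
  have bS: "bit (s r) i \<longleftrightarrow> (if i < p then False else if i = p then True else bit x i)" for i
    unfolding sx by (rule bit_Suc_number) (use p0 p1 in auto)
  have "bit (t (int p)) r" using tape_rep r bS[of p] by (simp add: tape_rep_def)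
  then have "t (int p) \<noteq> 0" by (metis bit_0_eq bot_apply bot_bool_def)
  then have pe: "p < e" using tape_rep by (metis of_nat_less_iff tape_rep_def)
  show ?thesis unfolding x_def[symmetric]
    by (rule reach_flip[OF tape_rep r e, where b = False and p = p]) (use pe e p0 p1 bS in \<open>auto simp:
        le_less\<close>)
qed

lemma reach_While0:
  assumes tape_rep: "tape_rep K s e t" and r: "r < K" and e: "e \<le> B" "B \<ge> 1" and lt: "s r = 0"
  shows "reach K out B (Run (While r b # k), t, 0) (Run k, t, 0)"
proof -
  have nz: "0 \<le> i \<and> i < int e \<longleftrightarrow> t i \<noteq> 0" for i using tape_rep by (simp add: tape_rep_def)
  have bt: "bit (t (int i)) r' = bit (s r') i" if "r' < K" for i r'
    using tape_rep that by (simp add: tape_rep_def)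
  have "reach K out B (Run (While r b # k), t, 0)
    (Run (While r b # k), (\<lambda>i. if 0 \<le> i \<and> i < 0 + int e then (\<lambda>x. x) (t i) else t i), 0 + int e)"
  proof (rule reach_scan_right)
    fix i :: int assume "0 \<le> i" "i < 0 + int e"
    then show "ctrl_step K out (Run (While r b # k)) (t i) = (Run (While r b # k), t i, 1)"
      using nz[of i] bt[OF r, of "nat i"] lt by simp
  qed (use e in auto)
  then have 1: "reach K out B (Run (While r b # k), t, 0) (Run (While r b # k), t, int e)" by simp
  have "astep K out (Run (While r b # k), t, int e) = (Ret k, t, int e - 1)"
    using nz[of "int e"] by (auto simp: astep_def)
  moreover have "reach K out B (Ret k, t, int e - 1) (Run k, t, 0)"
    by (rule reach_Ret) (use e nz nz[of "-1"] in auto)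
  ultimately have 2: "reach K out B (Run (While r b # k), t, int e) (Run k, t, 0)"
    using e by (intro reach_step[of "(Run (While r b # k), t, int e)"]) auto
  show ?thesis using reach_trans[OF 1 2] .
qed

lemma reach_WhileS:
  assumes tape_rep: "tape_rep K s e t" and r: "r < K" and e: "e \<le> B" "B \<ge> 1" and lt: "s r > 0"
  shows "reach K out B (Run (While r b # k), t, 0) (Run (b @ While r b # k), t, 0)"
proof -
  have nz: "0 \<le> i \<and> i < int e \<longleftrightarrow> t i \<noteq> 0" for i using tape_rep by (simp add: tape_rep_def)
  have bt: "bit (t (int i)) r' = bit (s r') i" if "r' < K" for i r'
    using tape_rep that by (simp add: tape_rep_def)
  define p where "p = (LEAST p. bit (s r) p)"
  obtain q where ex: "bit (s r) q" using bits_all_zero[of "s r"] lt by auto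
  have p0: "bit (s r) p" unfolding p_def using ex by (rule LeastI)
  have p1: "\<not> bit (s r) i" if "i < p" for i using that not_less_Least unfolding p_def by blast
  have pe: "p < e" using nz[of "int p"] bt[OF r, of p] p0 by (cases "p < e") auto
  have "reach K out B (Run (While r b # k), t, 0)
    (Run (While r b # k), (\<lambda>i. if 0 \<le> i \<and> i < 0 + int p then (\<lambda>x. x) (t i) else t i), 0 + int p)"
  proof (rule reach_scan_right)
    fix i :: int assume "0 \<le> i" "i < 0 + int p"
    then show "ctrl_step K out (Run (While r b # k)) (t i) = (Run (While r b # k), t i, 1)"
      using nz[of i] bt[OF r, of "nat i"] p1[of "nat i"] pe by simp
  qed (use e pe in auto)
  then have 1: "reach K out B (Run (While r b # k), t, 0) (Run (While r b # k), t, int p)" by simp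
  have "astep K out (Run (While r b # k), t, int p) = (Ret (b @ While r b # k), t, int p - 1)"
    using nz[of "int p"] pe p0 bt[OF r, of p] by (auto simp: astep_def)
  moreover have "reach K out B (Ret (b @ While r b # k), t, int p - 1) (Run (b @ While r b # k), t, 0)"
  proof (rule reach_Ret)
    show "t i \<noteq> 0" if "0 \<le> i" "i < int p" for i using nz[of i] that pe by linarith
    show "t (-1) = 0" using nz[of "-1"] by simp
  qed (use e pe in auto)
  ultimately have 2: "reach K out B (Run (While r b # k), t, int p) (Run (b @ While r b # k), t, 0)"
    using e pe by (intro reach_step[of "(Run (While r b # k), t, int p)"]) auto
  show ?thesis using reach_trans[OF 1 2] .
qed

text \<open>The continuation \<open>k\<close> is arbitrary because a loop body is executed with the
  loop itself still pending behind it.\<close>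

lemma exec_reach:
  assumes "exec X c s u" "X = 2 ^ B" "B \<ge> 1" "regs_below K c" "tape_rep K s e t" "e \<le> B"
  shows "\<exists>e' t'. reach K out B (Run (c @ k), t, 0) (Run k, t', 0) \<and> tape_rep K u e' t' \<and> e' \<le> B"
  using assms
proof (induction arbitrary: k e t rule: exec.induct)
  case (exec_Nil s)
  then show ?case by (auto intro!: exI[of _ e] exI[of _ t] reach_refl)
next
  case (exec_Inc s r c u)
  obtain e1 t1 where 1: "reach K out B (Run (Inc r # (c @ k)), t, 0) (Run (c @ k), t1, 0)"
    "tape_rep K (s(r := s r + 1)) e1 t1" "e1 \<le> B"
    using reach_Inc[of K s e t r B out "c @ k"] exec_Inc.prems exec_Inc.hyps by (metis regs_below.simps(2))
  obtain e2 t2 where 2: "reach K out B (Run (c @ k), t1, 0) (Run k, t2, 0)" "tape_rep K u e2 t2" "e2 \<le> B"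
    using exec_Inc.IH[of e1 t1 k] exec_Inc.prems 1 by (metis regs_below.simps(2))
  then show ?case using reach_trans[OF 1(1) 2(1)] by auto
next
  case (exec_Dec s r c u)
  obtain e1 t1 where 1: "reach K out B (Run (Dec r # (c @ k)), t, 0) (Run (c @ k), t1, 0)"
    "tape_rep K (s(r := s r - 1)) e1 t1" "e1 \<le> B"
    using reach_Dec[of K s e t r B out "c @ k"] exec_Dec.prems exec_Dec.hyps by (metis regs_below.simps(3))
  obtain e2 t2 where 2: "reach K out B (Run (c @ k), t1, 0) (Run k, t2, 0)" "tape_rep K u e2 t2" "e2 \<le> B"
    using exec_Dec.IH[of e1 t1 k] exec_Dec.prems 1 by (metis regs_below.simps(3))
  then show ?case using reach_trans[OF 1(1) 2(1)] by auto
next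
  case (exec_While0 s r c u b)
  have 1: "reach K out B (Run (While r b # (c @ k)), t, 0) (Run (c @ k), t, 0)"
    using reach_While0[of K s e t r B out b "c @ k"] exec_While0.hyps exec_While0.prems by simp
  obtain e2 t2 where 2: "reach K out B (Run (c @ k), t, 0) (Run k, t2, 0)" "tape_rep K u e2 t2" "e2 \<le> B"
    using exec_While0.IH[of e t k] exec_While0.prems by auto
  then show ?case using reach_trans[OF 1 2(1)] by auto
next
  case (exec_WhileS s r b s' c u)
  have 1: "reach K out B (Run (While r b # (c @ k)), t, 0) (Run (b @ While r b # (c @ k)), t, 0)"
    using reach_WhileS[of K s e t r B out b "c @ k"] exec_WhileS.hyps exec_WhileS.prems by simp
  obtain e1 t1 where 2: "reach K out B (Run (b @ While r b # (c @ k)), t, 0) (Run (While r b # (c @ k)),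
      t1, 0)"
    "tape_rep K s' e1 t1" "e1 \<le> B" using exec_WhileS.IH(1)[of e t "While r b # (c @ k)"]
        exec_WhileS.prems by auto
  obtain e2 t2 where 3: "reach K out B (Run (While r b # c @ k), t1, 0) (Run k, t2, 0)"
    "tape_rep K u e2 t2" "e2 \<le> B" using exec_WhileS.IH(2)[of e1 t1 k] exec_WhileS.prems 2 by auto
  then show ?case using reach_trans[OF reach_trans[OF 1 2(1)] 3(1)] by auto
qed

text \<open>Bit \<open>r\<close> of the successive input symbols, read as one number: the input
  tape, unchanged, already represents these register contents.\<close>

definition init_regs :: "nat list \<Rightarrow> nat \<Rightarrow> nat" where
  "init_regs w r = (\<Sum>i<length w. of_bool (bit (w ! i) r) * 2 ^ i)"

lemma sum_bits_less: "(\<Sum>i<n. of_bool (P i) * 2 ^ i :: nat) < 2 ^ n"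
  by (induction n) auto

lemma bit_sum_bits: "bit (\<Sum>i<n. of_bool (P i) * 2 ^ i :: nat) j \<longleftrightarrow> j < n \<and> P j"
proof (induction n)
  case (Suc n)
  let ?s = "\<Sum>i<n. of_bool (P i) * 2 ^ i :: nat"
  have lt: "?s < 2 ^ n" by (rule sum_bits_less)
  have hi: "\<not> bit ?s i" if "n \<le> i" for i using Suc.IH lt
  proof -
    have "2 ^ n \<le> (2 ^ i :: nat)" using that by simp
    with lt bit_nat_imp_le[of ?s i] show ?thesis by linarith
  qed
  have "or ?s (2 ^ n) = ?s + 2 ^ n"
  proof -
    define z where "z = ?s"
    have "\<not> bit z n" using hi by (simp add: z_def)
    then have "and z (2 ^ n) = 0" by (intro bit_eqI) (auto simp: bit_simps)
    then have "or z (2 ^ n) = z + 2 ^ n" by (rule disjunctive_add_eq_or[symmetric])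
    then show ?thesis by (simp only: z_def)
  qed
  then have "?s + of_bool (P n) * 2 ^ n = or ?s (of_bool (P n) * 2 ^ n)" by (cases "P n") simp_all
  then have "bit (?s + of_bool (P n) * 2 ^ n) j \<longleftrightarrow> bit ?s j \<or> bit (of_bool (P n) * 2 ^ n :: nat) j"
    by (simp only: bit_or_iff)
  moreover have "bit (of_bool (P n) * 2 ^ n :: nat) j \<longleftrightarrow> P n \<and> j = n"
    by (cases "P n") (auto simp: bit_simps)
  ultimately show ?case using Suc.IH by (auto simp: less_Suc_eq)
qed simp

lemma init_regs_less: "init_regs w r < 2 ^ length w"
  unfolding init_regs_def by (rule sum_bits_less)

lemma bit_init_regs: "bit (init_regs w r) i \<longleftrightarrow> i < length w \<and> bit (w ! i) r"
  unfolding init_regs_def by (rule bit_sum_bits)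

lemma tape_rep_init:
  assumes "\<And>a. a \<in> set w \<Longrightarrow> a \<noteq> 0"
  shows "tape_rep K (init_regs w) (length w) (fst (snd (tm_init w)))"
  using assms by (auto simp: tape_rep_def tm_init_def bit_init_regs)

lemma less_2_power_iff_bits: "(x::nat) < 2 ^ n \<longleftrightarrow> (\<forall>i\<ge>n. \<not> bit x i)"
proof
  assume "x < 2 ^ n"
  then show "\<forall>i\<ge>n. \<not> bit x i"
    by (metis bit_nat_imp_le le_less_trans not_le one_less_numeral_iff power_increasing_iff semiring_norm(76))
next
  assume "\<forall>i\<ge>n. \<not> bit x i"
  then have "take_bit n x = x" by (auto simp: bit_eq_iff bit_take_bit_iff not_less[symmetric])
  then show "x < 2 ^ n" by (metis take_bit_nat_less_exp)
qed

section \<open>Numbering the control states to obtain a Turing machine\<close>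

definition ctrl_set :: "instr list \<Rightarrow> ctrl set" where
  "ctrl_set c = {Acc, Rej} \<union> Run ` conts c \<union> Ret ` conts c"

lemma ctrl_step_valid:
  assumes "q \<in> ctrl_set c" "regs_below K c" "a < 2 ^ Suc K" "ctrl_step K out q a = (q', a', d)"
  shows "q' \<in> ctrl_set c \<and> a' < 2 ^ Suc K \<and> d \<in> {-1, 0, 1}"
proof -
  have b: "set_bit K (flip_bit r a) < 2 ^ Suc K" if "r < K" for r
    using assms(3) that unfolding less_2_power_iff_bits by (auto simp: bit_set_bit_iff bit_flip_bit_iff)
  note [simp del] = power_Suc
  have w: "x \<in> conts c \<Longrightarrow> regs_below K x" for x using assms(2) regs_below_conts by blast
  show ?thesis
  proof (cases q)
    case (Run x)
    then have x: "x \<in> conts c" using assms(1) by (auto simp: ctrl_set_def)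
    show ?thesis
    proof (cases x rule: conts.cases)
      case 1
      with Run assms show ?thesis by (auto simp: ctrl_set_def split: if_splits)
    next
      case (2 r k)
      then show ?thesis using Run x assms w[of x] b[of r] conts_Inc[of r k c]
        by (auto simp: ctrl_set_def split: if_splits)
    next
      case (3 r k)
      then show ?thesis using Run x assms w[of x] b[of r] conts_Dec[of r k c]
        by (auto simp: ctrl_set_def split: if_splits)
    next
      case (4 r b k)
      then show ?thesis using Run x assms conts_While[of r b k c]
        by (auto simp: ctrl_set_def split: if_splits)
    qed
  qed (use assms in \<open>auto simp: ctrl_set_def split: if_splits\<close>)
qed

text \<open>The machine model prescribes the numbers 0, 1 and 2 for the start, accepting and
  rejecting states.\<close>

lemma ex_numbering:
  assumes "finite Q" "a \<in> Q" "b \<in> Q" "d \<in> Q" "a \<noteq> b" "a \<noteq> d" "b \<noteq> d"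
  shows "\<exists>en. bij_betw en Q {..<card Q} \<and> en a = 0 \<and> en b = 1 \<and> en d = (2::nat)"
proof -
  define Q' where "Q' = Q - {a, b, d}"
  have fin: "finite Q'" using assms(1) by (simp add: Q'_def)
  then obtain f where f: "bij_betw f Q' {0..<card Q'}" using ex_bij_betw_finite_nat by blast
  have Q: "Q = {a, b, d} \<union> Q'" using assms by (auto simp: Q'_def)
  have c: "card Q = card Q' + 3" using fin assms(5-7) unfolding Q by (subst card_Un_disjoint) (auto simp:
      Q'_def)
  define en where "en = (\<lambda>x. if x = a then 0 else if x = b then 1 else if x = d then 2 else f x + 3)"
  have en': "bij_betw en Q' {3..<card Q}"
  proof -
    have "bij_betw (\<lambda>x. x + 3) {0..<card Q'} {3..<card Q}"
      unfolding bij_betw_def using c image_add_atLeastLessThan'[of 3 0 "card Q'"] by auto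
    then have "bij_betw ((\<lambda>x. x + 3) \<circ> f) Q' {3..<card Q}" using f bij_betw_trans by blast
    moreover have "en x = ((\<lambda>x. x + 3) \<circ> f) x" if "x \<in> Q'" for x using that by (auto simp: en_def Q'_def)
    ultimately show ?thesis by (metis (no_types, lifting) bij_betw_cong)
  qed
  have "bij_betw en {a, b, d} {0, 1, 2}" using assms(5-7) by (auto simp: bij_betw_def en_def)
  then have "bij_betw en ({a, b, d} \<union> Q') ({0, 1, 2} \<union> {3..<card Q})"
    using en' by (rule bij_betw_combine) auto
  moreover have "{0, 1, 2} \<union> {3..<card Q} = {..<card Q}" using c by auto
  ultimately have "bij_betw en Q {..<card Q}" using Q by simp
  then show ?thesis using assms(5-7) by (intro exI[of _ en]) (auto simp: en_def)
qed

text \<open>The simulation is in lockstep, one machine step per control step, so head positions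
  carry over unchanged. The answer is the parity of register \<open>out\<close>, visible in cell 0
  when the program ends.\<close>

lemma tm_of_program:
  assumes "5 \<le> K" "regs_below K c" "out < K"
  shows "\<exists>M. valid_tm M \<and> nsyms M = 2 ^ Suc K \<and>
    (\<forall>w B u. set w \<subseteq> {1..<9} \<longrightarrow> 1 \<le> B \<longrightarrow> length w \<le> B \<longrightarrow> exec (2 ^ B) c (init_regs w) u \<longrightarrow>
      (\<exists>n. halted_state (cstate (tm_run M w n))) \<and>
      (\<forall>n. halted_state (cstate (tm_run M w n)) \<longrightarrow> (cstate (tm_run M w n) = 1 \<longleftrightarrow> odd (u out))) \<and>
      (\<forall>n. \<bar>chead (tm_run M w n)\<bar> \<le> int B))"
proof -
  define Q where "Q = ctrl_set c"
  have "finite Q" "Run c \<in> Q" "Acc \<in> Q" "Rej \<in> Q" by (auto simp: Q_def ctrl_set_def finite_conts)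
  then obtain en where en: "bij_betw en Q {..<card Q}" "en (Run c) = 0" "en Acc = 1" "en Rej = (2::nat)"
    using ex_numbering[of Q "Run c" Acc Rej] by auto
  define de where "de = inv_into Q en"
  have de: "de (en q) = q" if "q \<in> Q" for q using en(1) that by (simp add: de_def bij_betw_inv_into_left)
  have deQ: "de i \<in> Q" if "i < card Q" for i
    using en(1) that by (metis bij_betw_def de_def inv_into_into lessThan_iff)
  have enl: "en q < card Q" if "q \<in> Q" for q using en(1) that by (auto simp: bij_betw_def)
  define M where "M = \<lparr>nstates = card Q, nsyms = 2 ^ Suc K,
    delta = (\<lambda>i a. case ctrl_step K out (de i) a of (q, a', d) \<Rightarrow> (en q, a', d))\<rparr>"
  have cQ: "card Q \<ge> 3"
    using enl[OF \<open>Rej \<in> Q\<close>] en(4) by simp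
  have valid: "valid_tm M"
    unfolding valid_tm_def
  proof (intro conjI allI impI)
    fix i a assume "i < nstates M" "a < nsyms M"
    then have "de i \<in> ctrl_set c" "a < 2 ^ Suc K" using deQ by (auto simp: M_def Q_def)
    then show "case delta M i a of (q', s', d) \<Rightarrow> q' < nstates M \<and> s' < nsyms M \<and> d \<in> {- 1, 0, 1}"
      using ctrl_step_valid[of "de i" c K a out, OF _ assms(2)] enl
      by (auto simp: M_def Q_def split: prod.splits simp del: power_Suc)
  qed (use cQ in \<open>auto simp: M_def\<close>)
  define emb where "emb = (\<lambda>(q, t, h). (en q, t, h) :: config)"
  \<comment> \<open>\<open>de\<close> inverts \<open>en\<close> only on \<open>Q\<close>, and
    controls are known to stay in \<open>Q\<close> only while the symbols stay below
    \<open>2 ^ Suc K\<close>.\<close>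
  define ok where "ok = (\<lambda>(q, t :: int \<Rightarrow> nat, h :: int). q \<in> Q \<and> (\<forall>i. t i < 2 ^ Suc K))"
  have step: "tm_step M (emb x) = emb (astep K out x) \<and> ok (astep K out x)" if okx: "ok x" for x
  proof -
    obtain q t h where x: "x = (q, t, h)" by (cases x) auto
    obtain q' a' d where st: "ctrl_step K out q (t h) = (q', a', d)" by (cases "ctrl_step K out q (t h)") auto
    have q: "q \<in> Q" "\<And>i. t i < 2 ^ Suc K" using okx by (auto simp: ok_def x)
    have v: "q' \<in> Q" "a' < 2 ^ Suc K"
      using ctrl_step_valid[OF _ assms(2) q(2) st] q(1) by (auto simp: Q_def)
    have inj: "en q = en p \<longleftrightarrow> q = p" if "p \<in> Q" for p using de q(1) that by metis
    have "tm_step M (emb x) = emb (astep K out x)"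
    proof (cases "q = Acc \<or> q = Rej")
      case True
      then show ?thesis using st by (auto simp: tm_step_def emb_def x astep_def halted_state_def en)
    next
      case False
      then have "\<not> halted_state (en q)"
        using inj[of Acc] inj[of Rej] \<open>Acc \<in> Q\<close> \<open>Rej \<in> Q\<close> en by (auto simp: halted_state_def)
      then show ?thesis using st q de by (simp add: tm_step_def emb_def x astep_def M_def)
    qed
    moreover have "ok (astep K out x)" using v q st by (auto simp: ok_def x astep_def)
    ultimately show ?thesis by blast
  qed
  have main: "(\<exists>n. halted_state (cstate (tm_run M w n))) \<and>
      (\<forall>n. halted_state (cstate (tm_run M w n)) \<longrightarrow> (cstate (tm_run M w n) = 1 \<longleftrightarrow> odd (u out))) \<and>
      (\<forall>n. \<bar>chead (tm_run M w n)\<bar> \<le> int B)"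
    if w: "set w \<subseteq> {1..<9}" and B: "1 \<le> B" "length w \<le> B" and ex: "exec (2 ^ B) c (init_regs w) u" for w B u
  proof -
    define t0 where "t0 = fst (snd (tm_init w))"
    define x0 where "x0 = (Run c, t0, 0 :: int)"
    have init: "tm_init w = emb x0" by (simp add: x0_def t0_def tm_init_def emb_def en)
    have wK: "w ! i < 2 ^ Suc K" if "i < length w" for i
    proof -
      have "w ! i < 9" using w that nth_mem by fastforce
      also have "9 \<le> (2::nat) ^ 5" by simp
      also have "\<dots> \<le> 2 ^ Suc K" using assms(1) by (intro power_increasing) auto
      finally show ?thesis .
    qed
    have ok0: "ok x0" using wK \<open>Run c \<in> Q\<close>
      by (auto simp: ok_def x0_def t0_def tm_init_def simp del: power_Suc)
    have run: "tm_run M w n = emb ((astep K out ^^ n) x0) \<and> ok ((astep K out ^^ n) x0)" for n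
      by (induction n) (use ok0 init step in \<open>auto simp: tm_run_def\<close>)
    have "tape_rep K (init_regs w) (length w) t0"
      unfolding t0_def using w by (intro tape_rep_init) auto
    then obtain e t where t: "reach K out B (Run (c @ []), t0, 0) (Run [], t, 0)" "tape_rep K u e t"
      using exec_reach[OF ex refl B(1) assms(2), of "length w" t0 out "[]"] B(2) by auto
    define fin where "fin = (if odd (u out) then Acc else Rej, t, 0 :: int)"
    have "bit (t 0) out \<longleftrightarrow> odd (u out)"
      using t(2) assms(3) unfolding tape_rep_def by (metis bit_0 of_nat_0)
    then have "astep K out (Run [], t, 0) = fin" by (simp add: astep_def fin_def)
    then have "reach K out B (Run [], t, 0) fin"
      by (metis (no_types, opaque_lifting) abs_zero fin_def of_nat_0_le_iff reach_refl reach_step snd_conv)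
    then have "reach K out B x0 fin" using t(1) by (auto simp: x0_def intro: reach_trans)
    then obtain N where N: "(astep K out ^^ N) x0 = fin"
      "\<And>m. m \<le> N \<Longrightarrow> \<bar>snd (snd ((astep K out ^^ m) x0))\<bar> \<le> int B" by (auto simp: reach_def)
    have runN: "tm_run M w N = emb fin" using run N by simp
    have halt: "halted_state (cstate (emb fin))" "cstate (emb fin) = 1 \<longleftrightarrow> odd (u out)"
      by (auto simp: halted_state_def cstate_def emb_def fin_def en)
    \<comment> \<open>A halted machine is frozen, so all halting times show the same answer and the
      head bound extends past time \<open>N\<close>.\<close>
    have stay: "tm_run M w (n + k) = tm_run M w n" if "halted_state (cstate (tm_run M w n))" for n k
    proof (induction k)
      case (Suc k)
      then show ?case using that
        by (cases "tm_run M w n") (simp add: tm_run_def tm_step_def cstate_def)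
    qed simp
    show ?thesis
    proof (intro conjI allI impI)
      show "\<exists>n. halted_state (cstate (tm_run M w n))" using runN halt by (intro exI[of _ N]) simp
    next
      fix n assume "halted_state (cstate (tm_run M w n))"
      then have "tm_run M w n = tm_run M w (n + N)" using stay by simp
      also have "\<dots> = emb fin" using stay[of N n] runN halt by (simp add: add.commute)
      finally show "cstate (tm_run M w n) = 1 \<longleftrightarrow> odd (u out)" using halt by simp
    next
      fix n
      show "\<bar>chead (tm_run M w n)\<bar> \<le> int B"
      proof (cases "n \<le> N")
        case True
        then show ?thesis using N(2)[of n] run[of n]
          by (cases "(astep K out ^^ n) x0") (auto simp: chead_def emb_def)
      next
        case False
        then have "tm_run M w n = emb fin" using stay[of N "n - N"] runN halt by simp
        then show ?thesis by (simp add: chead_def emb_def fin_def)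
      qed
    qed
  qed
  show ?thesis using valid main by (intro exI[of _ M]) (auto simp: M_def)
qed

section \<open>Functions computable in polynomial space\<close>

text \<open>Numbers with polynomially many bits in \<open>L\<close>. The base \<open>L + 2\<close>
  is at least 2 even for \<open>L = 0\<close>, so a larger exponent absorbs constants, sums and
  products.\<close>

definition bnd :: "nat \<Rightarrow> nat \<Rightarrow> nat" where
  "bnd k L = 2 ^ ((L + 2) ^ k)"

lemma bnd_mono: "k \<le> k' \<Longrightarrow> bnd k L \<le> bnd k' L"
  unfolding bnd_def by (intro power_increasing) auto

lemma bnd_ge: "1 \<le> k \<Longrightarrow> 2 ^ L \<le> bnd k L"
proof -
  assume "1 \<le> k"
  then have "(L + 2) ^ 1 \<le> (L + 2) ^ k" by (intro power_increasing) auto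
  then show ?thesis unfolding bnd_def by (intro power_increasing) auto
qed

text \<open>The summand 2 added to the inner polynomial is absorbed by raising its exponent from
  \<open>k\<close> to \<open>k + 2\<close>.\<close>

lemma poly_compose: "((L + 2) ^ k + 2) ^ k' \<le> (L + 2 :: nat) ^ ((k + 2) * k')"
proof -
  have 1: "1 \<le> (L + 2) ^ k" by simp
  have "(2::nat) * 2 \<le> (L + 2) * (L + 2)" by (intro mult_mono) auto
  then have "(L + 2) ^ k * 4 \<le> (L + 2) ^ k * ((L + 2) * (L + 2))" by (intro mult_left_mono) auto
  moreover have "(L + 2) ^ (k + 2) = (L + 2) ^ k * ((L + 2) * (L + 2))"
    by (simp only: power_add power2_eq_square)
  ultimately have "(L + 2) ^ k + 2 \<le> (L + 2) ^ (k + 2)" using 1 by linarith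
  then have "((L + 2) ^ k + 2) ^ k' \<le> ((L + 2) ^ (k + 2)) ^ k'" by (rule power_mono) simp
  then show ?thesis by (simp only: power_mult)
qed

lemma bnd_compose: "bnd k' ((L + 2) ^ k) \<le> bnd ((k + 2) * k') L"
  unfolding bnd_def using poly_compose by (intro power_increasing) auto

definition pbd :: "nat \<Rightarrow> (nat list \<Rightarrow> nat) \<Rightarrow> bool" where
  "pbd n F \<longleftrightarrow> (\<exists>k. \<forall>xs L. length xs = n \<longrightarrow> (\<forall>x\<in>set xs. x < 2 ^ L) \<longrightarrow> F xs < bnd k L)"

text \<open>The registers from \<open>base\<close> on are scratch space: they are zero before and after. The arguments
  are preserved.\<close>

definition implements ::
  "nat \<Rightarrow> (nat list \<Rightarrow> nat) \<Rightarrow> nat list \<Rightarrow> nat \<Rightarrow> nat \<Rightarrow> instr list \<Rightarrow> bool" where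
  "implements k F args dst base c \<longleftrightarrow>
     (\<forall>s L X. (\<forall>r\<ge>base. s r = 0) \<longrightarrow> s dst = 0 \<longrightarrow> (\<forall>a\<in>set args. s a < 2 ^ L) \<longrightarrow> bnd k L \<le> X \<longrightarrow>
        exec X c s (s(dst := F (map s args))))"

text \<open>Computability in polynomial space. The exponent \<open>k\<close> is fixed before the
  registers, whereas the program may depend on them; hence subprograms can be placed on any
  registers at a known cost.\<close>

definition pc :: "nat \<Rightarrow> (nat list \<Rightarrow> nat) \<Rightarrow> bool" where
  "pc n F \<longleftrightarrow> pbd n F \<and>
     (\<exists>k. \<forall>args dst base. length args = n \<longrightarrow> (\<forall>a\<in>set args. a < base \<and> a \<noteq> dst) \<longrightarrow> dst < base \<longrightarrow>
        (\<exists>c. implements k F args dst base c))"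

text \<open>Monotonicity in the exponent is built in, so that exponents of several ingredients can
  be merged by adding them.\<close>

abbreviation (input) bounded_from :: "nat \<Rightarrow> nat \<Rightarrow> (nat list \<Rightarrow> nat) \<Rightarrow> prop" where
  "PROP bounded_from k n F \<equiv> (\<And>xs L k'. length xs = n \<Longrightarrow> (\<And>x. x \<in> set xs \<Longrightarrow> x < 2 ^ L) \<Longrightarrow>
     k \<le> k' \<Longrightarrow> F xs < bnd k' L)"

abbreviation (input) implementable_from :: "nat \<Rightarrow> nat \<Rightarrow> (nat list \<Rightarrow> nat) \<Rightarrow> prop" where
  "PROP implementable_from k n F \<equiv> (\<And>args dst base k'. length args = n \<Longrightarrow>
     (\<And>a. a \<in> set args \<Longrightarrow> a < base \<and> a \<noteq> dst) \<Longrightarrow> dst < base \<Longrightarrow> k \<le> k' \<Longrightarrow>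
     \<exists>c. implements k' F args dst base c)"

lemma implements_mono: "implements k F args dst base c \<Longrightarrow> k \<le> k' \<Longrightarrow> implements k' F args dst base c"
  unfolding implements_def by (meson bnd_mono order_trans)

lemma pbdE:
  assumes "pbd n F"
  obtains k where "1 \<le> k" "PROP bounded_from k n F"
proof -
  from assms obtain k where "\<forall>xs L. length xs = n \<longrightarrow> (\<forall>x\<in>set xs. x < 2 ^ L) \<longrightarrow> F xs < bnd k L"
    by (auto simp: pbd_def)
  then have "F xs < bnd k' L" if "length xs = n" "\<And>x. x \<in> set xs \<Longrightarrow> x < 2 ^ L" "k + 1 \<le> k'" for xs L k'
    using that bnd_mono[of k k' L] by (metis add_leD1 less_le_trans)
  then show ?thesis using that[of "k + 1"] by auto
qed

lemma pc_pbd: "pc n F \<Longrightarrow> pbd n F"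
  by (simp add: pc_def)

lemma pcE:
  assumes "pc n F"
  obtains k where "PROP implementable_from k n F"
proof -
  from assms obtain k where k: "\<forall>args dst base. length args = n \<longrightarrow> (\<forall>a\<in>set args. a < base \<and> a \<noteq> dst) \<longrightarrow>
    dst < base \<longrightarrow> (\<exists>c. implements k F args dst base c)" by (auto simp: pc_def)
  show thesis
  proof (rule that[of k])
    fix args :: "nat list" and dst base k' :: nat
    assume "length args = n" "\<And>a. a \<in> set args \<Longrightarrow> a < base \<and> a \<noteq> dst" "dst < base" and k': "k \<le> k'"
    then obtain c where "implements k F args dst base c" using k by blast
    then show "\<exists>c. implements k' F args dst base c" using implements_mono k' by blast
  qed
qed

lemma pcI:
  assumes "pbd n F"
    and "\<And>args dst base. length args = n \<Longrightarrow> (\<And>a. a \<in> set args \<Longrightarrow> a < base \<and> a \<noteq> dst)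
     \<Longrightarrow> dst < base \<Longrightarrow> \<exists>c. implements k F args dst base c"
  shows "pc n F"
  using assms unfolding pc_def by blast

lemma implementsI:
  assumes "\<And>s L X. (\<And>r. r \<ge> base \<Longrightarrow> s r = 0) \<Longrightarrow> s dst = 0 \<Longrightarrow> (\<And>a. a \<in> set args \<Longrightarrow> s a < 2 ^ L)
     \<Longrightarrow> bnd k L \<le> X \<Longrightarrow> exec X c s (s(dst := F (map s args)))"
  shows "implements k F args dst base c"
  using assms unfolding implements_def by blast

lemma implementsD:
  assumes "implements k F args dst base c"
    and "\<And>r. r \<ge> base \<Longrightarrow> s r = 0" "s dst = 0" "\<And>a. a \<in> set args \<Longrightarrow> s a < 2 ^ L" "bnd k L \<le> X"
  shows "exec X c s (s(dst := F (map s args)))"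
  using assms unfolding implements_def by blast

lemma pbd_mono:
  assumes "pbd n H" "\<And>xs. length xs = n \<Longrightarrow> F xs \<le> H xs"
  shows "pbd n F"
  using assms unfolding pbd_def by (meson le_less_trans)

lemma pc_cong:
  assumes "pc n F" "\<And>xs. length xs = n \<Longrightarrow> F xs = G xs"
  shows "pc n G"
proof -
  obtain k where k: "PROP implementable_from k n F" using pcE[OF assms(1)] by blast
  have "pbd n G" using pbd_mono[OF pc_pbd[OF assms(1)]] assms(2) by simp
  moreover have "implements k F args dst base c \<longleftrightarrow> implements k G args dst base c" if "length args = n"
      for args dst base c
    unfolding implements_def using assms(2) that by simp
  ultimately show ?thesis using k by (intro pcI[of n G k]) (assumption, metis order_refl)
qed

section \<open>Moving and copying registers, projections and constants\<close>

lemma exec_append: "exec X c s t \<Longrightarrow> exec X d t u \<Longrightarrow> exec X (c @ d) s u"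
  by (induction rule: exec.induct) (auto intro: exec.intros)

lemma exec_Dec1: "s r > 0 \<Longrightarrow> exec X [Dec r] s (s(r := s r - 1))"
  by (intro exec.intros)

lemma exec_Inc1: "s r + 1 < X \<Longrightarrow> exec X [Inc r] s (s(r := s r + 1))"
  by (intro exec.intros)

lemma exec_clear: "exec X [While r [Dec r]] s (s(r := 0))"
proof (induction "s r" arbitrary: s)
  case 0
  then have "s(r := 0) = s" by auto
  then show ?case using 0 by (auto intro!: exec.intros)
next
  case (Suc x)
  have "exec X [Dec r] s (s(r := s r - 1))" using Suc(2) by (auto intro!: exec.intros)
  moreover have "exec X [While r [Dec r]] (s(r := s r - 1)) ((s(r := s r - 1))(r := 0))"
    using Suc by (metis diff_Suc_1 fun_upd_same)
  ultimately show ?case using Suc(2) by (auto intro: exec_WhileS)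
qed

lemma exec_move:
  assumes "a \<noteq> d" "s d + s a < X"
  shows "exec X [While a [Dec a, Inc d]] s (s(a := 0, d := s d + s a))"
  using assms(2)
proof (induction "s a" arbitrary: s)
  case 0
  then have "s(a := 0, d := s d + s a) = s" by auto
  moreover have "exec X [While a [Dec a, Inc d]] s s" using 0 by (auto intro!: exec.intros)
  ultimately show ?case by (simp only:)
next
  case (Suc x)
  let ?s = "s(a := s a - 1, d := s d + 1)"
  have "exec X [Dec a, Inc d] s ?s"
    using exec_Dec1[of s a X] exec_Inc1[of "s(a := s a - 1)" d X] Suc(2,3) assms(1)
    by (auto dest: exec_append)
  moreover have "exec X [While a [Dec a, Inc d]] ?s (?s(a := 0, d := ?s d + ?s a))"
    using Suc assms(1) by (intro Suc(1)) auto
  moreover have "?s(a := 0, d := ?s d + ?s a) = s(a := 0, d := s d + s a)"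
    using Suc(2) assms(1) by (auto simp: fun_eq_iff)
  ultimately show ?case using Suc(2) by (auto intro: exec_WhileS)
qed

lemma exec_move2:
  assumes "a \<noteq> d" "a \<noteq> e" "d \<noteq> e" "s d + s a < X" "s e + s a < X"
  shows "exec X [While a [Dec a, Inc d, Inc e]] s (s(a := 0, d := s d + s a, e := s e + s a))"
  using assms(4,5)
proof (induction "s a" arbitrary: s)
  case 0
  then have "s(a := 0, d := s d + s a, e := s e + s a) = s" by auto
  moreover have "exec X [While a [Dec a, Inc d, Inc e]] s s" using 0 by (auto intro!: exec.intros)
  ultimately show ?case by (simp only:)
next
  case (Suc x)
  let ?s = "s(a := s a - 1, d := s d + 1, e := s e + 1)"
  have "exec X [Dec a, Inc d, Inc e] s ?s"
  proof -
    have "exec X [Dec a] s (s(a := s a - 1))" using Suc(2) by (intro exec_Dec1) simp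
    moreover have "exec X [Inc d] (s(a := s a - 1)) (s(a := s a - 1, d := s d + 1))"
      using exec_Inc1[of "s(a := s a - 1)" d X] Suc(2-4) assms(1-3) by simp
    moreover have "exec X [Inc e] (s(a := s a - 1, d := s d + 1)) ?s"
      using exec_Inc1[of "s(a := s a - 1, d := s d + 1)" e X] Suc(2-4) assms(1-3) by simp
    ultimately have "exec X ([Dec a] @ [Inc d] @ [Inc e]) s ?s" by (metis exec_append)
    then show ?thesis by simp
  qed
  moreover have "exec X [While a [Dec a, Inc d, Inc e]] ?s (?s(a := 0, d := ?s d + ?s a, e := ?s e + ?s a))"
    using Suc assms(1-3) by (intro Suc(1)) auto
  moreover have "?s(a := 0, d := ?s d + ?s a, e := ?s e + ?s a) = s(a := 0, d := s d + s a, e := s e + s a)"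
    using Suc(2) assms(1-3) by (auto simp: fun_eq_iff)
  ultimately show ?case using Suc(2) by (auto intro: exec_WhileS)
qed

lemma pc_nth: "i < n \<Longrightarrow> pc n (\<lambda>xs. xs ! i)"
proof (rule pcI[of _ _ 1])
  assume i: "i < n"
  show "pbd n (\<lambda>xs. xs ! i)"
    unfolding pbd_def
  proof (intro exI[of _ 1] allI impI)
    fix xs :: "nat list" and L assume "length xs = n" "\<forall>x\<in>set xs. x < 2 ^ L"
    then have "xs ! i < 2 ^ L" using i by simp
    then show "xs ! i < bnd 1 L" using bnd_ge[of 1 L] by simp
  qed
  fix args :: "nat list" and dst base :: nat assume a: "length args = n" "\<And>a. a \<in> set args \<Longrightarrow> a < base \<and> a
      \<noteq> dst" "dst < base"
  define x where "x = args ! i"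
  have x: "x < base" "x \<noteq> dst" "x \<in> set args" using a i by (auto simp: x_def)
  \<comment> \<open>Reading a register empties it. A second copy is therefore collected in the
    scratch register \<open>base\<close> and moved back.\<close>
  let ?c = "[While x [Dec x, Inc dst, Inc base]] @ [While base [Dec base, Inc x]]"
  have "implements 1 (\<lambda>xs. xs ! i) args dst base ?c"
  proof (rule implementsI)
    fix s :: "nat \<Rightarrow> nat" and L X assume s: "\<And>r. base \<le> r \<Longrightarrow> s r = 0" "s dst = 0" "\<And>a. a \<in> set args \<Longrightarrow> s a <
        2 ^ L" "bnd 1 L \<le> X"
    have sx: "s x < X" using s(3)[OF x(3)] s(4) bnd_ge[of 1 L] by simp
    let ?s1 = "s(x := 0, dst := s dst + s x, base := s base + s x)"
    let ?s2 = "?s1(base := 0, x := ?s1 x + ?s1 base)"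
    have "exec X [While x [Dec x, Inc dst, Inc base]] s ?s1"
      by (rule exec_move2) (use x a s sx in auto)
    moreover have "exec X [While base [Dec base, Inc x]] ?s1 ?s2"
      by (rule exec_move) (use x a s sx in auto)
    moreover have "?s2 = s(dst := map s args ! i)"
      using x a i s by (auto simp: fun_eq_iff x_def)
    ultimately show "exec X ?c s (s(dst := map s args ! i))" by (metis exec_append)
  qed
  then show "\<exists>c. implements 1 (\<lambda>xs. xs ! i) args dst base c" by blast
qed

lemma pc_0: "pc n (\<lambda>xs. 0)"
proof (rule pcI[of _ _ 0])
  show "pbd n (\<lambda>xs. 0)" by (auto simp: pbd_def bnd_def)
  fix args :: "nat list" and dst base :: nat
  have "implements 0 (\<lambda>xs. 0) args dst base []"
  proof (rule implementsI)
    fix s X assume "s dst = (0::nat)"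
    then have "s(dst := 0) = s" by auto
    then show "exec X [] s (s(dst := 0))" by (simp add: exec_Nil)
  qed
  then show "\<exists>c. implements 0 (\<lambda>xs. 0) args dst base c" by blast
qed

lemma double_bnd: "2 * bnd k L \<le> bnd (k + 1) L"
proof -
  have "(1::nat) \<le> (L + 2) ^ k" by simp
  moreover have "2 * (L + 2) ^ k \<le> (L + 2) * (L + 2) ^ k" by (rule mult_right_mono) auto
  moreover have "(L + 2) ^ (k + 1) = (L + 2) * (L + 2) ^ k" by simp
  ultimately have "Suc ((L + 2) ^ k) \<le> (L + 2) ^ (k + 1)" by linarith
  then have "2 ^ Suc ((L + 2) ^ k) \<le> (2::nat) ^ ((L + 2) ^ (k + 1))" by (intro power_increasing) auto
  then show ?thesis by (simp add: bnd_def)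
qed

lemma pbd_add: "pbd n F \<Longrightarrow> pbd n G \<Longrightarrow> pbd n (\<lambda>xs. F xs + G xs)"
proof -
  assume "pbd n F" "pbd n G"
  then obtain k1 k2 where k: "PROP bounded_from k1 n F"
    "PROP bounded_from k2 n G"
    by (metis pbdE)
  have "F xs + G xs < bnd (k1 + k2 + 1) L" if "length xs = n" "\<And>x. x \<in> set xs \<Longrightarrow> x < 2 ^ L" for xs L
    using k(1)[OF that, of "k1 + k2"] k(2)[OF that, of "k1 + k2"] double_bnd[of "k1 + k2" L] by simp
  then show ?thesis unfolding pbd_def by blast
qed

lemma pbd_mult: "pbd n F \<Longrightarrow> pbd n G \<Longrightarrow> pbd n (\<lambda>xs. F xs * G xs)"
proof -
  assume "pbd n F" "pbd n G"
  then obtain k1 k2 where k: "PROP bounded_from k1 n F"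
    "PROP bounded_from k2 n G"
    by (metis pbdE)
  have "F xs * G xs < bnd (k1 + k2 + 1) L" if "length xs = n" "\<And>x. x \<in> set xs \<Longrightarrow> x < 2 ^ L" for xs L
  proof -
    have "F xs * G xs < bnd (k1 + k2) L * bnd (k1 + k2) L"
      using k(1)[OF that, of "k1 + k2"] k(2)[OF that, of "k1 + k2"] by (intro mult_strict_mono) auto
    also have "\<dots> = 2 ^ (2 * (L + 2) ^ (k1 + k2))" by (simp add: bnd_def mult_2 power_add)
    also have "\<dots> \<le> bnd (k1 + k2 + 1) L" unfolding bnd_def by (intro power_increasing) auto
    finally show ?thesis .
  qed
  then show ?thesis unfolding pbd_def by blast
qed

lemma pbd_const: "pbd n (\<lambda>xs. c)"
proof (induction c)
  case 0
  show ?case by (rule pc_pbd[OF pc_0])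
next
  case (Suc c)
  have "pbd n (\<lambda>xs. 1)" unfolding pbd_def by (intro exI[of _ 0]) (simp add: bnd_def)
  from pbd_add[OF Suc this] show ?case by simp
qed

lemma pc_Suc: assumes "pc n F" shows "pc n (\<lambda>xs. Suc (F xs))"
proof -
  obtain k where k: "PROP implementable_from k n F" using pcE[OF assms] by blast
  have pb: "pbd n (\<lambda>xs. Suc (F xs))" using pbd_add[OF pc_pbd[OF assms] pbd_const[of n 1]] by simp
  define G where "G = (\<lambda>xs. Suc (F xs))"
  have pG: "pbd n G" using pb by (simp add: G_def)
  obtain k2 where "1 \<le> k2" and k2: "PROP bounded_from k2 n G"
    using pbdE[OF pG] by blast
  show ?thesis
  proof (rule pcI[of _ _ "k + k2"], rule pb)
    fix args :: "nat list" and dst base :: nat assume a: "length args = n" "\<And>a. a \<in> set args \<Longrightarrow> a < base \<and>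
        a \<noteq> dst" "dst < base"
    obtain c where c: "implements (k + k2) F args dst base c" using k[of args base dst "k + k2", OF a] by auto
    have "implements (k + k2) (\<lambda>xs. Suc (F xs)) args dst base (c @ [Inc dst])"
    proof (rule implementsI)
      fix s :: "nat \<Rightarrow> nat" and L X assume s: "\<And>r. base \<le> r \<Longrightarrow> s r = 0" "s dst = 0" "\<And>a. a \<in> set args \<Longrightarrow> s a
          < 2 ^ L" "bnd (k + k2) L \<le> X"
      let ?s = "s(dst := F (map s args))"
      have "exec X c s ?s" by (rule implementsD[OF c]) (use s in auto)
      moreover have "G (map s args) < bnd (k + k2) L" by (rule k2) (use s(3) a(1) in auto)
      then have "Suc (F (map s args)) < X" using s(4) by (simp add: G_def)
      then have "exec X [Inc dst] ?s (?s(dst := ?s dst + 1))" by (intro exec_Inc1) simp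
      ultimately show "exec X (c @ [Inc dst]) s (s(dst := Suc (F (map s args))))"
        by (auto dest: exec_append)
    qed
    then show "\<exists>c. implements (k + k2) (\<lambda>xs. Suc (F xs)) args dst base c" by blast
  qed
qed

lemma pc_const: "pc n (\<lambda>xs. c)"
  by (induction c) (auto intro: pc_0 pc_Suc)

lemma pbd_reindex:
  assumes "pbd m F" "length js = m" "\<And>j. j \<in> set js \<Longrightarrow> j < n"
  shows "pbd n (\<lambda>xs. F (map (\<lambda>j. xs ! j) js))"
proof -
  from assms(1) obtain k where k: "\<forall>xs L. length xs = m \<longrightarrow> (\<forall>x\<in>set xs. x < 2 ^ L) \<longrightarrow> F xs < bnd k L"
    by (auto simp: pbd_def)
  have "F (map (\<lambda>j. xs ! j) js) < bnd k L" if "length xs = n" "\<forall>x\<in>set xs. x < 2 ^ L" for xs L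
    using k assms(2,3) that by simp
  then show ?thesis unfolding pbd_def by blast
qed

lemma pc_reindex:
  assumes "pc m F" "length js = m" "\<And>j. j \<in> set js \<Longrightarrow> j < n"
  shows "pc n (\<lambda>xs. F (map (\<lambda>j. xs ! j) js))"
proof -
  obtain k where k: "PROP implementable_from k m F" using pcE[OF assms(1)] by blast
  show ?thesis
  proof (rule pcI[of _ _ k])
    show "pbd n (\<lambda>xs. F (map (\<lambda>j. xs ! j) js))" using pbd_reindex assms pc_pbd by blast
    fix args :: "nat list" and dst base :: nat assume a: "length args = n" "\<And>a. a \<in> set args \<Longrightarrow> a < base \<and>
        a \<noteq> dst" "dst < base"
    let ?as = "map (\<lambda>j. args ! j) js"
    have sub: "set ?as \<subseteq> set args" using a assms by auto
    then obtain c where c: "implements k F ?as dst base c"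
      using k[of ?as base dst k] a assms(2) by auto
    have "implements k (\<lambda>xs. F (map (\<lambda>j. xs ! j) js)) args dst base c"
    proof (rule implementsI)
      fix s :: "nat \<Rightarrow> nat" and L X assume s: "\<And>r. base \<le> r \<Longrightarrow> s r = 0" "s dst = 0" "\<And>a. a \<in> set args \<Longrightarrow> s a
          < 2 ^ L" "bnd k L \<le> X"
      have "exec X c s (s(dst := F (map s ?as)))" by (rule implementsD[OF c]) (use s sub in auto)
      moreover have "map s ?as = map (\<lambda>j. map s args ! j) js" using a assms by auto
      ultimately show "exec X c s (s(dst := F (map (\<lambda>j. map s args ! j) js)))" by (simp only:)
    qed
    then show "\<exists>c. implements k (\<lambda>xs. F (map (\<lambda>j. xs ! j) js)) args dst base c" by blast
  qed
qed

section \<open>Primitive recursion with bounded intermediate values\<close>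

lemma exec_loop:
  assumes body: "\<And>j. j < N \<Longrightarrow> exec X b (S j) (S (Suc j))"
    and cnt: "\<And>j. j \<le> N \<Longrightarrow> S j r = N - j"
  shows "exec X [While r b] (S 0) (S N)"
proof -
  have "exec X [While r b] (S (N - i)) (S N)" if "i \<le> N" for i
    using that
  proof (induction i)
    case 0
    then show ?case using cnt[of N] by (auto intro!: exec_While0 exec_Nil)
  next
    case (Suc i)
    have "exec X b (S (N - Suc i)) (S (N - i))" using body[of "N - Suc i"] Suc.prems by (simp add:
        Suc_diff_Suc)
    then show ?case using Suc cnt[of "N - Suc i"] by (auto intro: exec_WhileS)
  qed
  from this[of N] show ?thesis by simp
qed

text \<open>The recursion may run for exponentially many rounds; only the sizes of the counter and
  of the accumulator cost space, and \<open>H\<close> bounds the accumulator in every round.\<close>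

lemma pc_rec_list:
  assumes C: "pc n C" and I: "pc n I" and F: "pc (Suc (Suc n)) F" and H: "pbd n H"
    and bd: "\<And>xs j. length xs = n \<Longrightarrow> j \<le> C xs \<Longrightarrow> rec_nat (I xs) (\<lambda>i a. F (i # a # xs)) j \<le> H xs"
  shows "pc n (\<lambda>xs. rec_nat (I xs) (\<lambda>i a. F (i # a # xs)) (C xs))"
proof -
  define R where "R = (\<lambda>xs j. rec_nat (I xs) (\<lambda>i a. F (i # a # xs)) j)"
  obtain k1 where k1: "PROP implementable_from k1 n C" using pcE[OF C] by blast
  obtain k2 where k2: "PROP implementable_from k2 n I" using pcE[OF I] by blast
  obtain k3 where k3: "PROP implementable_from k3 (Suc (Suc n)) F" using pcE[OF F] by blast
  have "pbd n (\<lambda>xs. C xs + H xs)" using pbd_add pc_pbd C H by blast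
  then obtain k4 where k4: "1 \<le> k4" "\<And>xs L k'. length xs = n \<Longrightarrow> (\<And>x. x \<in> set xs \<Longrightarrow> x < 2 ^ L) \<Longrightarrow> k4 \<le> k' \<Longrightarrow> C
      xs + H xs < bnd k' L"
    using pbdE by blast
  \<comment> \<open>The step function is run on a counter and an accumulator of up to
    \<open>(L + 2) ^ k4\<close> bits, so its exponent \<open>k3\<close> enters through the
    composition bound.\<close>
  define k where "k = k1 + k2 + k4 + (k4 + 2) * k3"
  show ?thesis
  proof (rule pcI[of _ _ k])
    show "pbd n (\<lambda>xs. rec_nat (I xs) (\<lambda>i a. F (i # a # xs)) (C xs))"
      by (rule pbd_mono[OF H]) (use bd in auto)
    fix args :: "nat list" and dst base :: nat assume a: "length args = n" "\<And>a. a \<in> set args \<Longrightarrow> a < base \<and>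
        a \<noteq> dst" "dst < base"
    have a': "x < base + 4 \<and> x \<noteq> base + i" if "x \<in> set args" for x i using a(2)[OF that] by auto
    obtain cC where cC: "implements k C args base (base + 4) cC"
      using k1[of args "base + 4" base k, OF a(1)] a'[of _ 0] by (auto simp: k_def)
    obtain cI where cI: "implements k I args (base + 2) (base + 4) cI"
      using k2[of args "base + 4" "base + 2" k, OF a(1)] a'[of _ 2] by (auto simp: k_def)
    obtain cF where cF: "implements k3 F ((base + 1) # (base + 2) # args) (base + 3) (base + 4) cF"
    proof -
      have "\<exists>c. implements k3 F ((base + 1) # (base + 2) # args) (base + 3) (base + 4) c"
      proof (rule k3)
        show "x < base + 4 \<and> x \<noteq> base + 3" if "x \<in> set ((base + 1) # (base + 2) # args)" for x
          using that a'[of x 3] by auto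
      qed (use a(1) in auto)
      then show thesis using that by blast
    qed
    \<comment> \<open>Scratch layout: \<open>base\<close> holds the rounds left,
      \<open>base + 1\<close> the index, \<open>base + 2\<close> the accumulator and
      \<open>base + 3\<close> the new value, which must be zero again before the next call of
      \<open>cF\<close>.\<close>
    define body where "body = [Dec base] @ cF @ [While (base + 2) [Dec (base + 2)]] @
      [While (base + 3) [Dec (base + 3), Inc (base + 2)]] @ [Inc (base + 1)]"
    define prog where "prog = cC @ cI @ [While base body] @
      [While (base + 2) [Dec (base + 2), Inc dst]] @ [While (base + 1) [Dec (base + 1)]]"
    have "implements k (\<lambda>xs. rec_nat (I xs) (\<lambda>i a. F (i # a # xs)) (C xs)) args dst base prog"
    proof (rule implementsI)
      fix s :: "nat \<Rightarrow> nat" and L X assume s: "\<And>r. base \<le> r \<Longrightarrow> s r = 0" "s dst = 0" "\<And>a. a \<in> set args \<Longrightarrow> s a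
          < 2 ^ L" "bnd k L \<le> X"
      define xs where "xs = map s args"
      define N where "N = C xs"
      have lx: "length xs = n" using a by (simp add: xs_def)
      have CH: "C xs + H xs < bnd k4 L" using k4(2)[of xs L k4] s(3) lx by (auto simp: xs_def)
      have "bnd k4 L \<le> bnd k L" by (rule bnd_mono) (simp add: k_def)
      then have CHX: "C xs + H xs < X" using CH s(4) by simp
      have Rb: "R xs j \<le> H xs" if "j \<le> N" for j using bd[OF lx] that by (simp add: R_def N_def)
      \<comment> \<open>The state after \<open>j\<close> rounds.\<close>
      define S where "S = (\<lambda>j. s(base := N - j, base + 1 := j, base + 2 := R xs j))"
      have 1: "exec X cC s (s(base := N))"
        unfolding N_def xs_def by (rule implementsD[OF cC]) (use s in auto)
      have m: "map (s(base := N)) args = xs" using a(2) by (auto simp: xs_def)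
      have "exec X cI (s(base := N)) ((s(base := N))(base + 2 := I (map (s(base := N)) args)))"
        by (rule implementsD[OF cI]) (use s a in auto)
      moreover have "(s(base := N))(base + 2 := I (map (s(base := N)) args)) = S 0"
        unfolding m using s(1)[of "base + 1"] by (auto simp: S_def R_def fun_eq_iff)
      ultimately have 2: "exec X cI (s(base := N)) (S 0)" by simp
      have 3: "exec X [While base body] (S 0) (S N)"
      proof (rule exec_loop)
        fix j assume j: "j < N"
        let ?s1 = "(S j)(base := S j base - 1)"
        have e1: "exec X [Dec base] (S j) ?s1" using j by (intro exec.intros) (auto simp: S_def)
        let ?as = "(base + 1) # (base + 2) # args"
        have m1: "map ?s1 ?as = j # R xs j # xs"
          using a(2)[of base] a(2)[of "base + 1"] a(2)[of "base + 2"] by (auto simp: S_def xs_def)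
        let ?s2 = "?s1(base + 3 := F (map ?s1 ?as))"
        have e2: "exec X cF ?s1 ?s2"
        proof (rule implementsD[OF cF])
          show "?s1 x < 2 ^ ((L + 2) ^ k4)" if "x \<in> set ?as" for x
          proof -
            have "x = base + 1 \<Longrightarrow> ?s1 x < bnd k4 L" using CH j by (simp add: S_def N_def)
            moreover have "x = base + 2 \<Longrightarrow> ?s1 x < bnd k4 L" using CH Rb[of j] j by (simp add: S_def)
            moreover have "x \<in> set args \<Longrightarrow> ?s1 x < bnd k4 L"
              using s(3)[of x] a(2)[of x] bnd_ge[OF k4(1), of L] by (simp add: S_def)
            ultimately show ?thesis using that by (auto simp: bnd_def)
          qed
          have "bnd k3 ((L + 2) ^ k4) \<le> bnd ((k4 + 2) * k3) L" by (rule bnd_compose)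
          also have "\<dots> \<le> bnd k L" by (rule bnd_mono) (simp add: k_def)
          finally show "bnd k3 ((L + 2) ^ k4) \<le> X" using s(4) by simp
        qed (use s in \<open>auto simp: S_def\<close>)
        have f: "F (map ?s1 ?as) = R xs (Suc j)" unfolding m1 by (simp add: R_def)
        let ?s3 = "?s2(base + 2 := 0)"
        have e3: "exec X [While (base + 2) [Dec (base + 2)]] ?s2 ?s3" by (rule exec_clear)
        let ?s4 = "?s3(base + 3 := 0, base + 2 := ?s3 (base + 2) + ?s3 (base + 3))"
        have e4: "exec X [While (base + 3) [Dec (base + 3), Inc (base + 2)]] ?s3 ?s4"
          by (rule exec_move) (use Rb[of "Suc j"] j CHX f in auto)
        let ?s5 = "?s4(base + 1 := ?s4 (base + 1) + 1)"
        have e5: "exec X [Inc (base + 1)] ?s4 ?s5"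
          using j CHX by (intro exec.intros) (auto simp: S_def N_def)
        have "?s5 = S (Suc j)"
          unfolding f using s(1)[of "base + 3"] j by (auto simp: S_def fun_eq_iff)
        moreover have "exec X body (S j) ?s5" unfolding body_def
          by (rule exec_append[OF e1 exec_append[OF e2 exec_append[OF e3 exec_append[OF e4 e5]]]])
        ultimately show "exec X body (S j) (S (Suc j))" by simp
      next
        show "S j base = N - j" for j by (simp add: S_def)
      qed
      let ?t = "(S N)(base + 2 := 0, dst := S N dst + S N (base + 2))"
      have 4: "exec X [While (base + 2) [Dec (base + 2), Inc dst]] (S N) ?t"
        by (rule exec_move) (use Rb[of N] CHX a s in \<open>auto simp: S_def\<close>)
      have 5: "exec X [While (base + 1) [Dec (base + 1)]] ?t (?t(base + 1 := 0))" by (rule exec_clear)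
      have "?t(base + 1 := 0) = s(dst := R xs (C xs))"
        using a s by (auto simp: S_def fun_eq_iff N_def)
      moreover have "exec X prog s (?t(base + 1 := 0))" unfolding prog_def
        by (rule exec_append[OF 1 exec_append[OF 2 exec_append[OF 3 exec_append[OF 4 5]]]])
      ultimately show "exec X prog s (s(dst := rec_nat (I (map s args)) (\<lambda>i a. F (i # a # map s args)) (C
          (map s args))))"
        by (simp add: R_def xs_def)
    qed
    then show "\<exists>c. implements k (\<lambda>xs. rec_nat (I xs) (\<lambda>i a. F (i # a # xs)) (C xs)) args dst base c" by blast
  qed
qed

abbreviation pcb :: "nat \<Rightarrow> (nat list \<Rightarrow> bool) \<Rightarrow> bool" where
  "pcb n P \<equiv> pc n (\<lambda>xs. of_bool (P xs))"

lemma pc_tl: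
  assumes "pc n F"
  shows "pc (Suc n) (\<lambda>ys. F (tl ys))"
proof (rule pc_cong)
  show "pc (Suc n) (\<lambda>xs. F (map (\<lambda>j. xs ! j) [1..<Suc n]))"
    by (rule pc_reindex[OF assms]) auto
  fix xs :: "nat list" assume "length xs = Suc n"
  then have "map (\<lambda>j. xs ! j) [1..<Suc n] = tl xs"
    by (intro nth_equalityI) (auto simp: nth_tl simp del: upt_Suc)
  then show "F (map (\<lambda>j. xs ! j) [1..<Suc n]) = F (tl xs)" by simp
qed

lemma pc_hd: "pc (Suc n) (\<lambda>ys. hd ys)"
proof (rule pc_cong[OF pc_nth[of 0 "Suc n"]])
  show "xs ! 0 = hd xs" if "length xs = Suc n" for xs :: "nat list" using that by (cases xs) auto
qed simp

text \<open>Weakening under binders: a predicate on a bound variable and the outer arguments is used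
  where \<open>k\<close> further variables have been pushed in between.\<close>

lemma pc_skip:
  assumes "pc (Suc n) (\<lambda>ys. F (hd ys) (tl ys))"
  shows "pc (Suc (k + n)) (\<lambda>ys. F (hd ys) ((tl ^^ k) (tl ys)))"
proof (rule pc_cong)
  let ?js = "0 # [Suc k..<Suc (k + n)]"
  show "pc (Suc (k + n)) (\<lambda>ys. F (hd (map (\<lambda>j. ys ! j) ?js)) (tl (map (\<lambda>j. ys ! j) ?js)))"
    by (rule pc_reindex[OF assms]) (auto simp del: upt_Suc)
  fix ys :: "nat list" assume l: "length ys = Suc (k + n)"
  have "(tl ^^ k) (tl ys) = drop k (tl ys)" by (induction k) (auto simp: drop_Suc tl_drop)
  also have "\<dots> = map (\<lambda>j. ys ! j) [Suc k..<Suc (k + n)]"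
    using l by (intro nth_equalityI) (auto simp: nth_tl simp del: upt_Suc)
  finally show "F (hd (map (\<lambda>j. ys ! j) ?js)) (tl (map (\<lambda>j. ys ! j) ?js)) = F (hd ys) ((tl ^^ k) (tl ys))"
    using l by (cases ys) auto
qed

lemmas pc_skip1 = pc_skip[where k = 1, simplified]

lemma pc_rec:
  assumes "pc n C" "pc n I" "pc (Suc (Suc n)) (\<lambda>ys. F (hd ys) (hd (tl ys)) (tl (tl ys)))" "pbd n H"
    and "\<And>xs j. length xs = n \<Longrightarrow> j \<le> C xs \<Longrightarrow> rec_nat (I xs) (\<lambda>i a. F i a xs) j \<le> H xs"
  shows "pc n (\<lambda>xs. rec_nat (I xs) (\<lambda>i a. F i a xs) (C xs))"
  using pc_rec_list[OF assms(1-4)] assms(5) by simp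

section \<open>Arithmetic, Boolean connectives and bounded quantifiers\<close>

lemma pc_add:
  assumes "pc n F" "pc n G" shows "pc n (\<lambda>xs. F xs + G xs)"
proof -
  have r: "rec_nat a (\<lambda>_. Suc) m = m + a" for m a by (induction m) auto
  have "pc n (\<lambda>xs. rec_nat (G xs) (\<lambda>i a. Suc a) (F xs))"
    by (rule pc_rec[where H = "\<lambda>xs. F xs + G xs"])
      (use assms in \<open>auto intro!: pc_Suc pc_hd pc_tl pbd_add pc_pbd[OF assms(1)] pc_pbd[OF assms(2)] simp: r\<close>)
  then show ?thesis by (simp add: r)
qed

lemma pc_mult:
  assumes "pc n F" "pc n G" shows "pc n (\<lambda>xs. F xs * G xs)"
proof -
  have r: "rec_nat 0 (\<lambda>_ a. a + g) m = m * g" for m g :: nat by (induction m) auto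
  have "pc n (\<lambda>xs. rec_nat 0 (\<lambda>i a. a + G xs) (F xs))"
    by (rule pc_rec[where H = "\<lambda>xs. F xs * G xs"])
      (use assms in \<open>auto intro!: pc_0 pc_add pc_tl[OF pc_hd] pc_tl[OF pc_tl[of _ G]] pbd_mult pc_pbd[OF
          assms(1)] pc_pbd[OF assms(2)] simp: r\<close>)
  then show ?thesis by (simp add: r)
qed

lemma pc_pred:
  assumes "pc n F" shows "pc n (\<lambda>xs. F xs - 1)"
proof -
  have r: "rec_nat 0 (\<lambda>i a. i) m = m - 1" for m :: nat by (cases m) auto
  have "pc n (\<lambda>xs. rec_nat 0 (\<lambda>i a. i) (F xs))"
    by (rule pc_rec[where H = F]) (use assms in \<open>auto intro!: pc_0 pc_hd pc_pbd simp: r\<close>)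
  then show ?thesis by (simp add: r)
qed

lemma pc_diff:
  assumes "pc n F" "pc n G" shows "pc n (\<lambda>xs. F xs - G xs)"
proof -
  have r: "rec_nat f (\<lambda>i a. a - 1) m = f - m" for m f :: nat by (induction m) auto
  have "pc n (\<lambda>xs. rec_nat (F xs) (\<lambda>i a. a - 1) (G xs))"
    by (rule pc_rec[where H = F])
      (use assms in \<open>auto intro!: pc_pred[unfolded One_nat_def] pc_tl[OF pc_hd] pc_pbd simp: r[unfolded
          One_nat_def]\<close>)
  then show ?thesis unfolding r .
qed

lemma pcb_le: assumes "pc n F" "pc n G" shows "pcb n (\<lambda>xs. F xs \<le> G xs)"
proof -
  have "pc n (\<lambda>xs. 1 - (F xs - G xs))" by (intro pc_diff pc_const assms)
  moreover have "1 - (a - b) = of_bool (a \<le> b)" for a b :: nat by auto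
  ultimately show ?thesis by simp
qed

lemma pcb_less: assumes "pc n F" "pc n G" shows "pcb n (\<lambda>xs. F xs < G xs)"
  using pcb_le[OF pc_Suc[OF assms(1)] assms(2)] by (simp add: Suc_le_eq)

lemma pcb_conj: assumes "pcb n P" "pcb n Q" shows "pcb n (\<lambda>xs. P xs \<and> Q xs)"
  using pc_mult[OF assms] by (simp add: of_bool_conj)

lemma pcb_not: assumes "pcb n P" shows "pcb n (\<lambda>xs. \<not> P xs)"
proof -
  have "pc n (\<lambda>xs. 1 - of_bool (P xs))" by (intro pc_diff pc_const assms)
  moreover have "1 - of_bool p = (of_bool (\<not> p) :: nat)" for p by auto
  ultimately show ?thesis by simp
qed

lemma pcb_disj: assumes "pcb n P" "pcb n Q" shows "pcb n (\<lambda>xs. P xs \<or> Q xs)"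
  using pcb_not[OF pcb_conj[OF pcb_not[OF assms(1)] pcb_not[OF assms(2)]]] by simp

lemma pcb_imp: assumes "pcb n P" "pcb n Q" shows "pcb n (\<lambda>xs. P xs \<longrightarrow> Q xs)"
  using pcb_not[OF pcb_conj[OF assms(1) pcb_not[OF assms(2)]]] by simp

lemma pcb_iff: assumes "pcb n P" "pcb n Q" shows "pcb n (\<lambda>xs. P xs \<longleftrightarrow> Q xs)"
  using pcb_conj[OF pcb_imp[OF assms] pcb_imp[OF assms(2,1)]] by (simp add: iff_conv_conj_imp)

lemma pcb_eq: assumes "pc n F" "pc n G" shows "pcb n (\<lambda>xs. F xs = G xs)"
  using pcb_conj[OF pcb_le[OF assms] pcb_le[OF assms(2,1)]] by (simp add: order_eq_iff)

lemma pc_if: assumes "pcb n P" "pc n F" "pc n G" shows "pc n (\<lambda>xs. if P xs then F xs else G xs)"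
proof -
  have "pc n (\<lambda>xs. of_bool (P xs) * F xs + of_bool (\<not> P xs) * G xs)"
    by (intro pc_add pc_mult assms pcb_not)
  moreover have "of_bool p * a + of_bool (\<not> p) * b = (if p then a else b :: nat)" for p a b by auto
  ultimately show ?thesis by simp
qed

lemma pcb_if: assumes "pcb n P" "pcb n F" "pcb n G" shows "pcb n (\<lambda>xs. if P xs then F xs else G xs)"
  using pc_if[OF assms] by (simp add: if_distrib)

lemma pc_min: assumes "pc n F" "pc n G" shows "pc n (\<lambda>xs. min (F xs) (G xs))"
  unfolding min_def by (intro pc_if pcb_le assms)

lemma pc_max: assumes "pc n F" "pc n G" shows "pc n (\<lambda>xs. max (F xs) (G xs))"
  unfolding max_def by (intro pc_if pcb_le assms)

text \<open>A bound variable is pushed onto the argument list, so under a quantifier the enclosing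
  variables are reached through \<open>tl\<close>.\<close>

lemma pcb_ex:
  assumes "pc n F" "pcb (Suc n) (\<lambda>ys. P (hd ys) (tl ys))"
  shows "pcb n (\<lambda>xs. \<exists>i<F xs. P i xs)"
proof -
  have r: "rec_nat 0 (\<lambda>i a. if P i xs then 1 else a) m = (of_bool (\<exists>i<m. P i xs) :: nat)" for m xs
    by (induction m) (auto simp: less_Suc_eq)
  have "pcb (Suc (Suc n)) (\<lambda>ys. P (hd ys) (tl (tl ys)))"
    using pc_skip1[of n "\<lambda>i xs. of_bool (P i xs)"] assms(2) by simp
  then have "pc n (\<lambda>xs. rec_nat 0 (\<lambda>i a. if P i xs then 1 else a) (F xs))"
    by (intro pc_rec[where H = "\<lambda>_. 1"] assms(1) pc_0 pbd_const pc_if pc_const pc_tl[OF pc_hd])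
      (use r in auto)
  then show ?thesis by (simp add: r)
qed

lemma pcb_all:
  assumes "pc n F" "pcb (Suc n) (\<lambda>ys. P (hd ys) (tl ys))"
  shows "pcb n (\<lambda>xs. \<forall>i<F xs. P i xs)"
  using pcb_not[OF pcb_ex[OF assms(1) pcb_not[OF assms(2)]]] by simp

text \<open>For a property that holds exactly on an initial segment this is the length of the
  segment. Quotients, binary lengths and carry lengths are obtained in this way without a search
  operator.\<close>

definition count :: "(nat \<Rightarrow> bool) \<Rightarrow> nat \<Rightarrow> nat" where
  "count P m = card {i. i < m \<and> P i}"

lemma count_rec: "count P m = rec_nat 0 (\<lambda>i a. if P i then Suc a else a) m"
proof (induction m)
  case (Suc m)
  have "{i. i < Suc m \<and> P i} = (if P m then insert m {i. i < m \<and> P i} else {i. i < m \<and> P i})"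
    by (auto simp: less_Suc_eq)
  then show ?case using Suc by (simp add: count_def)
qed (simp add: count_def)

lemma count_le: "count P m \<le> m"
proof -
  have "card {i. i < m \<and> P i} \<le> card {..<m}" by (intro card_mono) auto
  then show ?thesis by (simp add: count_def)
qed

lemma count_initial: "(\<And>i. i < m \<Longrightarrow> P i \<longleftrightarrow> i < k) \<Longrightarrow> k \<le> m \<Longrightarrow> count P m = k"
proof -
  assume "\<And>i. i < m \<Longrightarrow> P i \<longleftrightarrow> i < k" "k \<le> m"
  then have "{i. i < m \<and> P i} = {..<k}" by auto
  then show ?thesis by (simp add: count_def)
qed

lemma pc_count:
  assumes "pc n F" "pcb (Suc n) (\<lambda>ys. P (hd ys) (tl ys))"
  shows "pc n (\<lambda>xs. count (\<lambda>i. P i xs) (F xs))"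
proof -
  have "pcb (Suc (Suc n)) (\<lambda>ys. P (hd ys) (tl (tl ys)))"
    using pc_skip1[of n "\<lambda>i xs. of_bool (P i xs)"] assms(2) by simp
  then have "pc n (\<lambda>xs. rec_nat 0 (\<lambda>i a. if P i xs then Suc a else a) (F xs))"
    by (intro pc_rec[where H = F] assms(1) pc_0 pc_pbd pc_if pc_Suc pc_tl[OF pc_hd])
      (auto simp: count_rec[symmetric] intro: order_trans[OF count_le])
  then show ?thesis by (simp add: count_rec)
qed

lemma div_count: "(a::nat) div b = (if b = 0 then 0 else count (\<lambda>i. Suc i * b \<le> a) a)"
proof (cases "b = 0")
  case False
  have "Suc i * b \<le> a \<longleftrightarrow> i < a div b" for i
    using False by (metis Suc_le_eq less_eq_div_iff_mult_less_eq neq0_conv)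
  then show ?thesis using False by (simp add: count_initial[where k = "a div b"])
qed simp

lemma pc_div: assumes "pc n F" "pc n G" shows "pc n (\<lambda>xs. F xs div G xs)"
  unfolding div_count
  by (intro pc_if pcb_eq pc_0 assms pc_count pcb_le pc_mult pc_Suc pc_hd pc_tl[OF assms(1)] pc_tl[OF
      assms(2)])

lemma pc_mod: assumes "pc n F" "pc n G" shows "pc n (\<lambda>xs. F xs mod G xs)"
proof -
  have "pc n (\<lambda>xs. F xs - F xs div G xs * G xs)" by (intro pc_diff pc_mult pc_div assms)
  then show ?thesis by (simp add: minus_div_mult_eq_mod)
qed

section \<open>Shifts, binary digits and binary length\<close>

definition shr :: "nat \<Rightarrow> nat \<Rightarrow> nat" where "shr x i = x div 2 ^ i"

lemma pc_shr: assumes "pc n F" "pc n G" shows "pc n (\<lambda>xs. shr (F xs) (G xs))"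
proof -
  have r: "rec_nat x (\<lambda>_ a. a div 2) i = shr x i" for x i
    by (induction i) (auto simp: shr_def div_mult2_eq[symmetric] mult.commute)
  have "pc n (\<lambda>xs. rec_nat (F xs) (\<lambda>_ a. a div 2) (G xs))"
    by (intro pc_rec[where H = F] assms pc_pbd pc_div pc_const pc_tl[OF pc_hd])
      (auto simp: r shr_def)
  then show ?thesis by (simp add: r)
qed

text \<open>Powers are truncated because \<open>2 ^ i\<close> is not polynomially long in \<open>i\<close>.\<close>

definition pw :: "nat \<Rightarrow> nat \<Rightarrow> nat" where "pw x i = min (2 ^ i) (x + 1)"

lemma pc_pw: assumes "pc n F" "pc n G" shows "pc n (\<lambda>xs. pw (F xs) (G xs))"
proof -
  have r: "rec_nat 1 (\<lambda>_ a. min (2 * a) (x + 1)) i = pw x i" for x i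
    by (induction i) (auto simp: pw_def min_def)
  have "pc n (\<lambda>xs. rec_nat 1 (\<lambda>_ a. min (2 * a) (F xs + 1)) (G xs))"
    by (intro pc_rec[where H = "\<lambda>xs. F xs + 1"] assms pbd_add pbd_const pc_pbd[OF assms(1)] pc_min
        pc_mult pc_add pc_const
        pc_tl[OF pc_hd] pc_tl[OF pc_tl[OF assms(1)]])
      (auto simp: r[simplified] pw_def)
  then show ?thesis by (simp only: r)
qed

text \<open>The truncation is invisible here: if \<open>2 ^ i\<close> exceeds \<open>x + 1\<close>,
  then both moduli exceed \<open>x\<close> and leave it unchanged.\<close>

lemma mod_pw: "x mod pw x i = x mod 2 ^ i"
  by (cases "2 ^ i \<le> x + 1") (auto simp: pw_def min_def)

text \<open>Array access: \<open>x\<close> is an array of words of \<open>b\<close> bits. Networks,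
  rules, the input string and whole plays are stored this way.\<close>

definition dig :: "nat \<Rightarrow> nat \<Rightarrow> nat \<Rightarrow> nat" where
  "dig b x i = x div 2 ^ (b * i) mod 2 ^ b"

lemma dig_less: "dig b x i < 2 ^ b"
  by (simp add: dig_def)

lemma pc_dig: assumes "pc n B" "pc n F" "pc n G" shows "pc n (\<lambda>xs. dig (B xs) (F xs) (G xs))"
proof -
  have "pc n (\<lambda>xs. shr (F xs) (B xs * G xs) mod pw (shr (F xs) (B xs * G xs)) (B xs))"
    by (intro pc_mod pc_pw pc_shr pc_mult assms)
  then show ?thesis by (simp add: mod_pw dig_def shr_def)
qed

definition blen :: "nat \<Rightarrow> nat" where "blen x = count (\<lambda>i. 2 ^ i \<le> x) x"

lemma le_blen_iff: "i < blen x \<longleftrightarrow> 2 ^ i \<le> x"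
proof -
  define k where "k = (LEAST k. x < 2 ^ k)"
  have ex: "x < 2 ^ x" by (rule less_exp)
  have k: "x < 2 ^ k" unfolding k_def using ex by (rule LeastI)
  have kx: "k \<le> x" unfolding k_def using ex by (rule Least_le)
  have iff: "2 ^ i \<le> x \<longleftrightarrow> i < k" for i
  proof
    assume "2 ^ i \<le> x"
    with k have "(2::nat) ^ i < 2 ^ k" by linarith
    then show "i < k" by simp
  qed (use not_less_Least[of i "\<lambda>k. x < 2 ^ k"] in \<open>auto simp: k_def\<close>)
  have "blen x = k" unfolding blen_def by (rule count_initial) (use iff kx in auto)
  then show ?thesis using iff by simp
qed

lemma less_blen: "x < 2 ^ blen x"
  using le_blen_iff[of "blen x" x] by simp

lemma pow_le_iff_div: "2 ^ i \<le> (x::nat) \<longleftrightarrow> shr x i \<noteq> 0"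
  by (simp add: shr_def div_eq_0_iff not_less)

lemma pc_blen: assumes "pc n F" shows "pc n (\<lambda>xs. blen (F xs))"
  unfolding blen_def pow_le_iff_div
  by (intro pc_count pcb_not pcb_eq pc_shr pc_tl[OF assms] pc_hd pc_0 assms)

text \<open>Values, not just lengths, that are polynomial in the length of the arguments.\<close>

definition small :: "nat \<Rightarrow> (nat list \<Rightarrow> nat) \<Rightarrow> bool" where
  "small n F \<longleftrightarrow> (\<exists>k. \<forall>xs L. length xs = n \<longrightarrow> (\<forall>x\<in>set xs. x < 2 ^ L) \<longrightarrow> F xs \<le> (L + 2) ^ k)"

text \<open>Exponentiation turns closure of \<open>small\<close> under sums into closure of
  \<open>pbd\<close> under products.\<close>

lemma pbd_2_power: "small n F \<longleftrightarrow> pbd n (\<lambda>xs. 2 ^ F xs)"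
proof
  assume "small n F"
  then obtain k where k: "\<And>xs L. length xs = n \<Longrightarrow> (\<forall>x\<in>set xs. x < 2 ^ L) \<Longrightarrow> F xs \<le> (L + 2) ^ k"
    by (auto simp: small_def)
  have "2 ^ F xs < bnd (k + 1) L" if "length xs = n" "\<forall>x\<in>set xs. x < 2 ^ L" for xs L
  proof -
    have "(2::nat) ^ F xs \<le> bnd k L" unfolding bnd_def using k[OF that] by (intro power_increasing) auto
    moreover have "0 < bnd k L" by (simp add: bnd_def)
    ultimately show ?thesis using double_bnd[of k L] by linarith
  qed
  then show "pbd n (\<lambda>xs. 2 ^ F xs)" unfolding pbd_def by blast
next
  assume "pbd n (\<lambda>xs. 2 ^ F xs)"
  then obtain k where "\<And>xs L. length xs = n \<Longrightarrow> (\<forall>x\<in>set xs. x < 2 ^ L) \<Longrightarrow> (2::nat) ^ F xs < 2 ^ ((L + 2) ^ k)"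
    by (auto simp: pbd_def bnd_def)
  then have "\<And>xs L. length xs = n \<Longrightarrow> (\<forall>x\<in>set xs. x < 2 ^ L) \<Longrightarrow> F xs < ((L + 2) ^ k)"
    using power_less_imp_less_exp by (metis one_less_numeral_iff semiring_norm(76))
  then show "small n F" unfolding small_def by (meson less_imp_le)
qed

lemma small_add: "small n F \<Longrightarrow> small n G \<Longrightarrow> small n (\<lambda>xs. F xs + G xs)"
  unfolding pbd_2_power power_add by (rule pbd_mult)

lemma small_const: "small n (\<lambda>xs. c)"
  unfolding pbd_2_power by (rule pbd_const)

lemma small_mult: assumes "small n F" "small n G" shows "small n (\<lambda>xs. F xs * G xs)"
proof -
  obtain k1 k2 where k: "\<forall>xs L. length xs = n \<longrightarrow> (\<forall>x\<in>set xs. x < 2 ^ L) \<longrightarrow> F xs \<le> (L + 2) ^ k1"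
    "\<forall>xs L. length xs = n \<longrightarrow> (\<forall>x\<in>set xs. x < 2 ^ L) \<longrightarrow> G xs \<le> (L + 2) ^ k2"
    using assms by (auto simp: small_def)
  have "F xs * G xs \<le> (L + 2) ^ (k1 + k2)" if "length xs = n" "\<forall>x\<in>set xs. x < 2 ^ L" for xs L
    unfolding power_add using k that by (intro mult_mono) auto
  then show ?thesis unfolding small_def by blast
qed

lemma small_blen: assumes "pbd n F" shows "small n (\<lambda>xs. blen (F xs))"
proof -
  have "2 ^ blen x \<le> 2 * x + 1" for x
    using le_blen_iff[of "blen x - 1" x] by (cases "blen x") auto
  then have "\<And>xs. 2 ^ blen (F xs) \<le> 2 * F xs + 1" by blast
  moreover have "pbd n (\<lambda>xs. 2 * F xs + 1)" by (intro pbd_add pbd_mult pbd_const assms)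
  ultimately show ?thesis unfolding pbd_2_power using pbd_mono[of n "\<lambda>xs. 2 * F xs + 1" "\<lambda>xs. 2 ^ blen (F
      xs)"] by simp
qed

lemma pc_2_power: assumes "pc n F" "small n F" shows "pc n (\<lambda>xs. 2 ^ F xs)"
proof -
  have r: "rec_nat 1 (\<lambda>_ a. 2 * a) m = (2 ^ m :: nat)" for m by (induction m) auto
  have "pc n (\<lambda>xs. rec_nat 1 (\<lambda>_ a. 2 * a) (F xs))"
    by (rule pc_rec[where H = "\<lambda>xs. 2 ^ F xs"])
      (use assms in \<open>auto intro!: pc_mult pc_const pc_tl[OF pc_hd] simp: r[simplified] pbd_2_power
          power_increasing\<close>)
  then show ?thesis by (simp only: r)
qed

section \<open>Alternating trees\<close>

text \<open>Node \<open>k\<close> at height \<open>h\<close> lies above the leaves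
  \<open>k * 2 ^ h\<close> to \<open>Suc k * 2 ^ h - 1\<close>; the type of a node at height
  \<open>Suc h\<close> is given by \<open>U h\<close>, the same for all nodes of that
  height.\<close>

fun tree_val :: "(nat \<Rightarrow> bool) \<Rightarrow> (nat \<Rightarrow> bool) \<Rightarrow> nat \<Rightarrow> nat \<Rightarrow> bool" where
  "tree_val U lf 0 k \<longleftrightarrow> lf k"
| "tree_val U lf (Suc h) k \<longleftrightarrow> (if U h then tree_val U lf h (2 * k) \<and> tree_val U lf h (2 * k + 1)
     else tree_val U lf h (2 * k) \<or> tree_val U lf h (2 * k + 1))"

text \<open>The number of trailing ones of \<open>t\<close>: how many completed left siblings are
  merged once leaf \<open>t\<close> has been evaluated.\<close>

definition trail :: "nat \<Rightarrow> nat" where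
  "trail t = count (\<lambda>i. \<forall>j<Suc i. bit t j) t"

lemma trail_bits: "\<not> bit t (trail t)" "j < trail t \<Longrightarrow> bit t j" and trail_le: "2 ^ trail t \<le> t + 1"
proof -
  define k where "k = (LEAST k. \<not> bit t k)"
  have "\<not> bit t t" using bit_nat_imp_le[of t t] less_exp[of t] by linarith
  then have k0: "\<not> bit t k" and kt: "k \<le> t"
    unfolding k_def by (rule LeastI[of "\<lambda>k. \<not> bit t k"], rule Least_le)
  have k1: "bit t j" if "j < k" for j using that not_less_Least unfolding k_def by blast
  have iff: "(\<forall>j<Suc i. bit t j) \<longleftrightarrow> i < k" for i
    using k0 k1 by (metis less_trans_Suc linorder_neqE_nat lessI less_Suc_eq not_less_eq)
  have eq: "trail t = k" unfolding trail_def using iff kt by (intro count_initial) auto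
  show "\<not> bit t (trail t)" "j < trail t \<Longrightarrow> bit t j" using k0 k1 eq by auto
  have "bit (Suc t) k" using bit_Suc_number[of k t k] k0 k1 by auto
  then show "2 ^ trail t \<le> t + 1" using bit_nat_imp_le[of "Suc t" k] eq by simp
qed

lemma pcb_odd: "pc n F \<Longrightarrow> pcb n (\<lambda>xs. odd (F xs))"
  unfolding odd_iff_mod_2_eq_one by (intro pcb_eq pc_mod pc_const)

lemma pcb_bit: "pc n F \<Longrightarrow> pc n G \<Longrightarrow> pcb n (\<lambda>xs. bit (F xs) (G xs))"
  unfolding bit_iff_odd shr_def[symmetric] by (intro pcb_odd pc_shr)

lemma pc_trail: "pc n F \<Longrightarrow> pc n (\<lambda>xs. trail (F xs))"
  unfolding trail_def
  by (intro pc_count pcb_all pcb_bit pc_Suc pc_hd; (rule pc_tl)?; (rule pc_tl)?; assumption?)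

text \<open>Bit \<open>j\<close> of \<open>A\<close> is the value of the left sibling at height
  \<open>j\<close>, and \<open>v\<close> that of the right one just completed; product and maximum
  are conjunction and disjunction on 0 and 1.\<close>

definition carry :: "(nat \<Rightarrow> bool) \<Rightarrow> nat \<Rightarrow> nat \<Rightarrow> nat \<Rightarrow> nat" where
  "carry U A v h = rec_nat v (\<lambda>j v. if U j then of_bool (bit A j) * v else max (of_bool (bit A j)) v) h"

text \<open>The low bits are cleared and the carried value is put at position
  \<open>trail t\<close>, where \<open>A\<close> has a zero. The truncated power is exact, as
  \<open>2 ^ trail t\<close> is at most \<open>t + 1\<close>.\<close>

definition tree_step :: "(nat \<Rightarrow> bool) \<Rightarrow> (nat \<Rightarrow> bool) \<Rightarrow> nat \<Rightarrow> nat \<Rightarrow> nat" where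
  "tree_step U lf t A = (shr A (trail t) + carry U A (of_bool (lf t)) (trail t)) * pw t (trail t)"

definition tree_run :: "(nat \<Rightarrow> bool) \<Rightarrow> (nat \<Rightarrow> bool) \<Rightarrow> nat \<Rightarrow> nat" where
  "tree_run U lf t = rec_nat 0 (tree_step U lf) t"

text \<open>After t leaves, bit h of the accumulator is the value of the last completed subtree of
  height h, for every h at which the binary counter t has a one; processing the next leaf merges
  subtrees exactly along the carry of the increment.\<close>

lemma bit_tree_run: "bit (tree_run U lf t) h \<longleftrightarrow> bit t h \<and> tree_val U lf h (t div 2 ^ h - 1)"
proof (induction t arbitrary: h)
  case 0
  then show ?case by (simp add: tree_run_def)
next
  case (Suc t)
  define A where "A = tree_run U lf t"
  define k where "k = trail t"
  have k: "\<not> bit t k" "\<And>j. j < k \<Longrightarrow> bit t j" using trail_bits by (auto simp: k_def)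
  \<comment> \<open>At height \<open>j\<close> the carried value belongs to the subtree whose last
    leaf is \<open>t\<close>.\<close>
  have v: "carry U A (of_bool (lf t)) j = of_bool (tree_val U lf j (t div 2 ^ j))" if "j \<le> k" for j
    using that
  proof (induction j)
    case 0
    then show ?case by (simp add: carry_def)
  next
    case (Suc j)
    let ?m = "t div 2 ^ Suc j"
    have "bit t j" using k Suc.prems by simp
    then have o: "t div 2 ^ j = 2 * ?m + 1" unfolding bit_iff_odd
      by (metis div_mult2_eq mult.commute odd_two_times_div_two_succ power_Suc)
    have "bit A j \<longleftrightarrow> tree_val U lf j (2 * ?m)"
      using Suc.IH \<open>bit t j\<close> \<open>\<And>h. bit (tree_run U lf t) h \<longleftrightarrow> _ h\<close>[of j] o by (simp add: A_def)
    moreover have "carry U A (of_bool (lf t)) j = of_bool (tree_val U lf j (2 * ?m + 1))" using Suc o by simp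
    ultimately show ?case by (simp add: carry_def)
  qed
  have pw: "pw t k = 2 ^ k" using trail_le[of t] by (simp add: pw_def k_def)
  have run: "tree_run U lf (Suc t) = (A div 2 ^ k + of_bool (tree_val U lf k (t div 2 ^ k))) * 2 ^ k"
    using v[of k] pw by (simp add: tree_run_def tree_step_def shr_def A_def k_def)
  \<comment> \<open>The counter has a zero at \<open>k\<close>, hence so has the accumulator, and
    adding the new value produces no carry into higher positions.\<close>
  have "even (A div 2 ^ k)" using Suc.IH[of k] k(1) by (simp add: A_def bit_iff_odd)
  then have dv: "tree_run U lf (Suc t) div 2 ^ h = A div 2 ^ h" if "k < h" for h
  proof -
    obtain d where d: "h = k + Suc d" using \<open>k < h\<close> less_iff_Suc_add by auto
    have "tree_run U lf (Suc t) div 2 ^ h = tree_run U lf (Suc t) div 2 ^ k div 2 div 2 ^ d"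
      by (simp add: d power_add flip: div_mult2_eq) (simp add: algebra_simps)
    also have "\<dots> = (A div 2 ^ k + of_bool (tree_val U lf k (t div 2 ^ k))) div 2 div 2 ^ d"
      by (simp add: run)
    also have "\<dots> = A div 2 ^ k div 2 div 2 ^ d" using \<open>even (A div 2 ^ k)\<close> by auto
    also have "\<dots> = A div 2 ^ h" by (simp add: d power_add flip: div_mult2_eq) (simp add: algebra_simps)
    finally show ?thesis .
  qed
  have bS: "bit (Suc t) i \<longleftrightarrow> (if i < k then False else if i = k then True else bit t i)" for i
    by (rule bit_Suc_number) (use k in auto)
  consider "h < k" | "h = k" | "k < h" by linarith
  then show ?case
  proof cases
    case 1
    have "tree_run U lf (Suc t) div 2 ^ h = (A div 2 ^ k + of_bool (tree_val U lf k (t div 2 ^ k))) * 2 ^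
        (k - h)"
    proof -
      have "(2::nat) ^ k = 2 ^ (k - h) * 2 ^ h" using 1 by (simp flip: power_add)
      then show ?thesis unfolding run by (metis mult.assoc nonzero_mult_div_cancel_right power_not_zero
          zero_neq_numeral)
    qed
    then show ?thesis using 1 bS[of h] by (simp add: bit_iff_odd)
  next
    case 2
    have "bit (tree_run U lf (Suc t)) k \<longleftrightarrow> tree_val U lf k (t div 2 ^ k)"
      using \<open>even (A div 2 ^ k)\<close> unfolding bit_iff_odd run by simp
    \<comment> \<open>The trailing ones of \<open>t\<close> make \<open>Suc t\<close> a multiple of
      \<open>2 ^ k\<close>: leaf \<open>t\<close> closes a subtree of height
      \<open>k\<close>.\<close>
    moreover have "Suc t div 2 ^ k = Suc (t div 2 ^ k)"
    proof -
      have "\<not> bit (Suc t) i" if "i < k" for i using bS[of i] that by simp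
      then have "take_bit k (Suc t) = 0" by (intro bit_eqI) (auto simp: bit_take_bit_iff)
      then have "2 ^ k dvd Suc t" by (simp add: take_bit_eq_mod dvd_eq_mod_eq_0)
      then obtain q where q: "Suc t = 2 ^ k * q" by auto
      then have "q \<noteq> 0" by (metis mult_0_right nat.distinct(1))
      then obtain q' where "q = Suc q'" using not0_implies_Suc by auto
      then have "2 ^ k * q' + 2 ^ k = Suc t" using q by simp
      moreover have "(1::nat) \<le> 2 ^ k" by simp
      ultimately have "t div 2 ^ k = q'" by (intro div_nat_eqI) (linarith, simp)
      then show ?thesis using q \<open>q = Suc q'\<close> by simp
    qed
    ultimately show ?thesis using 2 bS[of k] by simp
  next
    case 3
    have "Suc t div 2 ^ h = t div 2 ^ h"
    proof (rule bit_eqI)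
      fix i
      have "bit (Suc t) (h + i) \<longleftrightarrow> bit t (h + i)" using bS[of "h + i"] 3 by simp
      then show "bit (Suc t div 2 ^ h) i \<longleftrightarrow> bit (t div 2 ^ h) i"
        by (simp add: bit_iff_odd div_mult2_eq power_add)
    qed
    moreover have "bit (tree_run U lf (Suc t)) h \<longleftrightarrow> bit A h" using dv[OF 3] by (simp add: bit_iff_odd)
    ultimately show ?thesis using 3 bS[of h] Suc.IH[of h] by (simp add: A_def)
  qed
qed

lemma tree_run_final: "bit (tree_run U lf (2 ^ d)) d \<longleftrightarrow> tree_val U lf d 0"
  unfolding bit_tree_run by (simp add: bit_iff_odd)

text \<open>The accumulator has ones only where the counter has them, so it is no longer than the
  counter. This is the space bound of the evaluation.\<close>

lemma tree_run_bound: "tree_run U lf t \<le> 2 * t + 1"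
proof -
  have "tree_run U lf t < 2 ^ blen t"
    unfolding less_2_power_iff_bits
    using less_blen[of t] by (auto simp: bit_tree_run less_2_power_iff_bits)
  moreover have "2 ^ blen t \<le> 2 * t + 1"
    using le_blen_iff[of "blen t - 1" t] by (cases "blen t") auto
  ultimately show ?thesis by simp
qed

text \<open>The loop visits \<open>2 ^ D\<close> leaves, but counter and accumulator need only about
  \<open>D\<close> bits, and \<open>small\<close> makes that polynomial.\<close>

lemma pcb_tree_val:
  assumes lf: "pcb (Suc n) (\<lambda>ys. lf (hd ys) (tl ys))" and U: "pcb (Suc n) (\<lambda>ys. U (hd ys) (tl ys))"
    and D: "pc n D" "small n D"
  shows "pcb n (\<lambda>xs. tree_val (\<lambda>j. U j xs) (\<lambda>t. lf t xs) (D xs) 0)"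
proof -
  let ?n = "Suc (Suc n)"
  have hd2: "pc ?n (\<lambda>ys. hd (tl ys))" by (rule pc_tl[OF pc_hd])
  have lf': "pcb ?n (\<lambda>ys. lf (hd ys) (tl (tl ys)))"
    using pc_skip1[of n "\<lambda>i xs. of_bool (lf i xs)"] lf by simp
  have U': "pcb (Suc (Suc ?n)) (\<lambda>ys. U (hd ys) (tl (tl (tl (tl ys)))))"
    using pc_skip[of n "\<lambda>i xs. of_bool (U i xs)" 3] U by (simp add: numeral_3_eq_3)
  have tr: "pc ?n (\<lambda>ys. trail (hd ys))" by (intro pc_trail pc_hd)
  have cb: "rec_nat (of_bool b) (\<lambda>j v. if U j then of_bool (bit A j) * v else max (of_bool (bit A j)) v)
      h \<le> (1::nat)"
    for U :: "nat \<Rightarrow> bool" and b and A h :: nat by (induction h) auto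
  have carry: "pc ?n (\<lambda>ys. carry (\<lambda>j. U j (tl (tl ys))) (hd (tl ys)) (of_bool (lf (hd ys) (tl (tl ys))))
      (trail (hd ys)))"
    unfolding carry_def
    by (rule pc_rec[where H = "\<lambda>_. 1"])
      (intro tr lf' pc_if U' pc_mult pc_max pcb_bit pc_hd pc_tl[OF pc_hd] pc_tl[OF pc_tl[OF hd2]]
          pbd_const cb)+
  have step: "pc ?n (\<lambda>ys. tree_step (\<lambda>j. U j (tl (tl ys))) (\<lambda>t. lf t (tl (tl ys))) (hd ys) (hd (tl ys)))"
    unfolding tree_step_def
    by (intro pc_mult pc_add carry pc_shr pc_pw tr pc_hd hd2)
  have "pc n (\<lambda>xs. tree_run (\<lambda>j. U j xs) (\<lambda>t. lf t xs) (2 ^ D xs))"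
    unfolding tree_run_def
  proof (rule pc_rec[where H = "\<lambda>xs. 2 * 2 ^ D xs + 1"])
    show "pc n (\<lambda>xs. 2 ^ D xs)" by (rule pc_2_power[OF D])
    show "pbd n (\<lambda>xs. 2 * 2 ^ D xs + 1)" using D(2) by (intro pbd_add pbd_mult pbd_const) (simp add:
        pbd_2_power)
    fix xs j assume "j \<le> (2::nat) ^ D xs"
    then show "rec_nat 0 (tree_step (\<lambda>j. U j xs) (\<lambda>t. lf t xs)) j \<le> 2 * 2 ^ D xs + 1"
      using tree_run_bound[of "\<lambda>j. U j xs" "\<lambda>t. lf t xs" j] unfolding tree_run_def by linarith
  qed (use step pc_0 in auto)
  then have "pcb n (\<lambda>xs. bit (tree_run (\<lambda>j. U j xs) (\<lambda>t. lf t xs) (2 ^ D xs)) (D xs))"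
    by (intro pcb_bit D)
  then show ?thesis by (simp only: tree_run_final)
qed

section \<open>Subtrees and blocks of levels\<close>

lemma tree_val_cong:
  "(\<And>i. k * 2 ^ h \<le> i \<Longrightarrow> i < Suc k * 2 ^ h \<Longrightarrow> lf i = lf' i) \<Longrightarrow> tree_val U lf h k = tree_val U lf' h k"
proof (induction h arbitrary: k)
  case (Suc h)
  have "tree_val U lf h (2 * k) = tree_val U lf' h (2 * k)" by (rule Suc.IH) (rule Suc.prems, auto)
  moreover have "tree_val U lf h (2 * k + 1) = tree_val U lf' h (2 * k + 1)" by (rule Suc.IH) (rule
      Suc.prems, auto)
  ultimately show ?case by simp
qed simp

lemma tree_val_const: "tree_val U (\<lambda>_. b) h k = b"
  by (induction h arbitrary: k) auto

text \<open>Prefixing all leaf numbers by \<open>c\<close> evaluates an inner node; the initial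
  network of the game enters the tree as such a prefix.\<close>

lemma tree_val_shift: "tree_val U (\<lambda>t. lf (c * 2 ^ h + t)) h k = tree_val U lf h (c + k)"
proof (induction h arbitrary: c k)
  case (Suc h)
  have "c * 2 ^ Suc h = (2 * c) * 2 ^ h" by simp
  then show ?case using Suc[of "2 * c" "2 * k"] Suc[of "2 * c" "2 * k + 1"] by (simp add: algebra_simps)
qed simp

text \<open>Consecutive binary levels of one type form a single quantifier over numbers of
  \<open>b\<close> bits, that is, over one move.\<close>

lemma tree_val_block:
  assumes "\<And>j. h \<le> j \<Longrightarrow> j < h + b \<Longrightarrow> U j = u"
  shows "tree_val U lf (h + b) k \<longleftrightarrow> (if u then \<forall>y<2 ^ b. tree_val U lf h (k * 2 ^ b + y)
    else \<exists>y<2 ^ b. tree_val U lf h (k * 2 ^ b + y))"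
  using assms
proof (induction b arbitrary: k)
  case (Suc b)
  have split: "(\<exists>y<2 ^ Suc b. P (k * 2 ^ Suc b + y)) \<longleftrightarrow>
     (\<exists>y<2 ^ b. P (2 * k * 2 ^ b + y)) \<or> (\<exists>y<2 ^ b. P ((2 * k + 1) * 2 ^ b + y))" for P :: "nat \<Rightarrow> bool"
  proof
    assume "\<exists>y<2 ^ Suc b. P (k * 2 ^ Suc b + y)"
    then obtain y where y: "y < 2 ^ Suc b" "P (k * 2 ^ Suc b + y)" by auto
    show "(\<exists>y<2 ^ b. P (2 * k * 2 ^ b + y)) \<or> (\<exists>y<2 ^ b. P ((2 * k + 1) * 2 ^ b + y))"
    proof (cases "y < 2 ^ b")
      case True
      then show ?thesis using y by (auto simp: algebra_simps)
    next
      case False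
      then have "y - 2 ^ b < 2 ^ b" "k * 2 ^ Suc b + y = (2 * k + 1) * 2 ^ b + (y - 2 ^ b)" using y by
          (auto simp: algebra_simps)
      then show ?thesis using y by metis
    qed
  next
    assume "(\<exists>y<2 ^ b. P (2 * k * 2 ^ b + y)) \<or> (\<exists>y<2 ^ b. P ((2 * k + 1) * 2 ^ b + y))"
    then show "\<exists>y<2 ^ Suc b. P (k * 2 ^ Suc b + y)"
    proof
      assume "\<exists>y<2 ^ b. P (2 * k * 2 ^ b + y)"
      then obtain y where "y < 2 ^ b" "P (2 * k * 2 ^ b + y)" by auto
      then show ?thesis by (intro exI[of _ y]) (auto simp: algebra_simps)
    next
      assume "\<exists>y<2 ^ b. P ((2 * k + 1) * 2 ^ b + y)"
      then obtain y where "y < 2 ^ b" "P ((2 * k + 1) * 2 ^ b + y)" by auto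
      then show ?thesis by (intro exI[of _ "2 ^ b + y"]) (auto simp: algebra_simps)
    qed
  qed
  have U: "U (h + b) = u" using Suc.prems by auto
  have IH: "tree_val U lf (h + b) k \<longleftrightarrow> (if u then \<forall>y<2 ^ b. tree_val U lf h (k * 2 ^ b + y)
    else \<exists>y<2 ^ b. tree_val U lf h (k * 2 ^ b + y))" for k using Suc.IH Suc.prems by auto
  \<comment> \<open>The universal case uses the splitting of the range for the negated
    predicate.\<close>
  show ?case
    using split[of "tree_val U lf h"] split[of "\<lambda>i. \<not> tree_val U lf h i"]
    by (cases u) (simp_all add: U IH del: power_Suc; blast)+
qed simp

section \<open>The game is decided in boundedly many rounds\<close>

text \<open>With no rounds left nothing is demanded, so the value describes the real game only if
  \<open>n\<close> is at least the number of nodes that are not strong.\<close>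

fun safeN :: "rule list \<Rightarrow> nat \<Rightarrow> net \<Rightarrow> bool" where
  "safeN R 0 G \<longleftrightarrow> True"
| "safeN R (Suc n) G \<longleftrightarrow> (\<forall>v \<in> Act G - Str G. connected_net (del_node v G) \<and>
     (\<exists>G'. cmove R (del_node v G) G' \<and> safeN R n G'))"

lemma wf_del_node: "wf_net G \<Longrightarrow> wf_net (del_node v G)"
  by (auto simp: wf_net_def del_node_def)

text \<open>Shared by movement and creation; \<open>v\<close> may also be active already, as in a
  movement onto a weak node.\<close>

lemma connected_extend:
  assumes "connected_net G" "adjA G \<subseteq> adjA G'" "Act G' \<subseteq> insert v (Act G)"
    and "u \<in> Act G" "(u, v) \<in> adjA G'" "(v, u) \<in> adjA G'"
  shows "connected_net G'"
proof -
  have old: "(x, y) \<in> (adjA G')\<^sup>*" if "x \<in> Act G" "y \<in> Act G" for x y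
    using assms(1,2) that rtrancl_mono unfolding connected_net_def by blast
  have "(x, u) \<in> (adjA G')\<^sup>*" "(u, x) \<in> (adjA G')\<^sup>*" if "x \<in> Act G'" for x
    using old[of x u] old[of u x] assms(3-6) that by auto
  then show ?thesis unfolding connected_net_def by (meson rtrancl_trans)
qed

text \<open>The measure counts inactive nodes too, because a movement onto an inactive node turns a
  strong node into a weak one, so the weak nodes alone may become more. Connectivity survives since
  the node that becomes active is adjacent to a formerly active one.\<close>

lemma cmove_invariants:
  assumes "cmove R G G'" "wf_net G" "\<forall>r \<in> set R. wf_rule r" "no_weak_creation R"
  shows "wf_net G'" "card (V G' - Str G') \<le> card (V G - Str G)" "connected_net G \<Longrightarrow> connected_net G'"
proof -
  have "wf_net G' \<and> card (V G' - Str G') \<le> card (V G - Str G) \<and> (connected_net G \<longrightarrow> connected_net G')"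
  proof (cases "G' = G")
    case False
    with assms(1) obtain r where r: "r \<in> set R" "apply_rule r G G'" by (auto simp: cmove_def)
    have fin: "finite (V G)" and edges: "\<And>e. e \<in> E G \<Longrightarrow> card e = 2 \<and> e \<subseteq> V G"
      and sub: "Act G \<subseteq> V G" "Str G \<subseteq> Act G" using assms(2) by (auto simp: wf_net_def)
    show ?thesis
    proof (cases r)
      case (Relab a b c d)
      with r obtain f where "G' = G\<lparr>lab := f\<rparr>" by auto
      then show ?thesis using assms(2) by (simp add: wf_net_def connected_net_def adjA_def)
    next
      case (Move a b)
      with r obtain u v where uv: "u \<in> Str G" "v \<in> V G - Str G" "{u, v} \<in> E G"
        and G': "G' = G\<lparr>Str := Str G - {u} \<union> {v}, Act := Act G \<union> {v}\<rparr>" by auto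
      have "V G' - Str G' = insert u (V G - Str G - {v})" using uv sub G' by auto
      then have "card (V G' - Str G') \<le> Suc (card (V G - Str G - {v}))" using fin by (simp add:
          card_insert_le_m1 card_insert_if)
      also have "\<dots> = card (V G - Str G)" using uv fin by (intro card_Suc_Diff1) auto
      finally have "card (V G' - Str G') \<le> card (V G - Str G)" .
      moreover have "wf_net G'" using assms(2) uv G' by (auto simp: wf_net_def)
      moreover have "connected_net G'" if "connected_net G"
        by (rule connected_extend[OF that, of _ v u])
          (use uv sub in \<open>auto simp: adjA_def G' insert_commute\<close>)
      ultimately show ?thesis by blast
    next
      case (Create as c as' s)
      have s: s using assms(4) r Create unfolding no_weak_creation_def by (cases s) auto
      \<comment> \<open>A creation rule with an empty label list would add an isolated active
        node.\<close>
      have ne: "as \<noteq> []" using assms(3) r Create by auto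
      from r Create s obtain us w where us: "length us = length as" "set us \<subseteq> Str G" "w \<notin> V G"
        and G': "V G' = insert w (V G)" "E G' = E G \<union> {{w, u} | u. u \<in> set us}"
          "Act G' = insert w (Act G)" "Str G' = insert w (Str G)" by auto
      have "V G' - Str G' = V G - Str G" using us G' by auto
      moreover have "wf_net G'" unfolding wf_net_def
      proof (intro conjI ballI)
        fix e assume "e \<in> E G'"
        then consider "e \<in> E G" | u where "u \<in> set us" "e = {w, u}" using G' by auto
        then show "card e = 2" "e \<subseteq> V G'" using edges us sub G' by (cases; auto simp: card_insert_if)+
      qed (use fin sub us G' in auto)
      moreover have "connected_net G'" if "connected_net G"
      proof -
        have u: "us ! 0 \<in> set us" using us ne by auto
        then have "{us ! 0, w} \<in> E G'" "{w, us ! 0} \<in> E G'" unfolding G' by (auto simp: insert_commute)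
        then show ?thesis
          by (intro connected_extend[OF that, of _ w "us ! 0"]) (use u us sub in \<open>auto simp: adjA_def G'\<close>)
      qed
      ultimately show ?thesis by simp
    qed
  qed (use assms in auto)
  then show "wf_net G'" "card (V G' - Str G') \<le> card (V G - Str G)" "connected_net G \<Longrightarrow> connected_net G'"
      by auto
qed

section \<open>Plays against a given strategy, and the reduction to boundedly many rounds\<close>

fun hist :: "(net list \<Rightarrow> net) \<Rightarrow> net \<Rightarrow> (nat \<Rightarrow> net \<Rightarrow> net) \<Rightarrow> nat \<Rightarrow> net list" where
  "hist \<sigma> G d 0 = [G]"
| "hist \<sigma> G d (Suc k) = (let h = hist \<sigma> G d k; h' = h @ [d k (last h)] in h' @ [\<sigma> h'])"

lemma length_hist: "length (hist \<sigma> G d k) = 2 * k + 1"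
  by (induction k) (auto simp: Let_def)

lemma hist_nth: "i < 2 * k + 1 \<Longrightarrow> k \<le> l \<Longrightarrow> hist \<sigma> G d l ! i = hist \<sigma> G d k ! i"
proof (induction l)
  case (Suc l)
  show ?case
  proof (cases "k = Suc l")
    case False
    then have "k \<le> l" using Suc.prems by simp
    then have "i < length (hist \<sigma> G d l)" using Suc.prems by (simp add: length_hist)
    then have "hist \<sigma> G d (Suc l) ! i = hist \<sigma> G d l ! i" by (simp add: Let_def nth_append)
    then show ?thesis using Suc \<open>k \<le> l\<close> by simp
  qed simp
qed simp

lemma hist_cong: "(\<And>j. j < k \<Longrightarrow> d j = d' j) \<Longrightarrow> hist \<sigma> G d k = hist \<sigma> G d' k"
  by (induction k) (auto simp: Let_def)

text \<open>The play is the limit of the growing histories: the history after \<open>i\<close>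
  rounds has \<open>2 * i + 1\<close> entries, so its entry \<open>i\<close> exists and is
  final.\<close>

lemma play_of_hist:
  assumes "\<And>k. dmove (last (hist \<sigma> G d k)) (d k (last (hist \<sigma> G d k)))"
  shows "play_of \<sigma> G (\<lambda>i. hist \<sigma> G d i ! i)"
proof -
  let ?p = "\<lambda>i. hist \<sigma> G d i ! i"
  have p: "?p i = hist \<sigma> G d k ! i" if "i < 2 * k + 1" for i k
    using hist_nth[of i k "max i k" \<sigma> G d] hist_nth[of i i "max i k" \<sigma> G d] that by simp
  have m: "map ?p [0..<2 * k + 1] = hist \<sigma> G d k" for k
    by (rule nth_equalityI) (use p[of _ k] in \<open>auto simp: length_hist simp del: upt_Suc\<close>)
  have l: "?p (2 * k) = last (hist \<sigma> G d k)" for k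
    using p[of "2 * k" k] by (simp add: last_conv_nth length_hist flip: length_greater_0_conv)
  have o: "?p (2 * k + 1) = d k (last (hist \<sigma> G d k))" for k
    using p[of "2 * k + 1" "Suc k"] by (simp add: Let_def nth_append length_hist)
  have m': "map ?p [0..<2 * k + 2] = hist \<sigma> G d k @ [d k (last (hist \<sigma> G d k))]" for k
    using m[of k] o[of k] by simp
  have e: "?p (2 * k + 2) = \<sigma> (map ?p [0..<2 * k + 2])" for k
    using p[of "2 * k + 2" "Suc k"] unfolding m' by (simp add: Let_def nth_append length_hist)
  show ?thesis unfolding play_of_def using l o e assms by auto
qed

text \<open>A winning strategy speaks about infinite plays only. Each finite beginning is therefore
  extended by a Destructor who skips from round \<open>k\<close> on, and the next deletion is tested
  by changing that Destructor in round \<open>k\<close> alone.\<close>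

lemma constructor_safe_imp_safeN:
  assumes "constructor_safe R G"
  shows "safeN R n G"
proof -
  from assms obtain \<sigma> where leg: "legal_strategy R \<sigma>"
    and win: "\<And>p i. play_of \<sigma> G p \<Longrightarrow> connected_net (p i)" by (auto simp: constructor_safe_def)
  have "safeN R n (last (hist \<sigma> G d k))"
    if "\<And>k. dmove (last (hist \<sigma> G d k)) (d k (last (hist \<sigma> G d k)))" "\<And>j. k \<le> j \<Longrightarrow> d j = (\<lambda>G. G)" for d k n
    using that
  proof (induction n arbitrary: d k)
    case (Suc n)
    let ?G = "last (hist \<sigma> G d k)"
    show ?case unfolding safeN.simps
    proof
      fix v assume v: "v \<in> Act ?G - Str ?G"
      define d' where "d' = d(k := del_node v)"
      have h: "hist \<sigma> G d' j = hist \<sigma> G d j" if "j \<le> k" for j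
        using that by (intro hist_cong) (auto simp: d'_def)
      have dm: "dmove (last (hist \<sigma> G d' j)) (d' j (last (hist \<sigma> G d' j)))" for j
      proof (cases "j < k")
        case True
        then show ?thesis using Suc.prems(1)[of j] h[of j] by (simp add: d'_def)
      next
        case False
        then consider "j = k" | "j > k" by linarith
        then show ?thesis
        proof cases
          case 1
          then show ?thesis using v h[of k] by (auto simp: dmove_def d'_def)
        next
          case 2
          then show ?thesis using Suc.prems(2)[of j] by (simp add: d'_def dmove_def)
        qed
      qed
      have hS: "hist \<sigma> G d' (Suc k) = hist \<sigma> G d k @ [del_node v ?G, \<sigma> (hist \<sigma> G d k @ [del_node v ?G])]"
        using h[of k] by (simp add: Let_def d'_def)
      have "connected_net (hist \<sigma> G d' (2 * k + 1) ! (2 * k + 1))"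
        by (rule win[OF play_of_hist[of \<sigma> G d', OF dm]])
      moreover have "hist \<sigma> G d' (2 * k + 1) ! (2 * k + 1) = hist \<sigma> G d' (Suc k) ! (2 * k + 1)"
        by (rule hist_nth) auto
      ultimately have "connected_net (hist \<sigma> G d' (Suc k) ! (2 * k + 1))" by metis
      then have "connected_net (del_node v ?G)" unfolding hS by (simp add: nth_append length_hist)
      moreover have "cmove R (del_node v ?G) (last (hist \<sigma> G d' (Suc k)))"
        using leg unfolding legal_strategy_def hS by (metis last_ConsL last_ConsR last_appendR
            not_Cons_self2 append_is_Nil_conv list.distinct(1) last_snoc)
      moreover have "safeN R n (last (hist \<sigma> G d' (Suc k)))"
        by (rule Suc.IH[OF dm]) (use Suc.prems(2) in \<open>auto simp: d'_def\<close>)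
      ultimately show "connected_net (del_node v ?G) \<and> (\<exists>G'. cmove R (del_node v ?G) G' \<and> safeN R n G')"
          by blast
    qed
  qed simp
  from this[of "\<lambda>_ G. G" 0 n] show ?thesis by (simp add: dmove_def)
qed

text \<open>Constructor keeps at least as many safe rounds in reserve as there are nodes that are
  not strong. A deletion costs one round but also one such node, and a skip is answered by a
  skip.\<close>

lemma safeN_imp_constructor_safe:
  assumes "wf_net G" "connected_net G" "\<forall>r \<in> set R. wf_rule r" "no_weak_creation R"
    and "card (V G - Str G) \<le> n" "safeN R n G"
  shows "constructor_safe R G"
proof -
  define W where "W = (\<lambda>G. wf_net G \<and> connected_net G \<and> (\<exists>n. card (V G - Str G) \<le> n \<and> safeN R n G))"
  have W: "connected_net G1 \<and> (\<exists>G2. cmove R G1 G2 \<and> W G2)" if "W G" "dmove G G1" for G G1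
  proof (cases "G1 = G")
    case True
    then show ?thesis using that by (auto simp: W_def cmove_def)
  next
    case False
    with that(2) obtain v where v: "v \<in> Act G - Str G" and G1: "G1 = del_node v G" by (auto simp: dmove_def)
    from that(1) obtain n where n: "wf_net G" "connected_net G" "card (V G - Str G) \<le> n" "safeN R n G" by
        (auto simp: W_def)
    have fin: "finite (V G)" and vV: "v \<in> V G - Str G" using n(1) v by (auto simp: wf_net_def)
    have "V G1 - Str G1 = V G - Str G - {v}" by (auto simp: G1 del_node_def)
    then have c: "Suc (card (V G1 - Str G1)) = card (V G - Str G)" using fin vV card_Suc_Diff1[of "V G -
        Str G" v] by simp
    then obtain m where m: "n = Suc m" using n(3) by (cases n) auto
    then obtain G2 where G2: "connected_net G1" "cmove R G1 G2" "safeN R m G2" using n(4) v G1 by auto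
    note inv = cmove_invariants[OF G2(2) _ assms(3,4)]
    have "W G2" unfolding W_def using inv wf_del_node[OF n(1)] G2 c n(3) m G1 by (auto intro!: exI[of _ m])
    then show ?thesis using G2 by blast
  qed
  \<comment> \<open>Legality is required for all histories, including those outside the invariant,
    so the choice insists on \<open>W\<close> only when some move reaches it.\<close>
  define \<sigma> where "\<sigma> = (\<lambda>h :: net list. SOME G2. cmove R (last h) G2 \<and> ((\<exists>G2. cmove R (last h) G2 \<and> W G2)
      \<longrightarrow> W G2))"
  have \<sigma>: "cmove R (last h) (\<sigma> h) \<and> ((\<exists>G2. cmove R (last h) G2 \<and> W G2) \<longrightarrow> W (\<sigma> h))" for h
    unfolding \<sigma>_def by (rule someI_ex) (auto simp: cmove_def)
  have "connected_net (p i)" if p: "play_of \<sigma> G p" for p i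
  proof -
    have ev: "W (p (2 * k))" for k
    proof (induction k)
      case 0
      then show ?case using p assms by (auto simp: play_of_def W_def)
    next
      case (Suc k)
      have d: "dmove (p (2 * k)) (p (2 * k + 1))" "p (2 * k + 2) = \<sigma> (map p [0..<2 * k + 2])"
        using p by (auto simp: play_of_def)
      have "last (map p [0..<2 * k + 2]) = p (2 * k + 1)" by simp
      then show ?case using W[OF Suc d(1)] \<sigma>[of "map p [0..<2 * k + 2]"] d(2) by simp
    qed
    have d: "dmove (p (2 * k)) (p (2 * k + 1))" for k using p by (auto simp: play_of_def)
    show ?thesis
    proof (cases "even i")
      case True
      then show ?thesis using ev[of "i div 2"] by (auto simp: W_def)
    next
      case False
      then show ?thesis using W[OF ev d, of "i div 2"] by simp
    qed
  qed
  then show ?thesis unfolding constructor_safe_def legal_strategy_def using \<sigma> by blast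
qed

theorem constructor_safe_iff_safeN:
  assumes "wf_net G" "connected_net G" "\<forall>r \<in> set R. wf_rule r" "no_weak_creation R"
    and "card (V G - Str G) \<le> n"
  shows "constructor_safe R G \<longleftrightarrow> safeN R n G"
  using assms constructor_safe_imp_safeN safeN_imp_constructor_safe by blast

section \<open>Networks as numbers\<close>

lemma ex_dig: "(\<And>i. i < K \<Longrightarrow> f i < 2 ^ N) \<Longrightarrow> \<exists>x<2 ^ (N * K). \<forall>i<K. dig N x i = f i"
proof (induction K)
  case (Suc K)
  then obtain x where x: "x < 2 ^ (N * K)" "\<And>i. i < K \<Longrightarrow> dig N x i = f i" by auto
  have fK: "f K < 2 ^ N" using Suc.prems by simp
  let ?x = "x + f K * 2 ^ (N * K)"
  have "dig N ?x i = f i" if "i < Suc K" for i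
  proof (cases "i = K")
    case True
    then show ?thesis using x(1) fK by (simp add: dig_def)
  next
    case False
    then have i: "i < K" using that by simp
    then obtain d where d: "K = i + Suc d" using less_iff_Suc_add by auto
    have "f K * 2 ^ (N * K) = (f K * 2 ^ (N * d) * 2 ^ N) * 2 ^ (N * i)"
      by (simp add: d power_add algebra_simps)
    then have "?x div 2 ^ (N * i) = x div 2 ^ (N * i) + f K * 2 ^ (N * d) * 2 ^ N"
      by (simp only: div_mult_self1 power_not_zero) simp
    then show ?thesis using x(2)[OF i] by (simp add: dig_def)
  qed
  moreover have "?x < 2 ^ (N * Suc K)"
  proof -
    have "?x < (1 + f K) * 2 ^ (N * K)" using x(1) by simp
    also have "\<dots> \<le> 2 ^ N * 2 ^ (N * K)" using fK by (intro mult_right_mono) auto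
    also have "\<dots> = 2 ^ (N * Suc K)" by (simp add: power_add)
    finally show ?thesis .
  qed
  ultimately show ?case by blast
qed simp

lemma ex_bits: "\<exists>x<2 ^ K. \<forall>i<K. bit (x::nat) i \<longleftrightarrow> P i"
  using sum_bits_less[where n = K and P = P] bit_sum_bits[where n = K and P = P]
  by (intro exI[of _ "\<Sum>i<K. of_bool (P i) * 2 ^ i"]) blast

text \<open>One parameter \<open>N\<close>, the input length, serves as word size, number of node slots and number of
  rounds. The status of a slot is 0 (unused), 1 (inactive), 2 (weak) or 3 (strong).\<close>

definition stt :: "nat \<Rightarrow> nat \<Rightarrow> nat \<Rightarrow> nat" where "stt N x i = dig N x i"
definition lbl :: "nat \<Rightarrow> nat \<Rightarrow> nat \<Rightarrow> nat" where "lbl N x i = dig N x (N + i)"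
definition adj :: "nat \<Rightarrow> nat \<Rightarrow> nat \<Rightarrow> nat \<Rightarrow> bool" where
  "adj N x i j \<longleftrightarrow> dig N x (2 * N + i * N + j) \<noteq> 0"
text \<open>A network takes \<open>N\<close> statuses, \<open>N\<close> labels and an
  \<open>N\<close> by \<open>N\<close> adjacency matrix, each entry a word of \<open>N\<close>
  bits.\<close>

definition blk :: "nat \<Rightarrow> nat" where "blk N = N * (2 * N + N * N)"

lemma stt_less: "stt N x i < 2 ^ N" and lbl_less: "lbl N x i < 2 ^ N"
  by (simp_all add: stt_def lbl_def dig_less)

lemma ex_code:
  assumes "N \<ge> 1" "\<And>i. i < N \<Longrightarrow> s i < 2 ^ N" "\<And>i. i < N \<Longrightarrow> l i < 2 ^ N"
  shows "\<exists>x<2 ^ blk N. (\<forall>i<N. stt N x i = s i) \<and> (\<forall>i<N. lbl N x i = l i) \<and>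
    (\<forall>i<N. \<forall>j<N. adj N x i j \<longleftrightarrow> a i j)"
proof -
  define f where "f = (\<lambda>i. if i < N then s i else if i < 2 * N then l (i - N)
    else of_bool (a ((i - 2 * N) div N) ((i - 2 * N) mod N)))"
  have "(1::nat) < 2 ^ N" using assms(1) one_less_power[of "2::nat" N] by simp
  then have "f i < 2 ^ N" for i using assms(2,3) by (auto simp: f_def)
  then obtain x where x: "x < 2 ^ (N * (2 * N + N * N))" "\<And>i. i < 2 * N + N * N \<Longrightarrow> dig N x i = f i"
    using ex_dig[of "2 * N + N * N" f N] by auto
  have "adj N x i j \<longleftrightarrow> a i j" if "i < N" "j < N" for i j
  proof -
    have "Suc i * N \<le> N * N" using that by (intro mult_right_mono) auto
    then have "2 * N + i * N + j < 2 * N + N * N" using that by simp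
    then show ?thesis using x(2)[of "2 * N + i * N + j"] that by (simp add: adj_def f_def)
  qed
  then show ?thesis using x by (intro exI[of _ x]) (auto simp: blk_def stt_def lbl_def f_def)
qed

definition stn :: "net \<Rightarrow> nat \<Rightarrow> nat" where
  "stn G v = (if v \<in> Str G then 3 else if v \<in> Act G then 2 else 1)"

definition Rep :: "nat \<Rightarrow> nat \<Rightarrow> net \<Rightarrow> (nat \<Rightarrow> nat) \<Rightarrow> bool" where
  "Rep N x G f \<longleftrightarrow> inj_on f (V G) \<and> (\<forall>v\<in>V G. f v < N) \<and> (\<forall>i<N. i \<notin> f ` V G \<longrightarrow> stt N x i = 0) \<and>
     (\<forall>v\<in>V G. stt N x (f v) = stn G v \<and> lbl N x (f v) = lab G v) \<and>
     (\<forall>u\<in>V G. \<forall>v\<in>V G. adj N x (f u) (f v) \<longleftrightarrow> {u, v} \<in> E G)"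

lemma RepD:
  assumes "Rep N x G f"
  shows "inj_on f (V G)" "v \<in> V G \<Longrightarrow> f v < N" "i < N \<Longrightarrow> i \<notin> f ` V G \<Longrightarrow> stt N x i = 0"
    "v \<in> V G \<Longrightarrow> stt N x (f v) = stn G v" "v \<in> V G \<Longrightarrow> lbl N x (f v) = lab G v"
    "u \<in> V G \<Longrightarrow> v \<in> V G \<Longrightarrow> adj N x (f u) (f v) \<longleftrightarrow> {u, v} \<in> E G"
    "u \<in> V G \<Longrightarrow> v \<in> V G \<Longrightarrow> f u = f v \<longleftrightarrow> u = v"
  using assms by (auto simp: Rep_def inj_on_eq_iff)

lemma Rep_node:
  assumes "Rep N x G f" "i < N" "stt N x i \<noteq> 0"
  shows "\<exists>v\<in>V G. i = f v"
  using assms(3) RepD(3)[OF assms(1,2)] by auto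

section \<open>Deletions and connectivity on codes\<close>

definition num_del :: "nat \<Rightarrow> nat \<Rightarrow> nat \<Rightarrow> bool" where
  "num_del N x y \<longleftrightarrow> (\<exists>v<N. stt N x v = 2 \<and> (\<forall>i<N. stt N y i = (if i = v then 0 else stt N x i)) \<and>
     (\<forall>i<N. lbl N y i = lbl N x i) \<and>
     (\<forall>i<N. \<forall>j<N. adj N y i j \<longleftrightarrow> adj N x i j \<and> i \<noteq> v \<and> j \<noteq> v))"

lemma Rep_del_node:
  assumes R: "Rep N x G f" and v: "v \<in> V G"
    and y: "\<And>i. i < N \<Longrightarrow> stt N y i = (if i = f v then 0 else stt N x i)" "\<And>i. i < N \<Longrightarrow> lbl N y i = lbl N x i"
      "\<And>i j. i < N \<Longrightarrow> j < N \<Longrightarrow> adj N y i j \<longleftrightarrow> adj N x i j \<and> i \<noteq> f v \<and> j \<noteq> f v"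
  shows "Rep N y (del_node v G) f"
  unfolding Rep_def
proof (intro conjI ballI allI impI)
  show "inj_on f (V (del_node v G))" using RepD(1)[OF R] by (auto simp: del_node_def intro: inj_on_diff)
  show "f u < N" if "u \<in> V (del_node v G)" for u using that RepD(2)[OF R] by (auto simp: del_node_def)
  show "stt N y i = 0" if "i < N" "i \<notin> f ` V (del_node v G)" for i
    using y(1)[of i] RepD(3)[OF R, of i] that by (auto simp: del_node_def)
  show "stt N y (f u) = stn (del_node v G) u" "lbl N y (f u) = lab (del_node v G) u" if "u \<in> V (del_node
      v G)" for u
    using that v RepD(2,4,5,7)[OF R] y(1,2)[of "f u"] by (auto simp: del_node_def stn_def)
  show "adj N y (f u) (f u') \<longleftrightarrow> {u, u'} \<in> E (del_node v G)" if "u \<in> V (del_node v G)" "u' \<in> V (del_node v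
      G)" for u u'
    using that v RepD(2,6,7)[OF R] y(3)[of "f u" "f u'"] by (auto simp: del_node_def)
qed

lemma num_del_complete:
  assumes R: "Rep N x G f" and "wf_net G" and v: "v \<in> Act G - Str G"
  shows "\<exists>y<2 ^ blk N. num_del N x y \<and> Rep N y (del_node v G) f"
proof -
  have vV: "v \<in> V G" using assms by (auto simp: wf_net_def)
  have N: "N \<ge> 1" using RepD(2)[OF R vV] by simp
  have less: "\<And>i. (if i = f v then 0 else stt N x i) < 2 ^ N" by (simp add: stt_less)
  obtain y where y: "y < 2 ^ blk N" "\<And>i. i < N \<Longrightarrow> stt N y i = (if i = f v then 0 else stt N x i)"
      "\<And>i. i < N \<Longrightarrow> lbl N y i = lbl N x i"
      "\<And>i j. i < N \<Longrightarrow> j < N \<Longrightarrow> adj N y i j \<longleftrightarrow> adj N x i j \<and> i \<noteq> f v \<and> j \<noteq> f v"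
    using ex_code[of N "\<lambda>i. if i = f v then 0 else stt N x i" "lbl N x" "\<lambda>i j. adj N x i j \<and> i \<noteq> f v \<and> j
        \<noteq> f v"]
      N less lbl_less by auto
  have "stt N x (f v) = 2" using RepD(4)[OF R vV] v by (simp add: stn_def)
  then have "num_del N x y" unfolding num_del_def using y RepD(2)[OF R vV] by (intro exI[of _ "f v"]) auto
  then show ?thesis using Rep_del_node[OF R vV y(2,3,4)] y(1) by blast
qed

lemma num_del_sound:
  assumes R: "Rep N x G f" and "num_del N x y"
  shows "\<exists>v\<in>Act G - Str G. Rep N y (del_node v G) f"
proof -
  from assms(2) obtain i where i: "i < N" "stt N x i = 2" "\<And>j. j < N \<Longrightarrow> stt N y j = (if j = i then 0 else
      stt N x j)"
     "\<And>i. i < N \<Longrightarrow> lbl N y i = lbl N x i"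
     "\<And>k j. k < N \<Longrightarrow> j < N \<Longrightarrow> adj N y k j \<longleftrightarrow> adj N x k j \<and> k \<noteq> i \<and> j \<noteq> i" by (auto simp: num_del_def)
  then obtain v where v: "v \<in> V G" "i = f v" using Rep_node[OF R, of i] by auto
  have "v \<in> Act G - Str G" using i(2) RepD(4)[OF R v(1)] v by (auto simp: stn_def split: if_splits)
  moreover have "Rep N y (del_node v G) f" using Rep_del_node[OF R v(1)] i v by auto
  ultimately show ?thesis by blast
qed

text \<open>A network is connected iff no set of nodes, coded by the bits of \<open>X\<close>, is a proper cut.\<close>

definition num_conn :: "nat \<Rightarrow> nat \<Rightarrow> nat \<Rightarrow> bool" where
  "num_conn N M y \<longleftrightarrow> (\<forall>X<M. (\<exists>i<N. 2 \<le> stt N y i \<and> bit X i) \<and>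
     (\<forall>i<N. \<forall>j<N. 2 \<le> stt N y i \<and> 2 \<le> stt N y j \<and> adj N y i j \<and> bit X i \<longrightarrow> bit X j) \<longrightarrow>
     (\<forall>i<N. 2 \<le> stt N y i \<longrightarrow> bit X i))"

lemma num_conn_iff:
  assumes R: "Rep N y G f" and wf: "wf_net G" and M: "2 ^ N \<le> M"
  shows "num_conn N M y \<longleftrightarrow> connected_net G"
proof -
  have sub: "Act G \<subseteq> V G" "Str G \<subseteq> Act G" using wf by (auto simp: wf_net_def)
  have act: "2 \<le> stt N y (f v) \<longleftrightarrow> v \<in> Act G" if "v \<in> V G" for v
    using RepD(4)[OF R that] sub by (auto simp: stn_def)
  have actE: "\<exists>v\<in>Act G. i = f v" if "i < N" "2 \<le> stt N y i" for i
  proof -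
    obtain v where "v \<in> V G" "i = f v" using Rep_node[OF R] \<open>i < N\<close> \<open>2 \<le> stt N y i\<close> by force
    then show ?thesis using act that by auto
  qed
  show ?thesis
  proof
    assume C: "num_conn N M y"
    show "connected_net G" unfolding connected_net_def
    proof (intro ballI)
      fix u v assume uv: "u \<in> Act G" "v \<in> Act G"
      \<comment> \<open>The test set is the set of slots reachable from \<open>u\<close>. It is
        closed under adjacency, so it must contain the slot of \<open>v\<close>.\<close>
      obtain X :: nat where X: "X < 2 ^ N" "\<And>i. i < N \<Longrightarrow> bit X i \<longleftrightarrow> (\<exists>z\<in>Act G. i = f z \<and> (u, z) \<in> (adjA G)\<^sup>*)"
        using ex_bits[of N "\<lambda>i. \<exists>z\<in>Act G. i = f z \<and> (u, z) \<in> (adjA G)\<^sup>*"] by blast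
      have 1: "\<exists>i<N. 2 \<le> stt N y i \<and> bit X i"
        using X(2)[of "f u"] act[of u] uv sub RepD(2)[OF R, of u] by blast
      have "bit X j" if ij: "i < N" "j < N" "2 \<le> stt N y i" "2 \<le> stt N y j" "adj N y i j" "bit X i" for i j
      proof -
        obtain z where z: "z \<in> Act G" "i = f z" "(u, z) \<in> (adjA G)\<^sup>*" using X(2)[OF ij(1)] ij(6) by auto
        obtain z' where z': "z' \<in> Act G" "j = f z'" using actE[OF ij(2,4)] by auto
        have "{z, z'} \<in> E G" using RepD(6)[OF R, of z z'] z z' ij sub by auto
        then have "(z, z') \<in> adjA G" using z z' by (simp add: adjA_def)
        with z(3) have "(u, z') \<in> (adjA G)\<^sup>*" by (rule rtrancl_into_rtrancl)
        then show ?thesis using X(2)[OF ij(2)] z' by blast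
      qed
      then have "\<forall>i<N. 2 \<le> stt N y i \<longrightarrow> bit X i" using C 1 X(1) M unfolding num_conn_def by (meson
          less_le_trans)
      then have "bit X (f v)" using act[of v] uv sub RepD(2)[OF R, of v] by blast
      then obtain z where z: "z \<in> Act G" "f v = f z" "(u, z) \<in> (adjA G)\<^sup>*"
        using X(2)[of "f v"] uv sub RepD(2)[OF R, of v] by blast
      then have "v = z" using RepD(7)[OF R, of v z] uv sub by blast
      with z show "(u, v) \<in> (adjA G)\<^sup>*" by simp
    qed
  next
    assume C: "connected_net G"
    show "num_conn N M y" unfolding num_conn_def
    proof (intro allI impI, elim conjE exE)
      fix X i j assume cl: "\<forall>i<N. \<forall>j<N. 2 \<le> stt N y i \<and> 2 \<le> stt N y j \<and> adj N y i j \<and> bit X i \<longrightarrow> bit X j"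
        and i: "i < N" "2 \<le> stt N y i" and j: "j < N" "2 \<le> stt N y j" "bit X j"
      obtain u v where uv: "u \<in> Act G" "v \<in> Act G" "i = f u" "j = f v" using actE i j by metis
      then have "(v, u) \<in> (adjA G)\<^sup>*" using C by (simp add: connected_net_def)
      then have "bit X (f u)"
      proof (induction rule: rtrancl_induct)
        case base
        then show ?case using j uv by simp
      next
        case (step a b)
        then have "a \<in> Act G" "b \<in> Act G" "{a, b} \<in> E G" by (auto simp: adjA_def)
        then show ?case using step cl act sub RepD(2,6)[OF R] by (metis subsetD)
      qed
      then show "bit X i" using uv by simp
    qed
  qed
qed

text \<open>Field 0 is the tag used by the input encoding; for a creation rule, field 1 is the number of
  labels on either side.\<close>

definition rule_of :: "(nat \<Rightarrow> nat) \<Rightarrow> rule" where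
  "rule_of g = (if g 0 = 5 then Relab (g 1) (g 2) (g 3) (g 4) else if g 0 = 6 then Move (g 1) (g 2)
     else Create (map (\<lambda>i. g (3 + i)) [0..<g 1]) (g 2) (map (\<lambda>i. g (3 + g 1 + i)) [0..<g 1]) (g 0 = 7))"

text \<open>\<open>P\<close> is an \<open>N\<close> by \<open>N\<close> bit matrix, row by row: the
  set of pairs relabeled in this turn.\<close>

definition num_relab :: "nat \<Rightarrow> nat \<Rightarrow> nat \<Rightarrow> nat \<Rightarrow> nat \<Rightarrow> nat \<Rightarrow> nat \<Rightarrow> nat \<Rightarrow> bool" where
  "num_relab N M a b c d x y \<longleftrightarrow> (\<exists>P<M.
     (\<forall>u<N. \<forall>v<N. bit P (u * N + v) \<longrightarrow> 2 \<le> stt N x u \<and> 2 \<le> stt N x v \<and> adj N x u v \<and>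
        lbl N x u = a \<and> lbl N x v = b) \<and>
     (\<forall>u<N. \<forall>v<N. \<forall>u'<N. \<forall>v'<N. bit P (u * N + v) \<and> bit P (u' * N + v') \<and> \<not> (u = u' \<and> v = v') \<longrightarrow>
        u \<noteq> u' \<and> u \<noteq> v' \<and> v \<noteq> u' \<and> v \<noteq> v') \<and>
     (\<forall>i<N. stt N y i = stt N x i) \<and>
     (\<forall>i<N. lbl N y i = (if \<exists>v<N. bit P (i * N + v) then c
        else if \<exists>u<N. bit P (u * N + i) then d else lbl N x i)) \<and>
     (\<forall>i<N. \<forall>j<N. adj N y i j \<longleftrightarrow> adj N x i j))"

definition num_move :: "nat \<Rightarrow> nat \<Rightarrow> nat \<Rightarrow> nat \<Rightarrow> nat \<Rightarrow> bool" where
  "num_move N a b x y \<longleftrightarrow> (\<exists>u<N. \<exists>v<N. stt N x u = 3 \<and> lbl N x u = a \<and> stt N x v \<noteq> 0 \<and> stt N x v \<noteq> 3 \<and>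
     lbl N x v = b \<and> adj N x u v \<and>
     (\<forall>i<N. stt N y i = (if i = v then 3 else if i = u then 2 else stt N x i)) \<and>
     (\<forall>i<N. lbl N y i = lbl N x i) \<and>
     (\<forall>i<N. \<forall>j<N. adj N y i j \<longleftrightarrow> adj N x i j))"

text \<open>\<open>U\<close> is the list of chosen slots and \<open>w\<close> a free slot. The new
  labels are fixed by implications instead of by inverting \<open>dig N U\<close>, which keeps
  definite descriptions out of the computation.\<close>

definition num_create :: "nat \<Rightarrow> nat \<Rightarrow> nat \<Rightarrow> nat \<Rightarrow> (nat \<Rightarrow> nat) \<Rightarrow> (nat \<Rightarrow> nat) \<Rightarrow> nat \<Rightarrow> nat \<Rightarrow> bool" where
  "num_create N M l c as as' x y \<longleftrightarrow> (\<exists>U<M. \<exists>w<N. stt N x w = 0 \<and>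
     (\<forall>i<l. dig N U i < N \<and> stt N x (dig N U i) = 3 \<and> lbl N x (dig N U i) = as i) \<and>
     (\<forall>i<l. \<forall>j<l. i \<noteq> j \<longrightarrow> dig N U i \<noteq> dig N U j) \<and>
     (\<forall>i<N. stt N y i = (if i = w then 3 else stt N x i)) \<and>
     (\<forall>i<N. if i = w then lbl N y i = c else
        (\<forall>k<l. dig N U k = i \<longrightarrow> lbl N y i = as' k) \<and> ((\<forall>k<l. dig N U k \<noteq> i) \<longrightarrow> lbl N y i = lbl N x i)) \<and>
     (\<forall>i<N. \<forall>j<N. adj N y i j \<longleftrightarrow> (if i = w then (\<exists>k<l. dig N U k = j)
        else if j = w then (\<exists>k<l. dig N U k = i) else adj N x i j)))"

section \<open>Constructor's moves on codes\<close>

lemma Rep_relab: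
  assumes R: "Rep N x G f" and S: "S \<subseteq> V G \<times> V G"
    and P: "\<And>i j. i < N \<Longrightarrow> j < N \<Longrightarrow> bit P (i * N + j) \<longleftrightarrow> (\<exists>(u, v)\<in>S. i = f u \<and> j = f v)"
    and y: "\<And>i. i < N \<Longrightarrow> stt N y i = stt N x i"
      "\<And>i. i < N \<Longrightarrow> lbl N y i = (if \<exists>v<N. bit P (i * N + v) then c else if \<exists>u<N. bit P (u * N + i) then d
          else lbl N x i)"
      "\<And>i j. i < N \<Longrightarrow> j < N \<Longrightarrow> adj N y i j \<longleftrightarrow> adj N x i j"
  shows "Rep N y (G\<lparr>lab := (\<lambda>x. if x \<in> fst ` S then c else if x \<in> snd ` S then d else lab G x)\<rparr>) f"
proof -
  have 1: "(\<exists>j<N. bit P (f z * N + j)) \<longleftrightarrow> z \<in> fst ` S" if z: "z \<in> V G" for z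
  proof
    assume "\<exists>j<N. bit P (f z * N + j)"
    then obtain u v where "(u, v) \<in> S" "f z = f u" using P[OF RepD(2)[OF R z]] by auto
    then show "z \<in> fst ` S" using RepD(7)[OF R z, of u] S by force
  next
    assume "z \<in> fst ` S"
    then obtain v where v: "(z, v) \<in> S" by auto
    then have "f v < N" using S RepD(2)[OF R] by auto
    then show "\<exists>j<N. bit P (f z * N + j)" using P[OF RepD(2)[OF R z], of "f v"] v by auto
  qed
  have 2: "(\<exists>j<N. bit P (j * N + f z)) \<longleftrightarrow> z \<in> snd ` S" if z: "z \<in> V G" for z
  proof
    assume "\<exists>j<N. bit P (j * N + f z)"
    then obtain u v where "(u, v) \<in> S" "f z = f v" using P[OF _ RepD(2)[OF R z]] by auto
    then show "z \<in> snd ` S" using RepD(7)[OF R z, of v] S by force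
  next
    assume "z \<in> snd ` S"
    then obtain u where u: "(u, z) \<in> S" by auto
    then have "f u < N" using S RepD(2)[OF R] by auto
    then show "\<exists>j<N. bit P (j * N + f z)" using P[OF _ RepD(2)[OF R z], of "f u"] u by auto
  qed
  show ?thesis using RepD[OF R] y 1 2 by (simp add: Rep_def stn_def)
qed

lemma Rep_move:
  assumes R: "Rep N x G f" and uv: "u \<in> V G" "v \<in> V G" "u \<in> Act G" "u \<noteq> v"
    and y: "\<And>i. i < N \<Longrightarrow> stt N y i = (if i = f v then 3 else if i = f u then 2 else stt N x i)"
      "\<And>i. i < N \<Longrightarrow> lbl N y i = lbl N x i" "\<And>i j. i < N \<Longrightarrow> j < N \<Longrightarrow> adj N y i j \<longleftrightarrow> adj N x i j"
  shows "Rep N y (G\<lparr>Str := Str G - {u} \<union> {v}, Act := Act G \<union> {v}\<rparr>) f"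
    (is "Rep N y ?G f")
  unfolding Rep_def
proof (intro conjI ballI allI impI)
  show "inj_on f (V ?G)" using RepD(1)[OF R] by simp
  show "f z < N" if "z \<in> V ?G" for z using that RepD(2)[OF R] by simp
  show "stt N y i = 0" if "i < N" "i \<notin> f ` V ?G" for i
    using y(1)[of i] RepD(3)[OF R, of i] that uv by auto
  show "stt N y (f z) = stn ?G z" "lbl N y (f z) = lab ?G z" if "z \<in> V ?G" for z
    using that uv RepD(2,4,5,7)[OF R, of z] RepD(7)[OF R, of z u] RepD(7)[OF R, of z v] y(1,2)[of "f z"]
    by (auto simp: stn_def)
  show "adj N y (f z) (f z') \<longleftrightarrow> {z, z'} \<in> E ?G" if "z \<in> V ?G" "z' \<in> V ?G" for z z'
    using that RepD(2)[OF R, of z] RepD(2)[OF R, of z'] RepD(6)[OF R, of z z'] y(3)[of "f z" "f z'"] by simp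
qed

lemma Rep_create:
  assumes R: "Rep N x G f" and wf: "wf_net G" and w: "w \<notin> V G" "wi < N" "wi \<notin> f ` V G"
    and us: "distinct us" "set us \<subseteq> V G" "length us = l" "length as' = l"
    and U: "\<And>k. k < l \<Longrightarrow> dig N U k = f (us ! k)"
    and y: "\<And>i. i < N \<Longrightarrow> stt N y i = (if i = wi then 3 else stt N x i)"
      "lbl N y wi = c"
      "\<And>i k. i < N \<Longrightarrow> i \<noteq> wi \<Longrightarrow> k < l \<Longrightarrow> dig N U k = i \<Longrightarrow> lbl N y i = as' ! k"
      "\<And>i. i < N \<Longrightarrow> i \<noteq> wi \<Longrightarrow> (\<And>k. k < l \<Longrightarrow> dig N U k \<noteq> i) \<Longrightarrow> lbl N y i = lbl N x i"
      "\<And>i j. i < N \<Longrightarrow> j < N \<Longrightarrow> adj N y i j \<longleftrightarrow> (if i = wi then (\<exists>k<l. dig N U k = j)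
        else if j = wi then (\<exists>k<l. dig N U k = i) else adj N x i j)"
  shows "Rep N y (G\<lparr>V := insert w (V G), E := E G \<union> {{w, u} | u. u \<in> set us}, Act := insert w (Act G),
       Str := insert w (Str G),
       lab := (\<lambda>x. if x = w then c else (case map_of (zip us as') x of Some a' \<Rightarrow> a' | None \<Rightarrow> lab G x))\<rparr>)
     (f(w := wi))" (is "Rep N y ?G ?f")
proof -
  have fw: "f v \<noteq> wi" if "v \<in> V G" for v using w that by auto
  have vw: "v \<noteq> w" if "v \<in> V G" for v using w that by auto
  have Ud: "(\<exists>k<l. dig N U k = f v) \<longleftrightarrow> v \<in> set us" if v: "v \<in> V G" for v
  proof
    assume "\<exists>k<l. dig N U k = f v"
    then obtain k where k: "k < l" "f (us ! k) = f v" using U by auto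
    have "us ! k \<in> set us" using k(1) us(3) by simp
    then show "v \<in> set us" using RepD(7)[OF R, of "us ! k" v] us(2) v k(2) by auto
  next
    assume "v \<in> set us"
    then obtain k where "k < l" "us ! k = v" using us by (auto simp: in_set_conv_nth)
    then show "\<exists>k<l. dig N U k = f v" using U by auto
  qed
  have Uw: "\<not> (\<exists>k<l. dig N U k = wi)" using U us fw by (metis nth_mem subsetD)
  have noE: "e \<notin> E G" if "w \<in> e" for e using wf w that by (auto simp: wf_net_def)
  have E1: "{u, v} \<in> E ?G \<longleftrightarrow> (if u = w then v \<in> set us else if v = w then u \<in> set us else {u, v} \<in> E G)"
      for u v
    using noE[of "{u, v}"] us w by (auto simp: doubleton_eq_iff)
  show ?thesis unfolding Rep_def
  proof (intro conjI ballI allI impI)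
    show "inj_on ?f (V ?G)" using RepD(1)[OF R] w fw by (auto simp: inj_on_def)
    show "?f v < N" if "v \<in> V ?G" for v using that RepD(2)[OF R] w by auto
    show "stt N y i = 0" if "i < N" "i \<notin> ?f ` V ?G" for i
    proof -
      have "i \<noteq> wi" using that(2) by auto
      moreover have "i \<notin> f ` V G" using that(2) vw by fastforce
      ultimately show ?thesis using y(1)[OF that(1)] RepD(3)[OF R that(1)] by simp
    qed
  next
    fix v assume v: "v \<in> V ?G"
    show "stt N y (?f v) = stn ?G v"
      using v y(1)[of "?f v"] RepD(2,4)[OF R] w fw by (auto simp: stn_def)
    show "lbl N y (?f v) = lab ?G v"
    proof (cases "v = w")
      case False
      then have vV: "v \<in> V G" using v by simp
      note fv = RepD(2)[OF R vV] fw[OF vV]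
      show ?thesis
      proof (cases "v \<in> set us")
        case True
        then obtain k where k: "k < l" "us ! k = v" using us by (auto simp: in_set_conv_nth)
        then have "lbl N y (f v) = as' ! k" using y(3)[OF fv, of k] U by auto
        moreover have "map_of (zip us as') v = Some (as' ! k)" using k us map_of_zip_nth[of us as' k] by auto
        ultimately show ?thesis using False by simp
      next
        case nin: False
        then have "lbl N y (f v) = lbl N x (f v)" using y(4)[OF fv] Ud[OF vV] by auto
        moreover have "map_of (zip us as') v = None" using nin us by (simp add: map_of_zip_is_None)
        ultimately show ?thesis using False RepD(5)[OF R vV] by simp
      qed
    qed (use y(2) in simp)
  next
    fix u v assume uv: "u \<in> V ?G" "v \<in> V ?G"
    show "adj N y (?f u) (?f v) \<longleftrightarrow> {u, v} \<in> E ?G"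
    proof -
      have "?f u < N" "?f v < N" using uv RepD(2)[OF R] w by auto
      moreover have "{w, w} \<notin> E ?G" using E1[of w w] us w by auto
      ultimately show ?thesis using uv y(5)[of "?f u" "?f v"] fw Ud Uw RepD(6)[OF R] unfolding E1
        using us w by auto
    qed
  qed
qed

text \<open>Weak creation, tag 8, gets no moves; it does not occur under the promise.\<close>

definition num_rule :: "nat \<Rightarrow> nat \<Rightarrow> (nat \<Rightarrow> nat) \<Rightarrow> nat \<Rightarrow> nat \<Rightarrow> bool" where
  "num_rule N M g x y \<longleftrightarrow> (if g 0 = 5 then num_relab N M (g 1) (g 2) (g 3) (g 4) x y
     else if g 0 = 6 then num_move N (g 1) (g 2) x y
     else g 0 = 7 \<and> num_create N M (g 1) (g 2) (\<lambda>i. g (3 + i)) (\<lambda>i. g (3 + g 1 + i)) x y)"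

lemma pair_index: "j < N \<Longrightarrow> j' < N \<Longrightarrow> i * N + j = i' * N + j' \<longleftrightarrow> i = i' \<and> j = (j' :: nat)"
proof
  assume j: "j < N" "j' < N" and eq: "i * N + j = i' * N + j'"
  have "(i * N + j) div N = i" "(i * N + j) mod N = j" "(i' * N + j') div N = i'" "(i' * N + j') mod N = j'"
    using j by auto
  then show "i = i' \<and> j = j'" using eq by auto
qed simp

lemma num_rule_sound:
  assumes R: "Rep N x G f" and wf: "wf_net G" and C: "num_rule N M g x y"
  shows "\<exists>G' f'. apply_rule (rule_of g) G G' \<and> Rep N y G' f'"
proof -
  have sub: "Act G \<subseteq> V G" "Str G \<subseteq> Act G" using wf by (auto simp: wf_net_def)
  have str: "v \<in> Str G" if "v \<in> V G" "stt N x (f v) = 3" for v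
    using RepD(4)[OF R that(1)] that(2) by (auto simp: stn_def split: if_splits)
  have act: "v \<in> Act G" if "v \<in> V G" "2 \<le> stt N x (f v)" for v
    using RepD(4)[OF R that(1)] that(2) sub by (auto simp: stn_def split: if_splits)
  consider "g 0 = 5" | "g 0 = 6" | "g 0 = 7" using C unfolding num_rule_def by metis
  then show ?thesis
  proof cases
    case 1
    then have "num_relab N M (g 1) (g 2) (g 3) (g 4) x y" using C by (simp add: num_rule_def)
    then obtain P where P': "P < M"
      "\<forall>u<N. \<forall>v<N. bit P (u * N + v) \<longrightarrow> 2 \<le> stt N x u \<and> 2 \<le> stt N x v \<and> adj N x u v \<and>
        lbl N x u = g 1 \<and> lbl N x v = g 2"
      "\<forall>u<N. \<forall>v<N. \<forall>u'<N. \<forall>v'<N. bit P (u * N + v) \<and> bit P (u' * N + v') \<and> \<not> (u = u' \<and> v = v') \<longrightarrow>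
        u \<noteq> u' \<and> u \<noteq> v' \<and> v \<noteq> u' \<and> v \<noteq> v'"
      "\<forall>i<N. stt N y i = stt N x i"
      "\<forall>i<N. lbl N y i = (if \<exists>v<N. bit P (i * N + v) then g 3
        else if \<exists>u<N. bit P (u * N + i) then g 4 else lbl N x i)"
      "\<forall>i<N. \<forall>j<N. adj N y i j \<longleftrightarrow> adj N x i j"
      unfolding num_relab_def by (elim exE conjE) (rule that)
    note P = P'(2-6)[rule_format]
    define S where "S = {(u, v). u \<in> V G \<and> v \<in> V G \<and> bit P (f u * N + f v)}"
    have PS: "bit P (i * N + j) \<longleftrightarrow> (\<exists>(u, v)\<in>S. i = f u \<and> j = f v)" if ij: "i < N" "j < N" for i j
    proof
      assume b: "bit P (i * N + j)"
      then have "stt N x i \<noteq> 0" "stt N x j \<noteq> 0" using P(1)[OF ij b] by auto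
      then obtain u v where "u \<in> V G" "v \<in> V G" "i = f u" "j = f v"
        using Rep_node[OF R ij(1)] Rep_node[OF R ij(2)] by auto
      then show "\<exists>(u, v)\<in>S. i = f u \<and> j = f v" using b by (auto simp: S_def)
    qed (auto simp: S_def)
    let ?G = "G\<lparr>lab := (\<lambda>x. if x \<in> fst ` S then g 3 else if x \<in> snd ` S then g 4 else lab G x)\<rparr>"
    have "Rep N y ?G f" by (rule Rep_relab[OF R, where P = P]) (use PS P(3-5) in \<open>auto simp: S_def\<close>)
    moreover have "apply_rule (Relab (g 1) (g 2) (g 3) (g 4)) G ?G"
      unfolding apply_rule.simps
    proof (intro exI[of _ S] conjI)
      show "\<forall>(u, v)\<in>S. u \<in> Act G \<and> v \<in> Act G \<and> {u, v} \<in> E G \<and> lab G u = g 1 \<and> lab G v = g 2"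
      proof (intro ballI, clarify)
        fix u v assume "(u, v) \<in> S"
        then have uv: "u \<in> V G" "v \<in> V G" "bit P (f u * N + f v)" by (auto simp: S_def)
        then show "u \<in> Act G \<and> v \<in> Act G \<and> {u, v} \<in> E G \<and> lab G u = g 1 \<and> lab G v = g 2"
          using P(1)[of "f u" "f v"] RepD(2,5,6)[OF R] act by simp
      qed
      show "\<forall>(u, v)\<in>S. \<forall>(u', v')\<in>S. (u, v) \<noteq> (u', v') \<longrightarrow> {u, v} \<inter> {u', v'} = {}"
      proof -
        have dis: "{u, v} \<inter> {u', v'} = {}" if "(u, v) \<in> S" "(u', v') \<in> S" "(u, v) \<noteq> (u', v')" for u v u' v'
        proof -
          have uv: "u \<in> V G" "v \<in> V G" "bit P (f u * N + f v)" "u' \<in> V G" "v' \<in> V G" "bit P (f u' * N + f v')"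
            using that by (auto simp: S_def)
          then have "\<not> (f u = f u' \<and> f v = f v')" using that(3) RepD(7)[OF R] by auto
          then show ?thesis using P(2)[of "f u" "f v" "f u'" "f v'"] uv RepD(2)[OF R] by blast
        qed
        show ?thesis by (intro ballI case_prodI2 impI, rule dis) simp_all
      qed
    qed simp
    ultimately show ?thesis using 1 by (auto simp: rule_of_def simp del: apply_rule.simps)
  next
    case 2
    then have "num_move N (g 1) (g 2) x y" using C by (simp add: num_rule_def)
    then obtain i j where ij: "i < N" "j < N" "stt N x i = 3" "lbl N x i = g 1" "stt N x j \<noteq> 0" "stt N x
        j \<noteq> 3"
       "lbl N x j = g 2" "adj N x i j"
      and y': "\<forall>k<N. stt N y k = (if k = j then 3 else if k = i then 2 else stt N x k)"
        "\<forall>k<N. lbl N y k = lbl N x k" "\<forall>k<N. \<forall>l<N. adj N y k l \<longleftrightarrow> adj N x k l"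
      unfolding num_move_def by (elim exE conjE) (rule that)
    note y = y'[rule_format]
    obtain u v where uv: "u \<in> V G" "v \<in> V G" "i = f u" "j = f v"
      using Rep_node[OF R ij(1)] Rep_node[OF R ij(2)] ij by auto
    have u: "u \<in> Str G" using str[of u] uv ij by simp
    have v: "v \<notin> Str G" using RepD(4)[OF R uv(2)] ij uv by (auto simp: stn_def)
    have "apply_rule (Move (g 1) (g 2)) G (G\<lparr>Str := Str G - {u} \<union> {v}, Act := Act G \<union> {v}\<rparr>)"
      unfolding apply_rule.simps using u v uv ij RepD(5,6)[OF R] by (intro exI[of _ u] exI[of _ v]) auto
    moreover have "Rep N y (G\<lparr>Str := Str G - {u} \<union> {v}, Act := Act G \<union> {v}\<rparr>) f"
      by (rule Rep_move[OF R]) (use uv u v y sub in auto)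
    ultimately show ?thesis using 2 by (auto simp: rule_of_def simp del: apply_rule.simps)
  next
    case 3
    define l where "l = g 1"
    from 3 have "num_create N M l (g 2) (\<lambda>i. g (3 + i)) (\<lambda>i. g (3 + l + i)) x y" using C by (simp add:
        num_rule_def l_def)
    then obtain U w where U': "U < M" "w < N" "stt N x w = 0"
       "\<forall>i<l. dig N U i < N \<and> stt N x (dig N U i) = 3 \<and> lbl N x (dig N U i) = g (3 + i)"
       "\<forall>i<l. \<forall>j<l. i \<noteq> j \<longrightarrow> dig N U i \<noteq> dig N U j"
      and y': "\<forall>i<N. stt N y i = (if i = w then 3 else stt N x i)"
       "\<forall>i<N. if i = w then lbl N y i = g 2 else
          (\<forall>k<l. dig N U k = i \<longrightarrow> lbl N y i = g (3 + l + k)) \<and> ((\<forall>k<l. dig N U k \<noteq> i) \<longrightarrow> lbl N y i = lbl N x i)"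
       "\<forall>i<N. \<forall>j<N. adj N y i j \<longleftrightarrow> (if i = w then (\<exists>k<l. dig N U k = j)
          else if j = w then (\<exists>k<l. dig N U k = i) else adj N x i j)"
      unfolding num_create_def by (elim exE conjE) (rule that)
    note U = U'(2-5)[rule_format]
    have y: "\<And>i. i < N \<Longrightarrow> stt N y i = (if i = w then 3 else stt N x i)" "lbl N y w = g 2"
      "\<And>i k. i < N \<Longrightarrow> i \<noteq> w \<Longrightarrow> k < l \<Longrightarrow> dig N U k = i \<Longrightarrow> lbl N y i = g (3 + l + k)"
      "\<And>i. i < N \<Longrightarrow> i \<noteq> w \<Longrightarrow> (\<And>k. k < l \<Longrightarrow> dig N U k \<noteq> i) \<Longrightarrow> lbl N y i = lbl N x i"
      "\<And>i j. i < N \<Longrightarrow> j < N \<Longrightarrow> adj N y i j \<longleftrightarrow> (if i = w then (\<exists>k<l. dig N U k = j)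
          else if j = w then (\<exists>k<l. dig N U k = i) else adj N x i j)"
      using y' U(1) by simp_all
    have "\<forall>k<l. \<exists>v\<in>V G. dig N U k = f v" using Rep_node[OF R] U(3) by force
    then obtain h where h: "\<And>k. k < l \<Longrightarrow> h k \<in> V G \<and> dig N U k = f (h k)" by metis
    define us where "us = map h [0..<l]"
    have us: "distinct us" "set us \<subseteq> Str G" "length us = l" "\<And>k. k < l \<Longrightarrow> us ! k = h k"
      using U(3,4) h str by (auto simp: us_def distinct_map inj_on_def) metis
    have wV: "w \<notin> f ` V G" using U(2) RepD(4)[OF R] by (auto simp: stn_def split: if_splits)
    \<comment> \<open>The code knows only the free slot \<open>w\<close>; any fresh number serves as
      the name of the new node.\<close>
    obtain w' where w': "w' \<notin> V G" using wf ex_new_if_finite[of "V G"] by (auto simp: wf_net_def)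
    let ?as' = "map (\<lambda>i. g (3 + l + i)) [0..<l]"
    let ?G = "G\<lparr>V := insert w' (V G), E := E G \<union> {{w', u} | u. u \<in> set us}, Act := insert w' (Act G),
       Str := insert w' (Str G),
       lab := (\<lambda>x. if x = w' then g 2 else (case map_of (zip us ?as') x of Some a' \<Rightarrow> a' | None \<Rightarrow> lab G x))\<rparr>"
    have "Rep N y ?G (f(w' := w))"
    proof (rule Rep_create[OF R wf w' U(1) wV us(1) _ us(3), where U = U])
      show "lbl N y i = ?as' ! k" if "i < N" "i \<noteq> w" "k < l" "dig N U k = i" for i k using y(3)[OF that]
          that(3) by simp
      show "adj N y i j \<longleftrightarrow> (if i = w then (\<exists>k<l. dig N U k = j)
          else if j = w then (\<exists>k<l. dig N U k = i) else adj N x i j)" if "i < N" "j < N" for i j by (rule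
              y(5)[OF that])
      show "dig N U k = f (us ! k)" if "k < l" for k using that us(4) h by simp
    qed (use us(2) sub y(1,2,4) in auto)
    moreover have "apply_rule (Create (map (\<lambda>i. g (3 + i)) [0..<l]) (g 2) ?as' True) G ?G"
      unfolding apply_rule.simps
    proof (intro exI[of _ us] exI[of _ w'] conjI allI impI)
      show "lab G (us ! i) = map (\<lambda>i. g (3 + i)) [0..<l] ! i" if "i < length us" for i
        using that us U(3)[of i] h[of i] RepD(5)[OF R, of "h i"] by simp
    qed (use us w' in auto)
    ultimately show ?thesis using 3 by (auto simp: rule_of_def l_def simp del: apply_rule.simps)
  qed
qed

text \<open>Node sets, pair matrices and lists of \<open>N\<close> slots fit in one block, so the
  single bound \<open>2 ^ blk N\<close> serves for every guess.\<close>

lemma pow_blk: "2 ^ N \<le> (2::nat) ^ blk N" "2 ^ (N * N) \<le> (2::nat) ^ blk N"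
  by (auto simp: blk_def algebra_simps intro!: power_increasing)
    (cases N; simp)

text \<open>The strict bound on the number of nodes provides a free slot for a created node, and
  \<open>2 \<le> N\<close> lets status 3 fit in a word.\<close>

lemma num_rule_complete:
  assumes R: "Rep N x G f" and wf: "wf_net G" and N: "2 \<le> N" and card: "card (V G) < N"
    and g: "\<And>j. g j < 2 ^ N" and tag: "g 0 = 5 \<or> g 0 = 6 \<or> g 0 = 7"
    and app: "apply_rule (rule_of g) G G'"
  shows "\<exists>y<2 ^ blk N. \<exists>f'. num_rule N (2 ^ blk N) g x y \<and> Rep N y G' f'"
proof -
  have sub: "Act G \<subseteq> V G" "Str G \<subseteq> Act G" "finite (V G)" using wf by (auto simp: wf_net_def)
  have N1: "1 \<le> N" using N by simp
  have three: "(3::nat) < 2 ^ N" using power_increasing[OF N, of "2::nat"] by simp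
  have act: "2 \<le> stt N x (f v)" if "v \<in> Act G" for v
    using RepD(4)[OF R, of v] that sub by (auto simp: stn_def)
  have str: "stt N x (f v) = 3" if "v \<in> Str G" for v
    using RepD(4)[OF R, of v] that sub by (auto simp: stn_def)
  consider "g 0 = 5" | "g 0 = 6" | "g 0 = 7" using tag by blast
  then show ?thesis
  proof cases
    case 1
    then have "apply_rule (Relab (g 1) (g 2) (g 3) (g 4)) G G'" using app by (simp add: rule_of_def)
    then obtain S where S: "\<forall>(u, v)\<in>S. u \<in> Act G \<and> v \<in> Act G \<and> {u, v} \<in> E G \<and> lab G u = g 1 \<and> lab G v = g 2"
        "\<forall>(u, v)\<in>S. \<forall>(u', v')\<in>S. (u, v) \<noteq> (u', v') \<longrightarrow> {u, v} \<inter> {u', v'} = {}"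
      and G': "G' = G\<lparr>lab := (\<lambda>x. if x \<in> fst ` S then g 3 else if x \<in> snd ` S then g 4 else lab G x)\<rparr>"
      unfolding apply_rule.simps by (elim exE conjE) (rule that)
    have S1: "u \<in> Act G \<and> v \<in> Act G \<and> {u, v} \<in> E G \<and> lab G u = g 1 \<and> lab G v = g 2" if "(u, v) \<in> S" for u v
      using bspec[OF S(1) that] by simp
    have S2: "{u, v} \<inter> {u', v'} = {}" if "(u, v) \<in> S" "(u', v') \<in> S" "(u, v) \<noteq> (u', v')" for u v u' v'
      using bspec[OF bspec[OF S(2) that(1), simplified prod.case] that(2)] that(3) unfolding prod.case by
          (rule mp)
    have SV: "S \<subseteq> V G \<times> V G" using S1 sub by auto
    obtain P :: nat where P: "P < 2 ^ (N * N)" "\<And>k. k < N * N \<Longrightarrow> bit P k \<longleftrightarrow> (\<exists>(u, v)\<in>S. k = f u * N + f v)"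
      using ex_bits[of "N * N" "\<lambda>k. \<exists>(u, v)\<in>S. k = f u * N + f v"] by blast
    have PS: "bit P (i * N + j) \<longleftrightarrow> (\<exists>(u, v)\<in>S. i = f u \<and> j = f v)" if ij: "i < N" "j < N" for i j
    proof -
      have "Suc i * N \<le> N * N" using ij by (intro mult_right_mono) auto
      then have "bit P (i * N + j) \<longleftrightarrow> (\<exists>(u, v)\<in>S. i * N + j = f u * N + f v)" using P(2)[of "i * N + j"]
          ij by simp
      moreover have "i * N + j = f u * N + f v \<longleftrightarrow> i = f u \<and> j = f v" if "(u, v) \<in> S" for u v
        using pair_index[OF ij(2), of "f v"] RepD(2)[OF R] SV that by auto
      ultimately show ?thesis by auto
    qed
    let ?l = "\<lambda>i. if \<exists>v<N. bit P (i * N + v) then g 3 else if \<exists>u<N. bit P (u * N + i) then g 4 else lbl N x i"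
    have "\<And>i. ?l i < 2 ^ N" using g lbl_less by auto
    then obtain y where y: "y < 2 ^ blk N" "\<forall>i<N. stt N y i = stt N x i" "\<forall>i<N. lbl N y i = ?l i"
      "\<forall>i<N. \<forall>j<N. adj N y i j \<longleftrightarrow> adj N x i j"
      using ex_code[OF N1, of "stt N x" ?l "adj N x"] stt_less by blast
    have "Rep N y G' f" unfolding G' by (rule Rep_relab[OF R SV PS]) (use y in auto)
    moreover have "num_relab N (2 ^ blk N) (g 1) (g 2) (g 3) (g 4) x y"
      unfolding num_relab_def
    proof (intro exI[of _ P] conjI y(2-4))
      show "P < 2 ^ blk N" using P(1) pow_blk(2)[of N] by linarith
      show "\<forall>u<N. \<forall>v<N. bit P (u * N + v) \<longrightarrow> 2 \<le> stt N x u \<and> 2 \<le> stt N x v \<and> adj N x u v \<and>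
        lbl N x u = g 1 \<and> lbl N x v = g 2"
      proof (intro allI impI)
        fix i j assume ij: "i < N" "j < N" "bit P (i * N + j)"
        then obtain u v where uv: "(u, v) \<in> S" "i = f u" "j = f v" using PS by auto
        then show "2 \<le> stt N x i \<and> 2 \<le> stt N x j \<and> adj N x i j \<and> lbl N x i = g 1 \<and> lbl N x j = g 2"
          using S1[OF uv(1)] act SV RepD(5)[OF R, of u] RepD(5)[OF R, of v] RepD(6)[OF R, of u v] by auto
      qed
      show "\<forall>u<N. \<forall>v<N. \<forall>u'<N. \<forall>v'<N. bit P (u * N + v) \<and> bit P (u' * N + v') \<and> \<not> (u = u' \<and> v = v') \<longrightarrow>
        u \<noteq> u' \<and> u \<noteq> v' \<and> v \<noteq> u' \<and> v \<noteq> v'"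
      proof (intro allI impI, elim conjE)
        fix i j i' j' assume ij: "i < N" "j < N" "i' < N" "j' < N" "bit P (i * N + j)" "bit P (i' * N +
            j')" "\<not> (i = i' \<and> j = j')"
        obtain u v where uv: "(u, v) \<in> S" "i = f u" "j = f v" using PS[OF ij(1,2)] ij(5) by auto
        obtain u' v' where uv': "(u', v') \<in> S" "i' = f u'" "j' = f v'" using PS[OF ij(3,4)] ij(6) by auto
        have "{u, v} \<inter> {u', v'} = {}" using S2[OF uv(1) uv'(1)] ij(7) uv uv' by auto
        then show "i \<noteq> i' \<and> i \<noteq> j' \<and> j \<noteq> i' \<and> j \<noteq> j'" using uv uv' SV RepD(7)[OF R] by auto
      qed
    qed
    ultimately show ?thesis using y(1) 1 by (auto simp: num_rule_def)
  next
    case 2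
    then have "apply_rule (Move (g 1) (g 2)) G G'" using app by (simp add: rule_of_def)
    then obtain u v where uv: "u \<in> Str G" "lab G u = g 1" "v \<in> V G - Str G" "lab G v = g 2" "{u, v} \<in> E G"
      and G': "G' = G\<lparr>Str := Str G - {u} \<union> {v}, Act := Act G \<union> {v}\<rparr>" unfolding apply_rule.simps by blast
    have V: "u \<in> V G" "v \<in> V G" "u \<in> Act G" "u \<noteq> v" using uv sub by auto
    let ?s = "\<lambda>k. if k = f v then 3 else if k = f u then 2 else stt N x k"
    have "\<And>i. ?s i < 2 ^ N" using three stt_less by auto
    then obtain y where y: "y < 2 ^ blk N" "\<forall>i<N. stt N y i = ?s i" "\<forall>i<N. lbl N y i = lbl N x i"
      "\<forall>i<N. \<forall>j<N. adj N y i j \<longleftrightarrow> adj N x i j"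
      using ex_code[OF N1, of ?s "lbl N x" "adj N x"] lbl_less by blast
    have "Rep N y G' f" unfolding G' by (rule Rep_move[OF R V]) (use y in auto)
    moreover have "num_move N (g 1) (g 2) x y"
      unfolding num_move_def
      by (rule exI[of _ "f u"], rule conjI[OF RepD(2)[OF R V(1)]], rule exI[of _ "f v"], intro conjI y(2-4))
        (use uv V str[of u] RepD(2,5)[OF R, of u] RepD(2,4,5)[OF R, of v] RepD(6)[OF R, of u v] in \<open>auto
            simp: stn_def\<close>)
    ultimately show ?thesis using y(1) 2 by (auto simp: num_rule_def)
  next
    case 3
    define l where "l = g 1"
    let ?as = "map (\<lambda>i. g (3 + i)) [0..<l]"
    let ?as' = "map (\<lambda>i. g (3 + l + i)) [0..<l]"
    have "apply_rule (Create ?as (g 2) ?as' True) G G'" using app 3 by (simp add: rule_of_def l_def)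
    then obtain us w where us: "length us = l" "distinct us" "set us \<subseteq> Str G"
        "\<And>i. i < l \<Longrightarrow> lab G (us ! i) = g (3 + i)" and w: "w \<notin> V G"
      and G': "G' = G\<lparr>V := insert w (V G), E := E G \<union> {{w, u} | u. u \<in> set us}, Act := insert w (Act G),
        Str := insert w (Str G),
        lab := (\<lambda>x. if x = w then g 2 else (case map_of (zip us ?as') x of Some a' \<Rightarrow> a' | None \<Rightarrow> lab G x))\<rparr>"
      unfolding apply_rule.simps by auto
    have usV: "set us \<subseteq> V G" using us sub by auto
    have nth: "us ! i \<in> V G \<and> us ! i \<in> Str G" if "i < l" for i using that us usV by auto
    have "l \<le> card (V G)" using card_mono[OF sub(3) usV] us by (simp add: distinct_card)
    \<comment> \<open>The chosen nodes are distinct, so a rule with too many labels cannot be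
      applicable at all.\<close>
    then have lN: "l \<le> N" using card by simp
    have "card (f ` V G) < card {..<N}" using card card_image_le[OF sub(3), of f] by simp
    then obtain wi where wi: "wi < N" "wi \<notin> f ` V G" using card_mono[of "f ` V G" "{..<N}"] sub(3)
      by (metis finite_imageI lessThan_iff not_less subsetI)
    have "f v < 2 ^ N" if "v \<in> V G" for v using RepD(2)[OF R that] less_exp[of N] by linarith
    then have "\<And>i. (if i < l then f (us ! i) else 0) < 2 ^ N" using nth by simp
    then obtain U where U': "U < 2 ^ (N * N)" "\<forall>i<N. dig N U i = (if i < l then f (us ! i) else 0)"
      using ex_dig[of N "\<lambda>i. if i < l then f (us ! i) else 0" N] by blast
    then have U: "U < 2 ^ (N * N)" "\<And>k. k < l \<Longrightarrow> dig N U k = f (us ! k)" using lN by auto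
    let ?s = "\<lambda>i. if i = wi then 3 else stt N x i"
    let ?l = "\<lambda>i. if i = wi then g 2 else if \<exists>k<l. dig N U k = i then g (3 + l + (THE k. k < l \<and> dig N U
        k = i)) else lbl N x i"
    let ?a = "\<lambda>i j. if i = wi then (\<exists>k<l. dig N U k = j) else if j = wi then (\<exists>k<l. dig N U k = i) else
        adj N x i j"
    have Uinj: "dig N U i \<noteq> dig N U j" if "i < l" "j < l" "i \<noteq> j" for i j
      using that U(2) nth RepD(7)[OF R] us(1,2) by (metis nth_eq_iff_index_eq)
    have the: "(THE k'. k' < l \<and> dig N U k' = dig N U k) = k" if "k < l" for k
      using that Uinj by (intro the_equality) auto
    have "\<And>i. ?s i < 2 ^ N" "\<And>i. ?l i < 2 ^ N" using three stt_less lbl_less g by auto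
    then obtain y where y: "y < 2 ^ blk N" "\<forall>i<N. stt N y i = ?s i" "\<forall>i<N. lbl N y i = ?l i"
      "\<forall>i<N. \<forall>j<N. adj N y i j \<longleftrightarrow> ?a i j"
      using ex_code[OF N1, of ?s ?l ?a] by blast
    have lb: "if i = wi then lbl N y i = g 2 else
        (\<forall>k<l. dig N U k = i \<longrightarrow> lbl N y i = g (3 + l + k)) \<and> ((\<forall>k<l. dig N U k \<noteq> i) \<longrightarrow> lbl N y i = lbl N x i)"
      if "i < N" for i
      using y(3) that the by auto (metis Uinj)
    have "Rep N y G' (f(w := wi))" unfolding G'
    proof (rule Rep_create[OF R wf w wi us(2) usV us(1), where U = U])
      show "lbl N y wi = g 2" using y(3) wi(1) by simp
      show "lbl N y i = ?as' ! k" if "i < N" "i \<noteq> wi" "k < l" "dig N U k = i" for i k using lb[OF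
          that(1)] that by simp
      show "lbl N y i = lbl N x i" if "i < N" "i \<noteq> wi" "\<And>k. k < l \<Longrightarrow> dig N U k \<noteq> i" for i using lb[OF
          that(1)] that by simp
    qed (use U y in auto)
    moreover have "num_create N (2 ^ blk N) l (g 2) (\<lambda>i. g (3 + i)) (\<lambda>i. g (3 + l + i)) x y"
      unfolding num_create_def
    proof (rule exI[of _ U], rule conjI, use U(1) pow_blk(2)[of N] in linarith,
        rule exI[of _ wi], intro conjI wi(1) y(2,4))
      show "stt N x wi = 0" using RepD(3)[OF R wi] .
      show "\<forall>i<l. dig N U i < N \<and> stt N x (dig N U i) = 3 \<and> lbl N x (dig N U i) = g (3 + i)"
        using U(2) nth RepD(2,5)[OF R] str us(4) by simp
    qed (use lb Uinj in auto)
    ultimately show ?thesis using y(1) 3 by (auto simp: num_rule_def l_def)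
  qed
qed

text \<open>A rule occupies \<open>2 * N + 3\<close> words: three header fields and two lists of at
  most \<open>N\<close> labels.\<close>

definition rule_field :: "nat \<Rightarrow> nat \<Rightarrow> nat \<Rightarrow> nat \<Rightarrow> nat" where
  "rule_field N RU r j = dig N RU (r * (2 * N + 3) + j)"

section \<open>The bounded game on codes\<close>

definition num_cmove :: "nat \<Rightarrow> nat \<Rightarrow> nat \<Rightarrow> nat \<Rightarrow> nat \<Rightarrow> nat \<Rightarrow> bool" where
  "num_cmove N M nr RU x y \<longleftrightarrow> x = y \<or> (\<exists>r<nr. num_rule N M (rule_field N RU r) x y)"

fun num_safe :: "nat \<Rightarrow> nat \<Rightarrow> nat \<Rightarrow> nat \<Rightarrow> nat \<Rightarrow> nat \<Rightarrow> bool" where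
  "num_safe N M nr RU 0 x \<longleftrightarrow> True"
| "num_safe N M nr RU (Suc k) x \<longleftrightarrow> (\<forall>y<M. num_del N x y \<longrightarrow> num_conn N M y \<and> (\<exists>z<M. num_cmove N M nr RU y z
    \<and> num_safe N M nr RU k z))"

lemma num_safe_iff_safeN:
  assumes N: "2 \<le> N" and rules: "\<forall>r \<in> set R. wf_rule r" "no_weak_creation R"
    and R: "R = map (\<lambda>r. rule_of (rule_field N RU r)) [0..<nr]"
  shows "Rep N x G f \<Longrightarrow> wf_net G \<Longrightarrow> num_safe N (2 ^ blk N) nr RU k x \<longleftrightarrow> safeN R k G"
proof (induction k arbitrary: x G f)
  case (Suc k)
  note Rx = Suc.prems(1) and wf = Suc.prems(2)
  \<comment> \<open>\<open>rule_of\<close> reads every tag other than 5, 6 and 7 as a weak creation,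
    and these are excluded.\<close>
  have tag: "rule_field N RU r 0 = 5 \<or> rule_field N RU r 0 = 6 \<or> rule_field N RU r 0 = 7" if "r < nr" for r
  proof -
    have "rule_of (rule_field N RU r) \<in> set R" using R that by auto
    then show ?thesis using rules(2) unfolding no_weak_creation_def rule_of_def by (auto split: if_splits)
  qed
  have cm: "cmove R G G' \<longleftrightarrow> G' = G \<or> (\<exists>r<nr. apply_rule (rule_of (rule_field N RU r)) G G')" for G G'
    unfolding cmove_def R by auto
  have step: "(\<exists>z<2 ^ blk N. num_cmove N (2 ^ blk N) nr RU y z \<and> num_safe N (2 ^ blk N) nr RU k z) \<longleftrightarrow>
      (\<exists>G'. cmove R H G' \<and> safeN R k G')"
    if y: "y < 2 ^ blk N" "Rep N y H f" and H: "wf_net H" "card (V H) < N" for y H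
  proof
    assume "\<exists>z<2 ^ blk N. num_cmove N (2 ^ blk N) nr RU y z \<and> num_safe N (2 ^ blk N) nr RU k z"
    then obtain z where z: "num_cmove N (2 ^ blk N) nr RU y z" "num_safe N (2 ^ blk N) nr RU k z" by auto
    obtain G' f' where G': "cmove R H G'" "Rep N z G' f'"
    proof (cases "y = z")
      case True
      then show thesis using that[of H f] y by (simp add: cmove_def)
    next
      case False
      with z(1) obtain r where r: "r < nr" "num_rule N (2 ^ blk N) (rule_field N RU r) y z" by (auto
          simp: num_cmove_def)
      show thesis using num_rule_sound[OF y(2) H(1) r(2)] that r(1) cm by blast
    qed
    have "wf_net G'" using cmove_invariants(1)[OF G'(1) H(1) rules] .
    then show "\<exists>G'. cmove R H G' \<and> safeN R k G'" using Suc.IH[OF G'(2)] z(2) G'(1) by blast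
  next
    assume "\<exists>G'. cmove R H G' \<and> safeN R k G'"
    then obtain G' where G': "cmove R H G'" "safeN R k G'" by auto
    have wf': "wf_net G'" using cmove_invariants(1)[OF G'(1) H(1) rules] .
    obtain z f' where z: "z < 2 ^ blk N" "num_cmove N (2 ^ blk N) nr RU y z" "Rep N z G' f'"
    proof (cases "G' = H")
      case True
      then show thesis using that[of y f] y by (simp add: num_cmove_def)
    next
      case False
      with G'(1) cm obtain r where r: "r < nr" "apply_rule (rule_of (rule_field N RU r)) H G'" by blast
      have "rule_field N RU r j < 2 ^ N" for j by (simp add: rule_field_def dig_less)
      then show thesis using num_rule_complete[OF y(2) H(1) N H(2) _ tag[OF r(1)] r(2)] that r(1)
          num_cmove_def by blast
    qed
    then show "\<exists>z<2 ^ blk N. num_cmove N (2 ^ blk N) nr RU y z \<and> num_safe N (2 ^ blk N) nr RU k z"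
      using Suc.IH[OF z(3) wf'] G'(2) by blast
  qed
  \<comment> \<open>All nodes have distinct slots, so there are at most \<open>N\<close> of them;
    the deletion makes this strict before Constructor moves.\<close>
  have del: "wf_net (del_node v G)" "card (V (del_node v G)) < N" if "v \<in> Act G - Str G" for v
  proof -
    show "wf_net (del_node v G)" using wf wf_del_node by blast
    have fin: "finite (V G)" and v: "v \<in> V G" using wf that by (auto simp: wf_net_def)
    have "card (V G) = card (f ` V G)" using RepD(1)[OF Rx] by (simp add: card_image)
    also have "\<dots> \<le> card {..<N}" using RepD(2)[OF Rx] by (intro card_mono) auto
    finally show "card (V (del_node v G)) < N" using card_Diff1_less[OF fin v] by (simp add: del_node_def)
  qed
  show ?case
  proof
    assume s: "num_safe N (2 ^ blk N) nr RU (Suc k) x"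
    show "safeN R (Suc k) G" unfolding safeN.simps
    proof
      fix v assume v: "v \<in> Act G - Str G"
      obtain y where y: "y < 2 ^ blk N" "num_del N x y" "Rep N y (del_node v G) f" using
          num_del_complete[OF Rx wf v] by blast
      then show "connected_net (del_node v G) \<and> (\<exists>G'. cmove R (del_node v G) G' \<and> safeN R k G')"
        using s num_conn_iff[OF y(3) del(1)[OF v] pow_blk(1)] step[OF y(1,3) del[OF v]] by auto
    qed
  next
    assume s: "safeN R (Suc k) G"
    show "num_safe N (2 ^ blk N) nr RU (Suc k) x" unfolding num_safe.simps
    proof (intro allI impI)
      fix y assume y: "y < 2 ^ blk N" "num_del N x y"
      obtain v where v: "v \<in> Act G - Str G" "Rep N y (del_node v G) f" using num_del_sound[OF Rx y(2)] by
          blast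
      then show "num_conn N (2 ^ blk N) y \<and> (\<exists>z<2 ^ blk N. num_cmove N (2 ^ blk N) nr RU y z \<and> num_safe N
          (2 ^ blk N) nr RU k z)"
        using s num_conn_iff[OF v(2) del(1)[OF v(1)] pow_blk(1)] step[OF y(1) v(2) del[OF v(1)]] by auto
    qed
  qed
qed simp

section \<open>The input encoding\<close>

declare bits.simps [simp del]

section \<open>Binary words and prefix-free encodings\<close>

lemma bits_0 [simp]: "bits 0 = []" by (simp add: bits.simps)

lemma bits_pos: "0 < n \<Longrightarrow> bits n = bits (n div 2) @ [n mod 2 + 1]"
  by (subst bits.simps) simp

lemma bits_eq_Nil [simp]: "bits n = [] \<longleftrightarrow> n = 0"
  by (cases "n = 0") (auto simp: bits_pos)

lemma blen_0 [simp]: "blen 0 = 0"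
  using le_blen_iff[of 0 0] by simp

lemma blen_pos: "0 < n \<Longrightarrow> blen n = Suc (blen (n div 2))"
proof -
  assume n: "0 < n"
  have "i < blen n \<longleftrightarrow> i < Suc (blen (n div 2))" for i
  proof (cases i)
    case 0
    then show ?thesis using n le_blen_iff[of 0 n] by simp
  next
    case (Suc j)
    have "2 ^ Suc j \<le> n \<longleftrightarrow> 2 ^ j \<le> n div 2" by (simp add: less_eq_div_iff_mult_less_eq mult.commute)
    then show ?thesis using Suc le_blen_iff[of i n] le_blen_iff[of j "n div 2"] by simp
  qed
  then show ?thesis by (metis linorder_neqE_nat less_irrefl)
qed

text \<open>An indexed form of the recursion, most significant bit first, so that the symbols can be
  produced by a bounded loop.\<close>

lemma bits_eq: "bits n = map (\<lambda>i. of_bool (bit n (blen n - 1 - i)) + 1) [0..<blen n]"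
proof (induction n rule: less_induct)
  case (less n)
  show ?case
  proof (cases "n = 0")
    case False
    let ?b = "blen (n div 2)"
    have b: "blen n = Suc ?b" using False by (simp add: blen_pos)
    have "bits n = bits (n div 2) @ [n mod 2 + 1]" using False by (simp add: bits_pos)
    moreover have "bits (n div 2) = map (\<lambda>i. of_bool (bit n (blen n - 1 - i)) + 1) [0..<?b]"
      unfolding b using less[of "n div 2"] False
      by (auto simp: bit_Suc[symmetric] Suc_diff_Suc simp del: upt_Suc)
    moreover have "n mod 2 = of_bool (bit n 0)" by (simp add: bit_0 mod_2_eq_odd)
    ultimately show ?thesis unfolding b by simp
  qed simp
qed

lemma length_bits: "length (bits n) = blen n"
  by (simp add: bits_eq)

lemma set_bits: "set (bits n) \<subseteq> {1, 2}"
  by (auto simp: bits_eq)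

lemma bits_inj: "bits n = bits m \<Longrightarrow> n = m"
proof (induction n arbitrary: m rule: less_induct)
  case (less n)
  consider "n = 0" | "m = 0" | "0 < n" "0 < m" by linarith
  then show ?case
  proof cases
    case 3
    then have "bits (n div 2) = bits (m div 2)" "n mod 2 = m mod 2" using less.prems by (auto simp: bits_pos)
    moreover have "n div 2 = m div 2" using less.IH[of "n div 2"] 3 calculation(1) by simp
    ultimately show ?thesis by (metis div_mult_mod_eq)
  next
    case 1
    then show ?thesis using less.prems bits_eq_Nil[of m] by simp
  next
    case 2
    then show ?thesis using less.prems by simp
  qed
qed

text \<open>Injectivity together with a uniquely determined remainder; in this form the property
  passes to concatenations.\<close>

definition prefix_free :: "('a \<Rightarrow> 'b list) \<Rightarrow> bool" where
  "prefix_free f \<longleftrightarrow> (\<forall>x y r s. f x @ r = f y @ s \<longrightarrow> x = y \<and> r = s)"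

lemma prefix_freeD: "prefix_free f \<Longrightarrow> f x @ r = f y @ s \<Longrightarrow> x = y \<and> r = s"
  unfolding prefix_free_def by blast

lemma sep_unique: "c \<notin> set xs \<Longrightarrow> c \<notin> set ys \<Longrightarrow> xs @ c # r = ys @ c # s \<Longrightarrow> xs = ys \<and> r = s"
proof (induction xs arbitrary: ys)
  case Nil
  then show ?case by (cases ys) auto
next
  case (Cons a xs)
  then show ?case by (cases ys) auto
qed

lemma prefix_free_enc_nat: "prefix_free enc_nat"
  unfolding prefix_free_def
proof (intro allI impI)
  fix x y r s assume "enc_nat x @ r = enc_nat y @ s"
  then have "bits x = bits y \<and> r = s"
    using set_bits[of x] set_bits[of y] by (intro sep_unique[of 3]) (auto simp: enc_nat_def)
  then show "x = y \<and> r = s" using bits_inj by blast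
qed

lemma hd_enc_nat: "enc_nat x \<noteq> []" "hd (enc_nat x @ r) \<noteq> 4" "hd (enc_nat x) \<noteq> 4"
  using set_bits[of x] by (cases "bits x"; auto simp: enc_nat_def)+

text \<open>No item starts with the terminator 4, so one symbol decides whether the list
  continues.\<close>

lemma prefix_free_enc_list:
  assumes "prefix_free f" "\<And>x. f x \<noteq> [] \<and> hd (f x) \<noteq> 4"
  shows "prefix_free (enc_list f)"
proof -
  have ne: "f x @ r \<noteq> 4 # s" for x r s using assms(2)[of x] by (cases "f x") auto
  have "enc_list f xs @ r = enc_list f ys @ s \<Longrightarrow> xs = ys \<and> r = s" for xs ys r s
  proof (induction xs arbitrary: ys)
    case Nil
    then show ?case using ne by (cases ys) (auto simp: enc_list_def, metis)
  next
    case (Cons x xs)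
    show ?case
    proof (cases ys)
      case Nil
      then show ?thesis using Cons.prems ne by (auto simp: enc_list_def)
    next
      case (Cons y ys')
      have "f x @ (enc_list f xs @ r) = f y @ (enc_list f ys' @ s)" using Cons.prems Cons by (simp add:
          enc_list_def)
      from prefix_freeD[OF assms(1) this] Cons.IH Cons show ?thesis by auto
    qed
  qed
  then show ?thesis unfolding prefix_free_def by blast
qed

lemma prefix_free_enc_rule: "prefix_free enc_rule"
proof -
  note n = prefix_free_enc_nat[THEN prefix_freeD]
  have "prefix_free (enc_list enc_nat)" by (rule prefix_free_enc_list[OF prefix_free_enc_nat])
    (simp add: hd_enc_nat)
  note l = this[THEN prefix_freeD]
  have "enc_rule x @ r = enc_rule y @ s \<Longrightarrow> x = y \<and> r = s" for x y r s
    by (cases x; cases y) (auto split: if_splits dest!: n l)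
  then show ?thesis unfolding prefix_free_def by blast
qed

definition enc_node :: "nat \<times> nat \<times> bool \<times> bool \<Rightarrow> nat list" where
  "enc_node = (\<lambda>(a, b, p, q). enc_nat a @ enc_nat b @ [if p then 1 else 2, if q then 1 else 2])"

definition enc_edge :: "nat \<times> nat \<Rightarrow> nat list" where
  "enc_edge = (\<lambda>(u, v). enc_nat u @ enc_nat v)"

text \<open>Networks themselves are not determined by their encoding, since labels outside
  \<open>V\<close> do not show in it. Injectivity is therefore stated for the three lists.\<close>

definition enc3 :: "(nat \<times> nat \<times> bool \<times> bool) list \<Rightarrow> (nat \<times> nat) list \<Rightarrow> rule list \<Rightarrow> nat list" where
  "enc3 es ps rs = enc_list enc_node es @ enc_list enc_edge ps @ enc_list enc_rule rs"

lemma enc3_inj: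
  assumes "enc3 es ps rs = enc3 es' ps' rs'"
  shows "es = es' \<and> ps = ps' \<and> rs = rs'"
proof -
  note n = prefix_free_enc_nat[THEN prefix_freeD]
  have "prefix_free enc_node" unfolding prefix_free_def enc_node_def by (auto split: if_splits dest!: n)
  then have 1: "prefix_free (enc_list enc_node)"
    by (rule prefix_free_enc_list) (simp add: enc_node_def case_prod_beta hd_enc_nat)
  have "prefix_free enc_edge" unfolding prefix_free_def enc_edge_def by (auto dest!: n)
  then have 2: "prefix_free (enc_list enc_edge)"
    by (rule prefix_free_enc_list) (simp add: enc_edge_def case_prod_beta hd_enc_nat)
  have 3: "prefix_free (enc_list enc_rule)"
  proof (rule prefix_free_enc_list[OF prefix_free_enc_rule])
    fix x show "enc_rule x \<noteq> [] \<and> hd (enc_rule x) \<noteq> 4" by (cases x) auto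
  qed
  have a: "es = es'" "enc_list enc_edge ps @ enc_list enc_rule rs = enc_list enc_edge ps' @ enc_list
      enc_rule rs'"
    using prefix_freeD[OF 1] assms unfolding enc3_def by blast+
  then have b: "ps = ps'" "enc_list enc_rule rs = enc_list enc_rule rs'" using prefix_freeD[OF 2] by blast+
  then have "rs = rs'" using prefix_freeD[OF 3, of rs "[]" rs' "[]"] by simp
  then show ?thesis using a b by blast
qed

definition edge_list :: "net \<Rightarrow> (nat \<times> nat) list" where
  "edge_list G = concat (map (\<lambda>u. map (\<lambda>v. (u, v)) (sorted_list_of_set {v. {u, v} \<in> E G \<and> u < v}))
     (sorted_list_of_set (V G)))"

lemma enc_instance_enc3:
  "enc_instance (G, R) = enc3 (map (\<lambda>v. (v, lab G v, v \<in> Act G, v \<in> Str G)) (sorted_list_of_set (V G)))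
      (edge_list G) R"
  by (simp add: enc_instance_def enc_net_def enc3_def enc_list_def edge_list_def enc_node_def enc_edge_def
      comp_def case_prod_beta')

text \<open>The nodes occupy the first \<open>K\<close> slots, and \<open>NM\<close> holds their
  names, which matter only for the comparison with the input.\<close>

definition num_string :: "nat \<Rightarrow> nat \<Rightarrow> nat \<Rightarrow> nat \<Rightarrow> nat \<Rightarrow> nat \<Rightarrow> nat list" where
  "num_string N K NM x nr RU = enc3 (map (\<lambda>i. (dig N NM i, lbl N x i, 2 \<le> stt N x i, stt N x i = 3)) [0..<K])
     (concat (map (\<lambda>i. map (\<lambda>j. (dig N NM i, dig N NM j)) (filter (\<lambda>j. i < j \<and> adj N x i j) [0..<K]))
         [0..<K]))
     (map (\<lambda>r. rule_of (rule_field N RU r)) [0..<nr])"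

text \<open>What the string cannot certify: it shows two flags instead of the status, adjacency only
  for \<open>i < j\<close>, and nothing about slots from \<open>K\<close> on.\<close>

definition valid_code :: "nat \<Rightarrow> nat \<Rightarrow> nat \<Rightarrow> bool" where
  "valid_code N K x \<longleftrightarrow> (\<forall>i<N. if i < K then 1 \<le> stt N x i \<and> stt N x i \<le> 3 else stt N x i = 0) \<and>
     (\<forall>i<K. \<forall>j<K. adj N x i j \<longleftrightarrow> adj N x j i) \<and> (\<forall>i<K. \<not> adj N x i i)"

lemma num_string_sound:
  assumes wf: "wf_net G" and eq: "num_string N K NM x nr RU = enc_instance (G, R)"
    and K: "K \<le> N" and x: "valid_code N K x"
  shows "\<exists>f. Rep N x G f" "R = map (\<lambda>r. rule_of (rule_field N RU r)) [0..<nr]" "card (V G) = K"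
proof -
  define nm where "nm = dig N NM"
  define vs where "vs = sorted_list_of_set (V G)"
  have fin: "finite (V G)" and edges: "\<And>e. e \<in> E G \<Longrightarrow> card e = 2 \<and> e \<subseteq> V G"
    and sub: "Str G \<subseteq> Act G" using wf by (auto simp: wf_net_def)
  have vs: "distinct vs" "sorted vs" "set vs = V G" using fin by (auto simp: vs_def)
  from enc3_inj[OF eq[unfolded num_string_def enc_instance_enc3]]
  have 1: "map (\<lambda>i. (nm i, lbl N x i, 2 \<le> stt N x i, stt N x i = 3)) [0..<K] =
      map (\<lambda>v. (v, lab G v, v \<in> Act G, v \<in> Str G)) vs"
    and 2: "concat (map (\<lambda>i. map (\<lambda>j. (nm i, nm j)) (filter (\<lambda>j. i < j \<and> adj N x i j) [0..<K])) [0..<K])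
        = edge_list G"
    and 3: "map (\<lambda>r. rule_of (rule_field N RU r)) [0..<nr] = R"
    by (auto simp: nm_def vs_def)
  show "R = map (\<lambda>r. rule_of (rule_field N RU r)) [0..<nr]" using 3 by simp
  have len: "length vs = K" using arg_cong[OF 1, of length] by simp
  then show "card (V G) = K" using vs distinct_card by metis
  have nth: "nm i = vs ! i" "lbl N x i = lab G (nm i)" "2 \<le> stt N x i \<longleftrightarrow> nm i \<in> Act G" "stt N x i = 3 \<longleftrightarrow> nm
      i \<in> Str G"
    if "i < K" for i
    using arg_cong[OF 1, of "\<lambda>l. l ! i"] that len by auto
  have inj: "inj_on nm {..<K}" using vs(1) len nth(1) by (auto simp: inj_on_def nth_eq_iff_index_eq)
  have img: "nm ` {..<K} = V G" using nth(1) len vs(3) by (auto simp: set_conv_nth image_iff)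
  \<comment> \<open>The input lists the nodes in sorted order, so pairs of slots with
    \<open>i < j\<close> correspond to edges written with the smaller name first.\<close>
  have less: "nm i < nm j" if "i < j" "j < K" for i j
  proof -
    have "vs ! i \<le> vs ! j" using vs(2) that len by (simp add: sorted_nth_mono)
    moreover have "nm i \<noteq> nm j" using inj that by (auto simp: inj_on_def)
    ultimately show ?thesis using nth(1) that by simp
  qed
  have fs: "finite {v. {u, v} \<in> E G \<and> u < v}" for u
    by (rule finite_subset[OF _ fin]) (use edges in auto)
  have "set (edge_list G) = {(u, v). {u, v} \<in> E G \<and> u < v}"
    using fin fs edges by (fastforce simp: edge_list_def)
  then have ES: "(\<exists>i j. i < j \<and> j < K \<and> adj N x i j \<and> u = nm i \<and> v = nm j) \<longleftrightarrow> {u, v} \<in> E G \<and> u < v" for u v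
    using arg_cong[OF 2, of "\<lambda>l. (u, v) \<in> set l"] by auto
  have lt: "adj N x i j \<longleftrightarrow> {nm i, nm j} \<in> E G" if "i < j" "j < K" for i j
  proof -
    have "i' = i \<and> j' = j" if "i' < j'" "j' < K" "nm i = nm i'" "nm j = nm j'" for i' j'
      using inj that \<open>i < j\<close> \<open>j < K\<close> by (auto simp: inj_on_def)
    then show ?thesis using ES[of "nm i" "nm j"] less[OF that] that by blast
  qed
  have adj: "adj N x i j \<longleftrightarrow> {nm i, nm j} \<in> E G" if "i < K" "j < K" for i j
  proof -
    consider "i < j" | "j < i" | "i = j" by linarith
    then show ?thesis
    proof cases
      case 2
      then show ?thesis using lt[of j i] x that by (auto simp: valid_code_def insert_commute)
    next
      case 3
      then show ?thesis using x that edges[of "{nm i}"] by (auto simp: valid_code_def)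
    qed (use lt that in auto)
  qed
  define f where "f = inv_into {..<K} nm"
  have f: "f (nm i) = i" if "i < K" for i using inj that by (simp add: f_def)
  have fV: "\<exists>i<K. v = nm i \<and> f v = i" if "v \<in> V G" for v using that f img by (metis imageE lessThan_iff)
  have "Rep N x G f" unfolding Rep_def
  proof (intro conjI ballI allI impI)
    show "inj_on f (V G)" using fV by (metis inj_onI)
    show "f v < N" if "v \<in> V G" for v using fV[OF that] K by auto
    show "stt N x i = 0" if "i < N" "i \<notin> f ` V G" for i
    proof -
      have "\<not> i < K" using that(2) f[of i] img by (metis image_eqI lessThan_iff)
      then show ?thesis using x that(1) by (auto simp: valid_code_def)
    qed
  next
    fix v assume "v \<in> V G"
    then obtain i where i: "i < K" "v = nm i" "f v = i" using fV by blast
    have "if i < K then 1 \<le> stt N x i \<and> stt N x i \<le> 3 else stt N x i = 0"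
      using x i(1) K unfolding valid_code_def by (meson less_le_trans)
    then have "1 \<le> stt N x i" "stt N x i \<le> 3" using i(1) by simp_all
    then show "stt N x (f v) = stn G v" using nth(3,4)[OF i(1)] i sub by (auto simp: stn_def)
    show "lbl N x (f v) = lab G v" using nth(2)[OF i(1)] i by simp
  next
    fix u v assume "u \<in> V G" "v \<in> V G"
    then show "adj N x (f u) (f v) \<longleftrightarrow> {u, v} \<in> E G" using fV adj by metis
  qed
  then show "\<exists>f. Rep N x G f" by blast
qed

section \<open>Every instance has a numeric description of bounded size\<close>

fun rule_fields :: "rule \<Rightarrow> nat list" where
  "rule_fields (Relab a b c d) = [5, a, b, c, d]"
| "rule_fields (Move a b) = [6, a, b]"
| "rule_fields (Create as c as' s) = [if s then 7 else 8, length as, c] @ as @ as'"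

lemma rule_of_rule_fields:
  assumes "wf_rule r" "\<And>j. j < length (rule_fields r) \<Longrightarrow> g j = rule_fields r ! j"
  shows "rule_of g = r"
proof (cases r)
  case (Relab a b c d)
  then have "g 0 = 5" "g 1 = a" "g 2 = b" "g 3 = c" "g 4 = d" using assms(2)[of 0] assms(2)[of 1]
      assms(2)[of 2] assms(2)[of 3] assms(2)[of 4] by auto
  then show ?thesis using Relab by (simp add: rule_of_def)
next
  case (Move a b)
  then have "g 0 = 6" "g 1 = a" "g 2 = b" using assms(2)[of 0] assms(2)[of 1] assms(2)[of 2] by auto
  then show ?thesis using Move by (simp add: rule_of_def)
next
  case (Create as c as' s)
  then have l: "length as = length as'" using assms(1) by simp
  have g: "g 0 = (if s then 7 else 8)" "g 1 = length as" "g 2 = c"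
    using Create assms(2)[of 0] assms(2)[of 1] assms(2)[of 2] by auto
  have "g (3 + i) = as ! i" if "i < length as" for i
    using assms(2)[of "3 + i"] that Create by (simp add: nth_append)
  then have 1: "map (\<lambda>i. g (3 + i)) [0..<length as] = as" by (intro nth_equalityI) auto
  have "g (3 + length as + i) = as' ! i" if "i < length as'" for i
    using assms(2)[of "3 + length as + i"] that Create by (simp add: nth_append)
  then have 2: "map (\<lambda>i. g (3 + length as + i)) [0..<length as] = as'" using l by (intro nth_equalityI) auto
  show ?thesis using Create g 1 2 by (simp add: rule_of_def)
qed

lemma length_elem_enc_list: "x \<in> set xs \<Longrightarrow> length (f x) \<le> length (enc_list f xs)"
  by (induction xs) (auto simp: enc_list_def)

lemma length_enc_list: "(\<And>x. f x \<noteq> []) \<Longrightarrow> length xs < length (enc_list f xs)"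
proof (induction xs)
  case (Cons a xs)
  then have "0 < length (f a)" by simp
  moreover have "length xs < length (enc_list f xs)" using Cons by blast
  moreover have "length (enc_list f (a # xs)) = length (f a) + length (enc_list f xs)" by (simp add:
      enc_list_def)
  ultimately show ?case unfolding list.size by linarith
qed (simp add: enc_list_def)

lemma less_2_power_enc_nat: "length (enc_nat v) \<le> N \<Longrightarrow> v < 2 ^ N"
proof -
  assume "length (enc_nat v) \<le> N"
  then have "blen v \<le> N" by (simp add: enc_nat_def length_bits)
  then have "(2::nat) ^ blen v \<le> 2 ^ N" by (intro power_increasing) auto
  then show ?thesis using less_blen[of v] by linarith
qed

lemma rule_fields_bounds:
  assumes "wf_rule r" "length (enc_rule r) \<le> N" "4 \<le> N"
  shows "length (rule_fields r) \<le> 2 * N + 3 \<and> (\<forall>a\<in>set (rule_fields r). a < 2 ^ N)"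
proof -
  \<comment> \<open>Tags go up to 8 and take four bits.\<close>
  have N: "(8::nat) < 2 ^ N" "N < 2 ^ N" using power_increasing[OF assms(3), of "2::nat"] less_exp by auto
  have nat: "a < 2 ^ N" if "length (enc_nat a) \<le> length (enc_rule r)" for a
    using that assms(2) by (intro less_2_power_enc_nat) simp
  show ?thesis
  proof (cases r)
    case (Relab a b c d)
    then show ?thesis using nat[of a] nat[of b] nat[of c] nat[of d] N assms(3) by simp
  next
    case (Move a b)
    then show ?thesis using nat[of a] nat[of b] N assms(3) by simp
  next
    case (Create as c as' s)
    have "length as < length (enc_list enc_nat as)" by (rule length_enc_list) (simp add: hd_enc_nat)
    then have lN: "length as \<le> N" using assms(2) Create by simp
    then have "length as < 2 ^ N" using N(2) by (rule le_less_trans)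
    moreover have "a < 2 ^ N" if "a \<in> set as \<union> set as'" for a
      using that length_elem_enc_list[of a as enc_nat] length_elem_enc_list[of a as' enc_nat] Create by
          (intro nat) auto
    ultimately show ?thesis using Create nat[of c] N lN assms(1) by (auto intro: le_less_trans[OF _ less_exp])
  qed
qed

lemma num_string_complete:
  assumes wf: "wf_net G" and rules: "\<forall>r \<in> set R. wf_rule r" and N: "N = length (enc_instance (G, R))"
  shows "\<exists>K<Suc N. \<exists>NM<2 ^ blk N. \<exists>x<2 ^ blk N. \<exists>nr<Suc N. \<exists>RU<2 ^ blk N * 2 ^ blk N.
    num_string N K NM x nr RU = enc_instance (G, R) \<and> valid_code N K x"
proof -
  define vs where "vs = sorted_list_of_set (V G)"
  define K where "K = length vs"
  have fin: "finite (V G)" and edges: "\<And>e. e \<in> E G \<Longrightarrow> card e = 2 \<and> e \<subseteq> V G"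
    and sub: "Str G \<subseteq> Act G" using wf by (auto simp: wf_net_def)
  have vs: "distinct vs" "sorted vs" "set vs = V G" using fin by (auto simp: vs_def)
  let ?node = "\<lambda>v. (v, lab G v, v \<in> Act G, v \<in> Str G)"
  have N': "N = length (enc_list enc_node (map ?node vs)) + length (enc_list enc_edge (edge_list G)) +
      length (enc_list enc_rule R)"
    unfolding N enc_instance_enc3 vs_def by (simp add: enc3_def)
  have pos: "0 < length (enc_list f xs)" for f :: "'a \<Rightarrow> nat list" and xs by (simp add: enc_list_def)
  have "enc_node p \<noteq> []" for p by (simp add: enc_node_def case_prod_beta hd_enc_nat)
  then have KN: "K \<le> N" using length_enc_list[of enc_node "map ?node vs"] N' by (simp add: K_def)
  have "enc_rule r \<noteq> []" for r by (cases r) auto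
  then have nr: "length R \<le> N" using length_enc_list[of enc_rule R] N' by simp
  have node: "v < 2 ^ N \<and> lab G v < 2 ^ N" if "v \<in> V G" for v
  proof -
    have "length (enc_node (?node v)) \<le> N"
      using length_elem_enc_list[of "?node v" "map ?node vs" enc_node] that vs N' by simp
    then show ?thesis by (intro conjI less_2_power_enc_nat) (simp_all add: enc_node_def)
  qed
  have N3: "3 \<le> N" using pos[of enc_node "map ?node vs"] pos[of enc_edge "edge_list G"] pos[of enc_rule
      R] N' by linarith
  have three: "(3::nat) < 2 ^ N" using power_increasing[OF N3, of "2::nat"] by simp
  have rule: "length (rule_fields r) \<le> 2 * N + 3 \<and> (\<forall>a\<in>set (rule_fields r). a < 2 ^ N)" if "r \<in> set R" for r
  proof (rule rule_fields_bounds)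
    show "wf_rule r" using rules that by blast
    have l: "length (enc_rule r) < length (enc_list enc_rule R)"
    proof -
      obtain R1 R2 where "R = R1 @ r # R2" using split_list[OF \<open>r \<in> set R\<close>] by blast
      then show ?thesis by (simp add: enc_list_def)
    qed
    then show "length (enc_rule r) \<le> N" using N' by simp
    have "1 \<le> length (enc_rule r)" by (cases r) auto
    then show "4 \<le> N" using l pos[of enc_node "map ?node vs"] pos[of enc_edge "edge_list G"] N' by linarith
  qed
  have nth: "vs ! i \<in> V G" if "i < K" for i using that vs(3) nth_mem[of i vs] by (simp add: K_def)
  have "(if i < K then vs ! i else 0) < 2 ^ N" for i using node[OF nth] by simp
  then obtain NM where NM0: "NM < 2 ^ (N * N)" "\<forall>i<N. dig N NM i = (if i < K then vs ! i else 0)"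
    using ex_dig[of N "\<lambda>i. if i < K then vs ! i else 0" N] by blast
  have NM: "NM < 2 ^ blk N" "\<And>i. i < K \<Longrightarrow> dig N NM i = vs ! i"
    using NM0 pow_blk(2)[of N] KN by (linarith, auto)
  let ?s = "\<lambda>i. if i < K then stn G (vs ! i) else 0"
  let ?l = "\<lambda>i. if i < K then lab G (vs ! i) else 0"
  let ?a = "\<lambda>i j. {vs ! i, vs ! j} \<in> E G"
  have "?s i < 2 ^ N" for i using three by (auto simp: stn_def)
  moreover have "?l i < 2 ^ N" for i using node[OF nth] by simp
  ultimately obtain x where x: "x < 2 ^ blk N" "\<forall>i<N. stt N x i = ?s i" "\<forall>i<N. lbl N x i = ?l i"
    "\<forall>i<N. \<forall>j<N. adj N x i j \<longleftrightarrow> ?a i j"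
    using ex_code[of N ?s ?l ?a] N3 by auto
  define S where "S = 2 * N + 3"
  let ?r = "\<lambda>k. if k div S < length R \<and> k mod S < length (rule_fields (R ! (k div S))) then rule_fields
      (R ! (k div S)) ! (k mod S) else 0"
  have "?r k < 2 ^ N" for k using rule[of "R ! (k div S)"] by auto
  then obtain RU where RU0: "RU < 2 ^ (N * (N * S))" "\<forall>k<N * S. dig N RU k = ?r k" using ex_dig[of "N *
      S" ?r N] by blast
  \<comment> \<open>The rule table takes \<open>2 * N^3 + 3 * N^2\<close> bits, a block
    \<open>N^3 + 2 * N^2\<close>; hence two blocks.\<close>
  have "N * (N * S) \<le> blk N + blk N" using N3 by (simp add: blk_def S_def algebra_simps)
  then have "(2::nat) ^ (N * (N * S)) \<le> 2 ^ (blk N + blk N)" by (intro power_increasing) auto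
  then have RU1: "RU < 2 ^ blk N * 2 ^ blk N" using RU0(1) by (simp add: power_add)
  have RU: "rule_of (rule_field N RU r) = R ! r" if r: "r < length R" for r
  proof (rule rule_of_rule_fields)
    show "wf_rule (R ! r)" using rules r by simp
    fix j assume j: "j < length (rule_fields (R ! r))"
    then have jS: "j < S" using rule[of "R ! r"] r by (simp add: S_def)
    have "Suc r * S \<le> N * S" using r nr by (intro mult_right_mono) auto
    then have "r * S + j < N * S" using jS by simp
    then show "rule_field N RU r j = rule_fields (R ! r) ! j" using RU0(2) jS r j by (simp add:
        rule_field_def S_def[symmetric])
  qed
  have st: "2 \<le> stt N x i \<longleftrightarrow> vs ! i \<in> Act G" "stt N x i = 3 \<longleftrightarrow> vs ! i \<in> Str G" if "i < K" for i
    using x(2) that KN sub by (auto simp: stn_def)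
  have map_vs: "map (\<lambda>i. h (vs ! i)) [0..<K] = map h vs" for h :: "nat \<Rightarrow> 'c"
    unfolding K_def by (intro nth_equalityI) auto
  have nodes: "map (\<lambda>i. (dig N NM i, lbl N x i, 2 \<le> stt N x i, stt N x i = 3)) [0..<K] = map ?node vs"
    using NM(2) st x(3) KN unfolding map_vs[symmetric] by (intro map_cong) auto
  have lt: "vs ! i < vs ! j \<longleftrightarrow> i < j" if "i < K" "j < K" for i j
  proof (cases i j rule: linorder_cases)
    case less
    then have "vs ! i \<le> vs ! j" "vs ! i \<noteq> vs ! j" using vs that K_def by (auto simp: sorted_nth_mono
        nth_eq_iff_index_eq)
    then show ?thesis using less by simp
  next
    case greater
    then have "vs ! j \<le> vs ! i" using vs that K_def by (auto simp: sorted_nth_mono)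
    then show ?thesis using greater by simp
  qed simp
  have "sorted_list_of_set {v. {u, v} \<in> E G \<and> u < v} = filter (\<lambda>v. {u, v} \<in> E G \<and> u < v) vs" for u
  proof (rule sorted_distinct_set_unique)
    have "{v. {u, v} \<in> E G \<and> u < v} \<subseteq> V G" using edges by auto
    then show "set (sorted_list_of_set {v. {u, v} \<in> E G \<and> u < v}) = set (filter (\<lambda>v. {u, v} \<in> E G \<and> u <
        v) vs)"
      using fin vs(3) finite_subset by (subst set_sorted_list_of_set) auto
  qed (use vs in \<open>auto simp: sorted_wrt_filter\<close>)
  then have "edge_list G = concat (map (\<lambda>u. map (\<lambda>v. (u, v)) (filter (\<lambda>v. {u, v} \<in> E G \<and> u < v) vs)) vs)"
    by (simp add: edge_list_def vs_def)
  also have "\<dots> = concat (map (\<lambda>i. map (\<lambda>v. (vs ! i, v)) (filter (\<lambda>v. {vs ! i, v} \<in> E G \<and> vs ! i < v) vs))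
      [0..<K])"
    using map_vs[of "\<lambda>u. map (\<lambda>v. (u, v)) (filter (\<lambda>v. {u, v} \<in> E G \<and> u < v) vs)"] by simp
  also have "\<dots> = concat (map (\<lambda>i. map (\<lambda>j. (dig N NM i, dig N NM j)) (filter (\<lambda>j. i < j \<and> adj N x i j)
      [0..<K])) [0..<K])"
  proof (rule arg_cong[where f = concat], rule map_cong)
    fix i assume i: "i \<in> set [0..<K]"
    let ?P = "\<lambda>v. {vs ! i, v} \<in> E G \<and> vs ! i < v"
    have "filter ?P vs = filter ?P (map (\<lambda>j. vs ! j) [0..<K])" using map_vs[of "\<lambda>v. v"] by simp
    also have "\<dots> = map (\<lambda>j. vs ! j) (filter (\<lambda>j. ?P (vs ! j)) [0..<K])" by (simp add: filter_map comp_def)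
    also have "filter (\<lambda>j. ?P (vs ! j)) [0..<K] = filter (\<lambda>j. i < j \<and> adj N x i j) [0..<K]"
      using lt x(4) i KN by (intro filter_cong) auto
    finally show "map (\<lambda>v. (vs ! i, v)) (filter ?P vs) =
       map (\<lambda>j. (dig N NM i, dig N NM j)) (filter (\<lambda>j. i < j \<and> adj N x i j) [0..<K])"
      using NM(2) i by simp
  qed simp
  finally have es: "concat (map (\<lambda>i. map (\<lambda>j. (dig N NM i, dig N NM j)) (filter (\<lambda>j. i < j \<and> adj N x i j)
      [0..<K])) [0..<K]) = edge_list G"
    by simp
  have rs: "map (\<lambda>r. rule_of (rule_field N RU r)) [0..<length R] = R" using RU by (intro nth_equalityI) auto
  have "num_string N K NM x (length R) RU = enc_instance (G, R)"
    unfolding num_string_def enc_instance_enc3 nodes es rs by (simp add: vs_def)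
  moreover have "valid_code N K x" unfolding valid_code_def
  proof (intro conjI allI impI)
    fix i assume "i < N"
    then show "if i < K then 1 \<le> stt N x i \<and> stt N x i \<le> 3 else stt N x i = 0" using x(2) by (simp add:
        stn_def)
  next
    fix i j assume "i < K" "j < K"
    then show "adj N x i j \<longleftrightarrow> adj N x j i" using x(4) KN by (simp add: insert_commute)
  next
    fix i assume "i < K"
    then show "\<not> adj N x i i" using x(4) KN edges[of "{vs ! i}"] by auto
  qed
  ultimately show ?thesis using KN nr NM(1) x(1) RU1 by (meson le_imp_less_Suc)
qed

section \<open>The decision procedure\<close>

text \<open>The blocks of \<open>T\<close>, of \<open>blk N\<close> bits each, list a play from the top: block \<open>2 * k + 2\<close> is the
  network with \<open>k + 1\<close> rounds to go, and blocks \<open>2 * k + 1\<close> and \<open>2 * k\<close> are the results of the next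
  moves of Destructor and Constructor. Whoever makes the first illegal move loses.\<close>

definition play_val :: "nat \<Rightarrow> nat \<Rightarrow> nat \<Rightarrow> nat \<Rightarrow> nat \<Rightarrow> nat \<Rightarrow> nat" where
  "play_val N M nr RU T k = rec_nat 1 (\<lambda>k a.
     if num_del N (dig (blk N) T (2 * k + 2)) (dig (blk N) T (2 * k + 1)) then
       if num_conn N M (dig (blk N) T (2 * k + 1)) \<and>
          num_cmove N M nr RU (dig (blk N) T (2 * k + 1)) (dig (blk N) T (2 * k)) then a else 0
     else 1) k"

lemma play_val_le: "play_val N M nr RU T k \<le> 1"
  by (induction k) (auto simp: play_val_def)

text \<open>All leaves below node \<open>q\<close> at height \<open>B * m\<close> agree on the
  blocks from \<open>m\<close> upward, which spell out \<open>q\<close>.\<close>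

lemma dig_block:
  assumes "q * 2 ^ (B * m) \<le> i" "i < Suc q * 2 ^ (B * m)"
  shows "dig B i (m + d) = q div 2 ^ (B * d) mod 2 ^ B"
proof -
  have "i div 2 ^ (B * m) = q" using assms by (intro div_nat_eqI) (simp_all add: mult.commute)
  then have "i div 2 ^ (B * (m + d)) = q div 2 ^ (B * d)"
    by (simp add: distrib_left power_add div_mult2_eq)
  then show ?thesis by (simp add: dig_def)
qed

text \<open>Odd blocks are Destructor's and universal, even ones Constructor's and existential. The
  node number \<open>p\<close> contains all earlier blocks, but only the last of them, the current
  network, matters.\<close>

lemma tree_val_play_val:
  assumes "0 < blk N"
  shows "tree_val (\<lambda>j. odd (j div blk N)) (\<lambda>T. play_val N (2 ^ blk N) nr RU T k = 1) (blk N * (2 * k)) p \<longleftrightarrow>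
    num_safe N (2 ^ blk N) nr RU k (p mod 2 ^ blk N)"
proof (induction k arbitrary: p)
  case 0
  then show ?case by (simp add: play_val_def)
next
  case (Suc k)
  define B M where "B = blk N" and "M = (2::nat) ^ B"
  have M: "0 < M" by (simp add: M_def)
  let ?U = "\<lambda>j. odd (j div B)"
  let ?lf = "\<lambda>k T. play_val N M nr RU T k = 1"
  let ?h = "B * (2 * k)"
  have U1: "?U j = True" if "?h + B \<le> j" "j < ?h + B + B" for j
  proof -
    have "j div B = 2 * k + 1" using that by (intro div_nat_eqI) (simp_all add: algebra_simps)
    then show ?thesis by simp
  qed
  have U0: "?U j = False" if "?h \<le> j" "j < ?h + B" for j
  proof -
    have "j div B = 2 * k" using that by (intro div_nat_eqI) (simp_all add: algebra_simps)
    then show ?thesis by simp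
  qed
  have leaf: "tree_val ?U (?lf (Suc k)) ?h ((p * M + y) * M + z) \<longleftrightarrow>
      (num_del N (p mod M) y \<longrightarrow> num_conn N M y \<and> num_cmove N M nr RU y z \<and> num_safe N M nr RU k z)"
    if yz: "y < M" "z < M" for y z
  proof -
    define q where "q = (p * M + y) * M + z"
    have q: "q mod M = z" "q div M = p * M + y" "(p * M + y) mod M = y" "(p * M + y) div M = p"
      using yz by (auto simp: q_def)
    \<comment> \<open>The tests of the current round are constant below \<open>q\<close>; only the
      remainder of the play varies with the leaf.\<close>
    have lf: "?lf (Suc k) i \<longleftrightarrow> (if num_del N (p mod M) y then if num_conn N M y \<and> num_cmove N M nr RU y z
        then ?lf k i else False else True)"
      if "q * 2 ^ ?h \<le> i" "i < Suc q * 2 ^ ?h" for i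
    proof -
      have "dig B i (2 * k) = z" using dig_block[of q B "2 * k" i 0] that q by (simp add: M_def)
      moreover have "dig B i (2 * k + 1) = y" using dig_block[of q B "2 * k" i 1] that q by (simp add: M_def)
      moreover have "dig B i (2 * k + 2) = p mod M"
        using dig_block[of q B "2 * k" i 2] that q
        by (simp add: M_def mult_2_right power_add div_mult2_eq)
      ultimately show ?thesis by (simp add: play_val_def B_def)
    qed
    have IH: "tree_val ?U (?lf k) ?h q \<longleftrightarrow> num_safe N M nr RU k z" using Suc.IH[of q] q(1) by (simp add:
        B_def M_def)
    have "tree_val ?U (?lf (Suc k)) ?h q \<longleftrightarrow> tree_val ?U (\<lambda>i. if num_del N (p mod M) y then if num_conn N M
        y \<and> num_cmove N M nr RU y z then ?lf k i else False else True) ?h q"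
      by (rule tree_val_cong) (rule lf)
    also have "\<dots> \<longleftrightarrow> (num_del N (p mod M) y \<longrightarrow> num_conn N M y \<and> num_cmove N M nr RU y z \<and> num_safe N M nr RU
        k z)"
      using IH by (cases "num_del N (p mod M) y"; cases "num_conn N M y \<and> num_cmove N M nr RU y z") (auto
          simp: tree_val_const)
    finally show ?thesis by (simp add: q_def)
  qed
  have "B * (2 * Suc k) = ?h + B + B" by (simp add: algebra_simps)
  then have "tree_val ?U (?lf (Suc k)) (B * (2 * Suc k)) p \<longleftrightarrow> (\<forall>y<M. tree_val ?U (?lf (Suc k)) (?h + B) (p
      * M + y))"
    using tree_val_block[of "?h + B" B ?U True "?lf (Suc k)" p, OF U1] by (simp add: M_def)
  also have "\<dots> \<longleftrightarrow> (\<forall>y<M. \<exists>z<M. tree_val ?U (?lf (Suc k)) ?h ((p * M + y) * M + z))"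
    using tree_val_block[of ?h B ?U False "?lf (Suc k)", OF U0] by (simp add: M_def)
  also have "\<dots> \<longleftrightarrow> (\<forall>y<M. \<exists>z<M. num_del N (p mod M) y \<longrightarrow> num_conn N M y \<and> num_cmove N M nr RU y z \<and> num_safe
      N M nr RU k z)"
    using leaf by meson
  also have "\<dots> \<longleftrightarrow> num_safe N M nr RU (Suc k) (p mod M)" unfolding num_safe.simps using M by blast
  finally show ?case by (simp add: B_def M_def)
qed

section \<open>The game predicates are computable in polynomial space\<close>

lemmas pc_tls = pc_tl pc_tl[OF pc_tl] pc_tl[OF pc_tl[OF pc_tl]] pc_tl[OF pc_tl[OF pc_tl[OF pc_tl]]]
  pc_tl[OF pc_tl[OF pc_tl[OF pc_tl[OF pc_tl]]]] pc_tl[OF pc_tl[OF pc_tl[OF pc_tl[OF pc_tl[OF pc_tl]]]]]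
lemmas pc_hds = pc_hd pc_tls[OF pc_hd]
lemmas pc_arith = pc_const pc_Suc pc_add pc_mult pc_diff pc_if pc_mod pc_dig pc_blen
  pcb_le pcb_less pcb_eq pcb_iff pcb_conj pcb_disj pcb_not pcb_imp pcb_if pcb_ex pcb_all pcb_bit

lemma pc_stt: "pc n N \<Longrightarrow> pc n X \<Longrightarrow> pc n I \<Longrightarrow> pc n (\<lambda>xs. stt (N xs) (X xs) (I xs))"
  unfolding stt_def by (rule pc_dig)

lemma pc_lbl: "pc n N \<Longrightarrow> pc n X \<Longrightarrow> pc n I \<Longrightarrow> pc n (\<lambda>xs. lbl (N xs) (X xs) (I xs))"
  unfolding lbl_def by (intro pc_dig pc_add)

lemma pcb_adj: "pc n N \<Longrightarrow> pc n X \<Longrightarrow> pc n I \<Longrightarrow> pc n J \<Longrightarrow> pcb n (\<lambda>xs. adj (N xs) (X xs) (I xs) (J xs))"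
  unfolding adj_def by (intro pcb_not pcb_eq pc_dig pc_add pc_mult pc_const)

lemma pc_blk: "pc n N \<Longrightarrow> pc n (\<lambda>xs. blk (N xs))"
  unfolding blk_def by (intro pc_add pc_mult pc_const)

lemmas pc_net = pc_arith pc_stt pc_lbl pcb_adj pc_blk pc_hds

lemma pcb_num_del:
  assumes "pc n N" "pc n X" "pc n Y" shows "pcb n (\<lambda>xs. num_del (N xs) (X xs) (Y xs))"
  unfolding num_del_def by (intro pc_net assms assms[THEN pc_tls(1)] assms[THEN pc_tls(2)] assms[THEN
      pc_tls(3)])

lemma pcb_num_conn:
  assumes "pc n N" "pc n M" "pc n Y" shows "pcb n (\<lambda>xs. num_conn (N xs) (M xs) (Y xs))"
  unfolding num_conn_def by (intro pc_net assms assms[THEN pc_tls(1)] assms[THEN pc_tls(2)] assms[THEN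
      pc_tls(3)])

lemma pcb_num_relab:
  assumes "pc n N" "pc n M" "pc n A" "pc n B" "pc n C" "pc n D" "pc n X" "pc n Y"
  shows "pcb n (\<lambda>xs. num_relab (N xs) (M xs) (A xs) (B xs) (C xs) (D xs) (X xs) (Y xs))"
  unfolding num_relab_def
  by (intro pc_net assms assms[THEN pc_tls(1)] assms[THEN pc_tls(2)] assms[THEN pc_tls(3)]
    assms[THEN pc_tls(4)] assms[THEN pc_tls(5)])

lemma pcb_num_move:
  assumes "pc n N" "pc n A" "pc n B" "pc n X" "pc n Y"
  shows "pcb n (\<lambda>xs. num_move (N xs) (A xs) (B xs) (X xs) (Y xs))"
  unfolding num_move_def
  by (intro pc_net assms assms[THEN pc_tls(1)] assms[THEN pc_tls(2)] assms[THEN pc_tls(3)] assms[THEN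
      pc_tls(4)])

lemma pc_rule_field: "pc n N \<Longrightarrow> pc n RU \<Longrightarrow> pc n R \<Longrightarrow> pc n J \<Longrightarrow> pc n (\<lambda>xs. rule_field (N xs) (RU xs) (R xs) (J
    xs))"
  unfolding rule_field_def by (intro pc_dig pc_add pc_mult pc_const)

lemma pcb_num_rule:
  assumes "pc n N" "pc n M" "pc n RU" "pc n R" "pc n X" "pc n Y"
  shows "pcb n (\<lambda>xs. num_rule (N xs) (M xs) (rule_field (N xs) (RU xs) (R xs)) (X xs) (Y xs))"
  unfolding num_rule_def num_create_def
  by (intro pc_net pc_rule_field pcb_num_relab pcb_num_move assms assms[THEN pc_tls(1)] assms[THEN
      pc_tls(2)] assms[THEN pc_tls(3)]
    assms[THEN pc_tls(4)] assms[THEN pc_tls(5)])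

lemma pcb_num_cmove:
  assumes "pc n N" "pc n M" "pc n NR" "pc n RU" "pc n X" "pc n Y"
  shows "pcb n (\<lambda>xs. num_cmove (N xs) (M xs) (NR xs) (RU xs) (X xs) (Y xs))"
  unfolding num_cmove_def
  by (intro pcb_num_rule pcb_disj pcb_eq pcb_ex pc_hd assms assms[THEN pc_tls(1)])

lemma pc_play_val:
  assumes "pc n N" "pc n M" "pc n NR" "pc n RU" "pc n T" "pc n K"
  shows "pc n (\<lambda>xs. play_val (N xs) (M xs) (NR xs) (RU xs) (T xs) (K xs))"
  unfolding play_val_def
proof (rule pc_rec[where H = "\<lambda>_. 1"])
  show "pc (Suc (Suc n)) (\<lambda>ys. if num_del (N (tl (tl ys))) (dig (blk (N (tl (tl ys)))) (T (tl (tl ys)))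
      (2 * hd ys + 2)) (dig (blk (N (tl (tl ys)))) (T (tl (tl ys))) (2 * hd ys + 1)) then
       if num_conn (N (tl (tl ys))) (M (tl (tl ys))) (dig (blk (N (tl (tl ys)))) (T (tl (tl ys))) (2 * hd
           ys + 1)) \<and>
          num_cmove (N (tl (tl ys))) (M (tl (tl ys))) (NR (tl (tl ys))) (RU (tl (tl ys))) (dig (blk (N
              (tl (tl ys)))) (T (tl (tl ys))) (2 * hd ys + 1)) (dig (blk (N (tl (tl ys)))) (T (tl (tl
              ys))) (2 * hd ys)) then hd (tl ys) else 0
     else 1)"
    by (intro pc_if pcb_num_del pcb_conj pcb_num_conn pcb_num_cmove pc_dig pc_blk pc_add pc_mult pc_const
        pc_hds assms[THEN pc_tls(2)])
qed (use assms play_val_le[unfolded play_val_def] in \<open>auto intro: pc_const pbd_const\<close>)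

text \<open>Matching returns the input position reached, or \<open>N + 1\<close> forever after a mismatch.\<close>

definition match_char :: "nat \<Rightarrow> nat \<Rightarrow> nat \<Rightarrow> nat \<Rightarrow> nat" where
  "match_char N W p c = (if p < N \<and> dig 4 W p = c then Suc p else Suc N)"

section \<open>Comparing a generated string with the input\<close>

lemma foldl_match_char_stuck: "foldl (match_char N W) (Suc N) s = Suc N"
  by (induction s) (auto simp: match_char_def)

text \<open>A mismatch and a string running past the input both lead to the absorbing position, so
  the end of the input is reached exactly on equality.\<close>

lemma foldl_match_char_iff:
  assumes "\<And>p. p < length w \<Longrightarrow> dig 4 W p = w ! p" "p \<le> length w"
  shows "foldl (match_char (length w) W) p s = length w \<longleftrightarrow> s = drop p w"
  using assms(2)
proof (induction s arbitrary: p)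
  case Nil
  then show ?case by auto
next
  case (Cons c s)
  show ?case
  proof (cases "p < length w \<and> w ! p = c")
    case True
    then have "foldl (match_char (length w) W) p (c # s) = foldl (match_char (length w) W) (Suc p) s"
      using assms(1) by (simp add: match_char_def)
    then show ?thesis using Cons.IH[of "Suc p"] True by (auto simp: Cons_nth_drop_Suc[symmetric])
  next
    case False
    then have "foldl (match_char (length w) W) p (c # s) = Suc (length w)"
      using assms(1) by (auto simp: match_char_def foldl_match_char_stuck)
    moreover have "c # s \<noteq> drop p w"
      using False by (metis drop_eq_Nil2 linorder_not_le list.distinct(1) list.sel(1) hd_drop_conv_nth)
    ultimately show ?thesis by simp
  qed
qed

lemma foldl_match_char_le: "foldl (match_char N W) p s \<le> p + Suc N"
  by (cases s rule: rev_cases) (auto simp: match_char_def)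

text \<open>Turns matching of a concatenation into primitive recursion whose accumulator is the
  input position, so the string is never stored.\<close>

lemma foldl_concat_upt: "foldl f p (concat (map g [0..<K])) = rec_nat p (\<lambda>i q. foldl f q (g i)) K"
  by (induction K) auto

lemma concat_map_filter: "concat (map h (map g (filter P xs))) = concat (map (\<lambda>j. if P j then h (g j)
    else []) xs)"
  by (induction xs) auto

lemma concat_map_concat:
  "concat (map h (concat (map g xs))) = concat (map (\<lambda>i. concat (map h (g i))) xs)"
  by (induction xs) auto

lemma pc_match_char: "pc n N \<Longrightarrow> pc n W \<Longrightarrow> pc n P \<Longrightarrow> pc n C \<Longrightarrow> pc n (\<lambda>xs. match_char (N xs) (W xs) (P xs) (C xs))"
  unfolding match_char_def by (intro pc_if pcb_conj pcb_less pcb_eq pc_dig pc_const pc_Suc)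

lemma pc_match_concat:
  assumes "pc n N" "pc n P" "pc n K"
    and "pc (Suc (Suc n)) (\<lambda>ys. foldl (match_char (N (tl (tl ys))) (W (tl (tl ys)))) (hd (tl ys)) (g (hd
        ys) (tl (tl ys))))"
  shows "pc n (\<lambda>xs. foldl (match_char (N xs) (W xs)) (P xs) (concat (map (\<lambda>i. g i xs) [0..<K xs])))"
  unfolding foldl_concat_upt
proof (rule pc_rec[where H = "\<lambda>xs. P xs + Suc (N xs)"])
  show "pbd n (\<lambda>xs. P xs + Suc (N xs))" by (intro pc_pbd pc_add pc_Suc assms)
  show "rec_nat (P xs) (\<lambda>i q. foldl (match_char (N xs) (W xs)) q (g i xs)) j \<le> P xs + Suc (N xs)" for xs j
    unfolding foldl_concat_upt[symmetric] by (rule foldl_match_char_le)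
qed (use assms in auto)

lemma pc_match_nat:
  assumes "pc n N" "pc n W" "pc n P" "pc n Y"
  shows "pc n (\<lambda>xs. foldl (match_char (N xs) (W xs)) (P xs) (enc_nat (Y xs)))"
proof -
  have enc: "enc_nat v = concat (map (\<lambda>i. [of_bool (bit v (blen v - 1 - i)) + 1]) [0..<blen v]) @ [3]" for v
    unfolding enc_nat_def by (subst bits_eq) (simp only: concat_map_singleton)
  show ?thesis unfolding enc foldl_append foldl.simps
    by (intro pc_match_char pc_match_concat assms pc_const pc_blen, unfold foldl.simps)
      (intro pc_match_char pc_const pc_blen pc_add pcb_bit pc_diff pc_hds assms[THEN pc_tls(2)])
qed

lemma pc_match_nats:
  assumes "pc n N" "pc n W" "pc n P" "pc n K" "pc (Suc (Suc n)) (\<lambda>ys. h (hd ys) (tl (tl ys)))"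
  shows "pc n (\<lambda>xs. foldl (match_char (N xs) (W xs)) (P xs) (enc_list enc_nat (map (\<lambda>i. h i xs) [0..<K xs])))"
  unfolding enc_list_def map_map comp_def foldl_append foldl.simps
  by (intro pc_match_char pc_match_concat pc_match_nat assms(1-4) pc_const pc_hds assms(5)
      assms(1-4)[THEN pc_tls(2)])

lemma pc_match_rule:
  assumes "pc n N" "pc n W" "pc n P" "pc n RU" "pc n R"
  shows "pc n (\<lambda>xs. foldl (match_char (N xs) (W xs)) (P xs) (enc_rule (rule_of (rule_field (N xs) (RU xs)
      (R xs)))))"
proof -
  have enc: "foldl f p (enc_rule (rule_of g)) = (if g 0 = 5 then
      foldl f (foldl f (foldl f (foldl f (f p 5) (enc_nat (g 1))) (enc_nat (g 2))) (enc_nat (g 3)))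
          (enc_nat (g 4))
    else if g 0 = 6 then foldl f (foldl f (f p 6) (enc_nat (g 1))) (enc_nat (g 2))
    else foldl f (foldl f (foldl f (f p (if g 0 = 7 then 7 else 8)) (enc_list enc_nat (map (\<lambda>i. g (3 +
        i)) [0..<g 1])))
      (enc_nat (g 2))) (enc_list enc_nat (map (\<lambda>i. g (3 + g 1 + i)) [0..<g 1])))" for f and p :: nat and g
    by (simp add: rule_of_def)
  show ?thesis unfolding enc
    by (intro pc_if pcb_eq pc_match_nat pc_match_nats pc_match_char pc_rule_field pc_const pc_add pc_hds
        assms assms[THEN pc_tls(2)])
qed

lemma pc_match_num_string:
  assumes "pc n N" "pc n W" "pc n K" "pc n NM" "pc n X" "pc n NR" "pc n RU"
  shows "pc n (\<lambda>xs. foldl (match_char (N xs) (W xs)) 0 (num_string (N xs) (K xs) (NM xs) (X xs) (NR xs)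
      (RU xs)))"
proof -
  have node: "foldl f p (enc_node (a, b, c, d)) = f (f (foldl f (foldl f p (enc_nat a)) (enc_nat b)) (if
      c then 1 else 2)) (if d then 1 else 2)"
    for f and p :: nat and a b c d by (simp add: enc_node_def)
  have edge: "foldl f p (if Q then enc_edge (a, b) else []) = (if Q then foldl f (foldl f p (enc_nat a))
      (enc_nat b) else p)"
    for f and p :: nat and Q a b by (simp add: enc_edge_def)
  have edges: "enc_list enc_edge (concat (map (\<lambda>i. map (\<lambda>j. (dig N NM i, dig N NM j)) (filter (\<lambda>j. i < j
      \<and> adj N x i j) [0..<K])) [0..<K])) =
     concat (map (\<lambda>i. concat (map (\<lambda>j. if i < j \<and> adj N x i j then enc_edge (dig N NM i, dig N NM j) else
         []) [0..<K])) [0..<K]) @ [4]"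
    for N NM x K
    unfolding enc_list_def concat_map_concat concat_map_filter ..
  have 1: "pc n (\<lambda>xs. foldl (match_char (N xs) (W xs)) 0 (enc_list enc_node (map (\<lambda>i. (dig (N xs) (NM xs)
      i, lbl (N xs) (X xs) i,
      2 \<le> stt (N xs) (X xs) i, stt (N xs) (X xs) i = 3)) [0..<K xs])))"
    unfolding enc_list_def map_map comp_def foldl_append foldl.simps
    by (intro pc_match_char pc_match_concat assms pc_const, unfold node)
      (intro pc_match_char pc_match_nat pc_net assms assms[THEN pc_tls(2)])
  have 2: "pc n (\<lambda>xs. foldl (match_char (N xs) (W xs)) (P xs) (enc_list enc_edge (concat (map (\<lambda>i. map
      (\<lambda>j. (dig (N xs) (NM xs) i, dig (N xs) (NM xs) j))
      (filter (\<lambda>j. i < j \<and> adj (N xs) (X xs) i j) [0..<K xs])) [0..<K xs]))))" if "pc n P" for P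
    unfolding edges foldl_append foldl.simps
    by (intro pc_match_char pc_match_concat assms pc_const that assms[THEN pc_tls(2)] pc_hds, unfold edge)
      (intro pc_match_nat pc_net assms[THEN pc_tls(2)] assms[THEN pc_tls(4)])
  have 3: "pc n (\<lambda>xs. foldl (match_char (N xs) (W xs)) (P xs) (enc_list enc_rule (map (\<lambda>r. rule_of
      (rule_field (N xs) (RU xs) r)) [0..<NR xs])))" if "pc n P" for P
    unfolding enc_list_def map_map comp_def foldl_append foldl.simps
    by (intro pc_match_char pc_match_concat assms pc_const that pc_match_rule pc_hds assms[THEN pc_tls(2)])
  show ?thesis unfolding num_string_def enc3_def foldl_append by (intro 3 2 1)
qed

definition track_char :: "nat list \<Rightarrow> nat \<Rightarrow> nat" where
  "track_char xs p = of_bool (bit (xs ! 0) p) + 2 * of_bool (bit (xs ! 1) p) + 4 * of_bool (bit (xs ! 2) p) +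
     8 * of_bool (bit (xs ! 3) p)"

definition track_len :: "nat list \<Rightarrow> nat" where
  "track_len xs = blen (max (max (xs ! 0) (xs ! 1)) (max (xs ! 2) (xs ! 3)))"

text \<open>The initial network \<open>x\<close> is placed in block \<open>2 * N\<close>, above the
  \<open>2 * N\<close> blocks for the moves of \<open>N\<close> rounds.\<close>

definition game_val :: "nat \<Rightarrow> nat \<Rightarrow> nat \<Rightarrow> nat \<Rightarrow> bool" where
  "game_val N nr RU x \<longleftrightarrow> tree_val (\<lambda>j. odd (j div blk N))
     (\<lambda>t. play_val N (2 ^ blk N) nr RU (x * 2 ^ (blk N * (2 * N)) + t) N = 1) (blk N * (2 * N)) 0"

text \<open>\<open>W\<close> is the input repacked as one array of 4-bit symbols. It is determined
  by the four registers; quantifying over it replaces its construction.\<close>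

definition decide :: "nat list \<Rightarrow> bool" where
  "decide xs \<longleftrightarrow> (\<exists>W<2 ^ (4 * track_len xs). (\<forall>p<track_len xs. dig 4 W p = track_char xs p) \<and>
     (\<exists>K<Suc (track_len xs). \<exists>NM<2 ^ blk (track_len xs). \<exists>x<2 ^ blk (track_len xs). \<exists>nr<Suc (track_len xs).
        \<exists>RU<2 ^ blk (track_len xs) * 2 ^ blk (track_len xs).
          foldl (match_char (track_len xs) W) 0 (num_string (track_len xs) K NM x nr RU) = track_len xs \<and>
          valid_code (track_len xs) K x \<and> game_val (track_len xs) nr RU x))"

section \<open>Computability and correctness of the decision predicate\<close>

lemma small_tl: "small n F \<Longrightarrow> small (Suc n) (\<lambda>ys. F (tl ys))"
  unfolding small_def
proof (elim exE, intro exI allI impI)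
  fix k and ys :: "nat list" and L
  assume *: "\<forall>xs L. length xs = n \<longrightarrow> (\<forall>x\<in>set xs. x < 2 ^ L) \<longrightarrow> F xs \<le> (L + 2) ^ k" "length ys = Suc n"
      "\<forall>x\<in>set ys. x < 2 ^ L"
  then have "set (tl ys) \<subseteq> set ys" "length (tl ys) = n" by (cases ys; auto)+
  then show "F (tl ys) \<le> (L + 2) ^ k" using * by blast
qed

lemmas small_tls = small_tl[OF small_tl[OF small_tl[OF small_tl[OF small_tl[OF small_tl]]]]]

lemma small_track_len: "small 4 track_len"
  unfolding track_len_def by (intro small_blen pc_pbd pc_max pc_nth) auto

lemma pc_track_len: "pc 4 track_len"
  unfolding track_len_def by (intro pc_blen pc_max pc_nth) auto

lemma pcb_valid_code:
  assumes "pc n N" "pc n K" "pc n X" shows "pcb n (\<lambda>xs. valid_code (N xs) (K xs) (X xs))"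
  unfolding valid_code_def by (intro pc_net assms assms[THEN pc_tls(1)] assms[THEN pc_tls(2)])

lemma small_blk: "small n N \<Longrightarrow> small n (\<lambda>xs. blk (N xs))"
  unfolding blk_def by (intro small_mult small_add small_const)

lemma pcb_game_val:
  assumes "pc n N" "small n N" "pc n NR" "pc n RU" "pc n X"
  shows "pcb n (\<lambda>xs. game_val (N xs) (NR xs) (RU xs) (X xs))"
proof -
  have B: "pc n (\<lambda>xs. blk (N xs))" by (intro pc_blk assms)
  have D: "pc n (\<lambda>xs. blk (N xs) * (2 * N xs))" "small n (\<lambda>xs. blk (N xs) * (2 * N xs))"
    by (intro pc_mult pc_const B assms small_mult small_const small_blk)+
  have M: "pc n (\<lambda>xs. 2 ^ blk (N xs))" by (intro pc_2_power B small_blk assms)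
  note E = pc_2_power[OF D]
  show ?thesis unfolding game_val_def
    by (intro pcb_tree_val D pcb_odd pc_div pc_hd B[THEN pc_tl] pcb_eq pc_const pc_play_val
        assms(1,3,4)[THEN pc_tl] M[THEN pc_tl]
      pc_add pc_mult assms(5)[THEN pc_tl] E[THEN pc_tl])
qed

lemma pcb_decide: "pcb 4 decide"
proof -
  note N = pc_track_len
  have M: "pc 4 (\<lambda>xs. 2 ^ blk (track_len xs))" by (intro pc_2_power pc_blk N small_blk small_track_len)
  have W: "pc 4 (\<lambda>xs. 2 ^ (4 * track_len xs))" by (intro pc_2_power pc_mult pc_const N small_mult
      small_const small_track_len)
  have ch: "pc 6 (\<lambda>ys. track_char (tl (tl ys)) (hd ys))"
  proof -
    have x: "pc 6 (\<lambda>ys. tl (tl ys) ! i)" if "i < 4" for i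
      using pc_tls(2)[OF pc_nth[OF that]] by simp
    have h: "pc 6 (\<lambda>ys. hd ys)" using pc_hd[of 5] by simp
    show ?thesis unfolding track_char_def by (intro pc_add pc_mult pc_const pcb_bit h x) auto
  qed
  have e: "6 = Suc (Suc 4)" by simp
  have game: "pcb (Suc (Suc (Suc (Suc (Suc (Suc 4)))))) (\<lambda>ys. game_val (track_len (tl (tl (tl (tl (tl (tl
      ys))))))) (hd (tl ys)) (hd ys) (hd (tl (tl ys))))"
    by (intro pcb_game_val N[THEN pc_tls(6)] small_tls small_track_len pc_hds)
  show ?thesis unfolding decide_def
    by (intro pcb_ex pcb_all pcb_conj pcb_eq pc_dig pc_const pc_hds pc_match_num_string pcb_valid_code
        pc_Suc pc_mult
      W M N ch[unfolded e] game N[THEN pc_tls(1)] N[THEN pc_tls(2)] N[THEN pc_tls(3)] N[THEN pc_tls(4)]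
          N[THEN pc_tls(5)] N[THEN pc_tls(6)]
      M[THEN pc_tls(1)] M[THEN pc_tls(2)] M[THEN pc_tls(3)] M[THEN pc_tls(4)] M[THEN pc_tls(5)])
qed

lemma nat_less_16_bits: "(c::nat) < 16 \<Longrightarrow> c = of_bool (bit c 0) + 2 * of_bool (bit c 1) + 4 * of_bool (bit
    c 2) + 8 * of_bool (bit c 3)"
  and nat_less_16_high: "(c::nat) < 16 \<Longrightarrow> 4 \<le> r \<Longrightarrow> \<not> bit c r"
proof -
  assume c: "c < 16"
  have div: "c div 4 = c div 2 div 2" "c div 8 = c div 4 div 2" by (simp_all flip: div_mult2_eq)
  have "c div 8 mod 2 = c div 8" using c by (intro mod_less) simp
  then have "c = c mod 2 + 2 * (c div 2 mod 2) + 4 * (c div 4 mod 2) + 8 * (c div 8 mod 2)"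
    using div_mult_mod_eq[of c 2] div_mult_mod_eq[of "c div 2" 2] div_mult_mod_eq[of "c div 4" 2] div by
        linarith
  then show "c = of_bool (bit c 0) + 2 * of_bool (bit c 1) + 4 * of_bool (bit c 2) + 8 * of_bool (bit c 3)"
    unfolding mod_2_eq_odd bit_iff_odd by simp
  assume "4 \<le> r"
  then have "(16::nat) \<le> 2 ^ r" using power_increasing[of 4 r "2::nat"] by simp
  then show "\<not> bit c r" using bit_nat_imp_le[of c r] c by auto
qed

text \<open>The last symbol is nonzero, so one of the four tracks has a one there, and the longest
  track has the length of the input.\<close>

lemma track_init:
  assumes "set w \<subseteq> {1..<9}"
  shows "p < length w \<Longrightarrow> track_char (map (init_regs w) [0, 1, 2, 3]) p = w ! p"
    and "track_len (map (init_regs w) [0, 1, 2, 3]) = length w"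
proof -
  have w: "w ! p \<noteq> 0 \<and> w ! p < 16" if "p < length w" for p using assms nth_mem[OF that] by fastforce
  show char: "track_char (map (init_regs w) [0, 1, 2, 3]) p = w ! p" if "p < length w" for p
    using nat_less_16_bits[of "w ! p"] w[OF that] that by (simp add: track_char_def bit_init_regs)
  define m where "m = max (max (init_regs w 0) (init_regs w 1)) (max (init_regs w 2) (init_regs w 3))"
  have "m < 2 ^ length w" using init_regs_less by (simp add: m_def)
  then have up: "blen m \<le> length w" using le_blen_iff[of "length w" m] by simp
  have "length w \<le> blen m"
  proof (cases w)
    case (Cons a v)
    let ?p = "length w - 1"
    have p: "?p < length w" using Cons by simp
    have "\<exists>r<4. bit (w ! ?p) r"
    proof (rule ccontr)
      assume "\<not> (\<exists>r<4. bit (w ! ?p) r)"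
      then have "w ! ?p = 0" using nat_less_16_bits[of "w ! ?p"] w[OF p] by simp
      then show False using w[OF p] by simp
    qed
    then obtain r where r: "r < 4" "bit (w ! ?p) r" by blast
    then have "2 ^ ?p \<le> init_regs w r" using bit_init_regs[of w r ?p] p bit_nat_imp_le by blast
    moreover have "r = 0 \<or> r = 1 \<or> r = 2 \<or> r = 3" using r(1) by linarith
    ultimately have "2 ^ ?p \<le> m" by (auto simp: m_def)
    then show ?thesis using le_blen_iff[of ?p m] by linarith
  qed simp
  then show "track_len (map (init_regs w) [0, 1, 2, 3]) = length w" using up by (simp add: track_len_def
      m_def)
qed

lemma game_val_iff:
  assumes "1 \<le> N" "x < 2 ^ blk N"
  shows "game_val N nr RU x \<longleftrightarrow> num_safe N (2 ^ blk N) nr RU N x"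
proof -
  have "0 < blk N" using assms(1) by (simp add: blk_def)
  then show ?thesis
    using tree_val_shift[of "\<lambda>j. odd (j div blk N)" "\<lambda>T. play_val N (2 ^ blk N) nr RU T N = 1" x "blk N *
        (2 * N)" 0]
      tree_val_play_val[of N nr RU N x] assms(2) by (simp add: game_val_def)
qed

lemma decide_iff_constructor_safe:
  assumes wf: "wf_net G" and conn: "connected_net G" and rules: "\<forall>r \<in> set R. wf_rule r" "no_weak_creation R"
    and w: "w = enc_instance (G, R)" "set w \<subseteq> {1..<9}"
  shows "decide (map (init_regs w) [0, 1, 2, 3]) \<longleftrightarrow> constructor_safe R G"
proof -
  define N where "N = length w"
  let ?M = "2 ^ blk N :: nat"
  have N3: "3 \<le> N" by (simp add: N_def w(1) enc_instance_enc3 enc3_def enc_list_def)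
  have len: "track_len (map (init_regs w) [0, 1, 2, 3]) = N" using track_init(2)[OF w(2)] by (simp add: N_def)
  have ch: "track_char (map (init_regs w) [0, 1, 2, 3]) p = w ! p" if "p < N" for p
    using track_init(1)[OF w(2)] that by (simp add: N_def)
  have match: "foldl (match_char N W) 0 s = N \<longleftrightarrow> s = w" if "\<forall>p<N. dig 4 W p = w ! p" for W s
    using foldl_match_char_iff[of w W 0 s] that by (simp add: N_def)
  \<comment> \<open>Every matching description yields the same answer, so the existential search is
    sound in both directions.\<close>
  have key: "game_val N nr RU x \<longleftrightarrow> constructor_safe R G"
    if "K < Suc N" "x < ?M" "num_string N K NM x nr RU = w" "valid_code N K x" for K NM x nr RU
  proof -
    have s: "\<exists>f. Rep N x G f" "R = map (\<lambda>r. rule_of (rule_field N RU r)) [0..<nr]" "card (V G) = K"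
      using num_string_sound[OF wf, of N K NM x nr RU R] that w(1) by auto
    then obtain f where f: "Rep N x G f" by blast
    have "card (V G - Str G) \<le> card (V G)" using wf by (intro card_mono) (auto simp: wf_net_def)
    then have "constructor_safe R G \<longleftrightarrow> safeN R N G"
      using s(3) that(1) by (intro constructor_safe_iff_safeN wf conn rules) simp
    also have "\<dots> \<longleftrightarrow> num_safe N ?M nr RU N x" using num_safe_iff_safeN[OF _ rules s(2) f wf, of N] N3 by simp
    also have "\<dots> \<longleftrightarrow> game_val N nr RU x" using game_val_iff[OF _ that(2)] N3 by simp
    finally show ?thesis by simp
  qed
  have "decide (map (init_regs w) [0, 1, 2, 3]) \<longleftrightarrow> (\<exists>W<2 ^ (4 * N). (\<forall>p<N. dig 4 W p = w ! p) \<and>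
      (\<exists>K<Suc N. \<exists>NM<?M. \<exists>x<?M. \<exists>nr<Suc N. \<exists>RU<?M * ?M. num_string N K NM x nr RU = w \<and>
        valid_code N K x \<and> game_val N nr RU x))"
    unfolding decide_def len using match ch by (intro ex_cong conj_cong refl) auto
  also have "\<dots> \<longleftrightarrow> constructor_safe R G"
  proof
    assume "constructor_safe R G"
    have "w ! p < 2 ^ 4" if "p < N" for p using w(2) nth_mem[of p w] that by (fastforce simp: N_def)
    then obtain W where "W < 2 ^ (4 * N)" "\<forall>p<N. dig 4 W p = w ! p" using ex_dig[of N "\<lambda>p. w ! p" 4] by blast
    moreover obtain K NM x nr RU where "K < Suc N" "NM < ?M" "x < ?M" "nr < Suc N" "RU < ?M * ?M"
      "num_string N K NM x nr RU = w" "valid_code N K x"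
      using num_string_complete[OF wf rules(1), of N] w(1) N_def by blast
    ultimately show "\<exists>W<2 ^ (4 * N). (\<forall>p<N. dig 4 W p = w ! p) \<and>
      (\<exists>K<Suc N. \<exists>NM<?M. \<exists>x<?M. \<exists>nr<Suc N. \<exists>RU<?M * ?M. num_string N K NM x nr RU = w \<and>
        valid_code N K x \<and> game_val N nr RU x)" using key \<open>constructor_safe R G\<close> by blast
  qed (use key in blast)
  finally show ?thesis .
qed

lemma set_enc_nat: "set (enc_nat n) \<subseteq> {1..<9}"
  using set_bits[of n] by (fastforce simp: enc_nat_def)

lemma set_enc_list: "(\<And>x. set (f x) \<subseteq> {1..<9}) \<Longrightarrow> set (enc_list f xs) \<subseteq> {1..<9}"
  by (fastforce simp: enc_list_def)

lemma set_enc_instance: "set (enc_instance (G, R)) \<subseteq> {1..<9}"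
proof -
  have "set (enc_rule r) \<subseteq> {1..<9}" for r
    using set_enc_nat set_enc_list[OF set_enc_nat] by (cases r) fastforce+
  moreover have "set (enc_node p) \<subseteq> {1..<9}" "set (enc_edge q) \<subseteq> {1..<9}" for p q
    using set_enc_nat by (fastforce simp: enc_node_def enc_edge_def case_prod_beta)+
  ultimately show ?thesis unfolding enc_instance_enc3 enc3_def set_append by (intro Un_least set_enc_list)
qed

theorem mainTheorem5:
  shows "in_PSPACE_promise enc_instance
           (\<lambda>(G, R). safety_instance (G, R) \<and> no_weak_creation R)
           (\<lambda>(G, R). constructor_safe R G)"
proof -
  obtain k0 where k0: "PROP implementable_from k0 4 (\<lambda>xs. of_bool (decide xs))"
    using pcE[OF pcb_decide] by blast
  define k where "k = k0 + 1"
  \<comment> \<open>Registers 0 to 3 hold the input, 4 receives the answer, and scratch space starts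
    at 5.\<close>
  have "\<exists>c. implements k (\<lambda>xs. of_bool (decide xs)) [0, 1, 2, 3] 4 5 c"
    by (rule k0) (auto simp: k_def)
  then obtain c where c: "implements k (\<lambda>xs. of_bool (decide xs)) [0, 1, 2, 3] 4 5 c" by blast
  obtain K0 where "regs_below K0 c" using ex_regs_below by blast
  then have K: "regs_below (K0 + 5) c" by (rule regs_below_mono) simp
  obtain M where M: "valid_tm M" "nsyms M = 2 ^ Suc (K0 + 5)" and run:
    "\<And>w B u. set w \<subseteq> {1..<9} \<Longrightarrow> 1 \<le> B \<Longrightarrow> length w \<le> B \<Longrightarrow> exec (2 ^ B) c (init_regs w) u \<Longrightarrow>
      (\<exists>n. halted_state (cstate (tm_run M w n))) \<and>
      (\<forall>n. halted_state (cstate (tm_run M w n)) \<longrightarrow> (cstate (tm_run M w n) = 1 \<longleftrightarrow> odd (u 4))) \<and>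
      (\<forall>n. \<bar>chead (tm_run M w n)\<bar> \<le> int B)"
    using tm_of_program[of "K0 + 5" c 4] K by auto
  have "(2::nat) ^ 5 \<le> 2 ^ Suc (K0 + 5)" by (intro power_increasing) auto
  then have nsyms: "9 \<le> nsyms M" unfolding M(2) by simp
  show ?thesis unfolding in_PSPACE_promise_def
  proof (rule exI[of _ M], rule exI[of _ "2 ^ k"], rule exI[of _ k], intro conjI M(1) allI impI)
    fix x :: "net \<times> rule list"
    assume P: "case x of (G, R) \<Rightarrow> safety_instance (G, R) \<and> no_weak_creation R"
    obtain G R where x: "x = (G, R)" by (cases x)
    have pr: "wf_net G" "connected_net G" "\<forall>r \<in> set R. wf_rule r" "no_weak_creation R"
      using P by (auto simp: x safety_instance_def)
    define w where "w = enc_instance (G, R)"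
    have w: "set w \<subseteq> {1..<9}" unfolding w_def by (rule set_enc_instance)
    define B where "B = (length w + 2) ^ k"
    have "(length w + 2) ^ 1 \<le> B" unfolding B_def by (intro power_increasing) (auto simp: k_def)
    then have B: "1 \<le> B" "length w \<le> B" by simp_all
    let ?u = "(init_regs w)(4 := of_bool (decide (map (init_regs w) [0, 1, 2, 3])))"
    \<comment> \<open>Input symbols have only four bits, so the output and scratch registers are
      zero at the start.\<close>
    have "init_regs w r = 0" if "4 \<le> r" for r
    proof -
      have "w ! i < 16" if "i < length w" for i using w nth_mem[OF that] by fastforce
      then have "\<not> bit (init_regs w r) i" for i using nat_less_16_high that by (auto simp: bit_init_regs)
      then show ?thesis by (rule bits_all_zero)
    qed
    then have "exec (2 ^ B) c (init_regs w) ?u"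
      using init_regs_less by (intro implementsD[OF c, where L = "length w"]) (auto simp: B_def bnd_def)
    note r = run[OF w B this]
    have dec: "odd (?u 4) \<longleftrightarrow> constructor_safe R G"
      using decide_iff_constructor_safe[OF pr w_def w] by simp
    \<comment> \<open>Uses that \<open>length w + 2\<close> is at most
      \<open>2 * (length w + 1)\<close>, which explains the factor \<open>2 ^ k\<close>.\<close>
    have "B \<le> 2 ^ k * (length w + 1) ^ k" unfolding B_def power_mult_distrib[symmetric] by (intro
        power_mono) auto
    then have bd: "int B \<le> int (2 ^ k * (length w + 1) ^ k)" by (simp only: of_nat_le_iff)
    show "set (enc_instance x) \<subseteq> {1..<nsyms M}" using w nsyms by (fastforce simp: x w_def)
    show "\<exists>n. halted_state (cstate (tm_run M (enc_instance x) n))" using r by (simp add: x w_def)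
    show "cstate (tm_run M (enc_instance x) n) = 1 \<longleftrightarrow> (case x of (G, R) \<Rightarrow> constructor_safe R G)"
      if "halted_state (cstate (tm_run M (enc_instance x) n))" for n
      using r dec that by (simp add: x w_def)
    show "\<bar>chead (tm_run M (enc_instance x) n)\<bar> \<le> int (2 ^ k * (length (enc_instance x) + 1) ^ k)" for n
      using r bd order_trans unfolding x w_def by blast
  qed
qed

end
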